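(* For every permutation $(a,b,c)$ of $(2,1,0)$, all the spaces $\Delta_a(\ker\Delta_b\cap\ker\Delta_c)$, $\langle\Delta_a,\Delta_b\rangle(\ker\Delta_c)$, $\langle\Delta_a,\Delta_b,\Delta_c\rangle(\mathcal C)$, $\Delta_b(\ker\Delta_c)$, $\langle\Delta_b,\Delta_c\rangle(\mathcal C)$ and $\Delta_c(\mathcal C)$ are hereditarily $\ell_2$.
   Context: All spaces are complex. For the couple $(X_0,X_1)=(\ell_\infty,\ell_1)$ put $\Sigma=\ell_\infty+\ell_1$. The Calderón space $\mathcal C$ of the couple is the Banach space of bounded continuous functions $F:\{z\in\mathbb C:0\le \mathrm{Re}\,z\le 1\}\to\Sigma$, analytic on the open strip, such that for $j=0,1$ the map $t\mapsto F(j+it)$ is continuous from $\mathbb R$ into $X_j$ and tends to $0$ as $|t|\to\infty$, with norm $\|F\|=\max_{j=0,1}\sup_{t}\|F(j+it)\|_{X_j}$. For $k=0,1,2$ let $\Delta_k:\mathcal C\to\Sigma$, $\Delta_k(F)=F^{(k)}(1/2)/k!$, and for distinct indices $\langle\Delta_a,\Delta_b\rangle(F)=(\Delta_aF,\Delta_bF)$, $\langle\Delta_a,\Delta_b,\Delta_c\rangle(F)=(\Delta_aF,\Delta_bF,\Delta_cF)$. For a closed subspace $K\subset\mathcal C$ and one of these maps $T$, the space $T(K)$ carries the quotient norm $\|x\|=\inf\{\|F\|:F\in K,\ TF=x\}$. A Banach space $X$ is hereditarily $\ell_2$ if every infinite dimensional closed subspace of $X$ contains a subspace isomorphic to $\ell_2$.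 *)

theory Defs
  imports "HOL-Analysis.Analysis"
begin

section \<open>The complex sequence spaces\<close>

text \<open>Since \<open>nat\<close> is discrete, this type is the space of all bounded complex sequences with the
  supremum norm. The library makes it a real Banach space; the complex structure is added here.\<close>

type_synonym linf = "(nat, complex) bcontfun"

definition scale_linf :: "complex \<Rightarrow> linf \<Rightarrow> linf" where
  "scale_linf c x = Bcontfun (\<lambda>n. c * apply_bcontfun x n)"

lemma apply_scale_linf [simp]:
  "apply_bcontfun (scale_linf c x) n = c * apply_bcontfun x n"
proof -
  have "(\<lambda>n. c * apply_bcontfun x n) \<in> bcontfun"
    by (rule bcontfun_normI[where b = "norm c * norm x"])
       (auto simp: norm_mult intro!: mult_left_mono norm_bounded)
  then show ?thesis
    by (simp add: scale_linf_def Bcontfun_inverse)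
qed

lemma vector_space_scale_linf: "vector_space scale_linf"
  by unfold_locales (auto intro!: bcontfun_eqI simp: algebra_simps)

lemma norm_scale_linf: "norm (scale_linf c x) = norm c * norm x"
proof -
  have le: "norm (scale_linf c x) \<le> norm c * norm x" for c x
    by (rule norm_bound) (auto simp: norm_mult intro!: mult_left_mono norm_bounded)
  show ?thesis
  proof (cases "c = 0")
    case True
    then show ?thesis using le[of c x] by simp
  next
    case False
    have "x = scale_linf (inverse c) (scale_linf c x)"
      using False by (auto intro!: bcontfun_eqI)
    then have "norm x \<le> norm (inverse c) * norm (scale_linf c x)"
      using le by metis
    then have "norm c * norm x \<le> norm (scale_linf c x)"
      using False by (simp add: norm_inverse norm_divide field_simps)
    then show ?thesis using le[of c x] by simp
  qed
qed

definition l1 :: "linf set" where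
  "l1 = {x. summable (\<lambda>n. cmod (apply_bcontfun x n))}"

definition l1_norm :: "linf \<Rightarrow> real" where
  "l1_norm x = (\<Sum>n. cmod (apply_bcontfun x n))"

definition l2 :: "linf set" where
  "l2 = {x. summable (\<lambda>n. (cmod (apply_bcontfun x n))\<^sup>2)}"

definition l2_norm :: "linf \<Rightarrow> real" where
  "l2_norm x = sqrt (\<Sum>n. (cmod (apply_bcontfun x n))\<^sup>2)"

text \<open>The sum of the couple is \<open>linf\<close> itself, isometrically, so that \<open>linf\<close> with its norm is used
  for it below.\<close>

lemma norm_le_l1_norm:
  assumes "x \<in> l1"
  shows "norm x \<le> l1_norm x"
proof (rule norm_bound)
  fix n
  show "norm (apply_bcontfun x n) \<le> l1_norm x"
    using sum_le_suminf[of "\<lambda>n. cmod (apply_bcontfun x n)" "{n}"] assms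
    by (auto simp: l1_def l1_norm_def)
qed

lemma sum_norm_linf_l1:
  fixes x :: linf
  shows "Inf {norm u + l1_norm v | u v. v \<in> l1 \<and> x = u + v} = norm x"
proof (rule cInf_eq_minimum)
  have "0 \<in> l1" "l1_norm 0 = 0"
    by (auto simp: l1_def l1_norm_def)
  then show "norm x \<in> {norm u + l1_norm v | u v. v \<in> l1 \<and> x = u + v}"
    by force
next
  fix r assume "r \<in> {norm u + l1_norm v | u v. v \<in> l1 \<and> x = u + v}"
  then obtain u v where "r = norm u + l1_norm v" "v \<in> l1" "x = u + v"
    by blast
  then show "norm x \<le> r"
    using norm_le_l1_norm[of v] norm_triangle_ineq[of u v] by simp
qed

section \<open>The Calderon space and the maps \<open>Delta\<close>\<close>

text \<open>As for \<open>has_field_derivative\<close>: a Frechet derivative that is complex linear.\<close>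

definition has_cderiv :: "(complex \<Rightarrow> linf) \<Rightarrow> linf \<Rightarrow> complex \<Rightarrow> bool" where
  "has_cderiv F D z \<longleftrightarrow> (F has_derivative (\<lambda>h. scale_linf h D)) (at z)"

definition cderiv :: "(complex \<Rightarrow> linf) \<Rightarrow> complex \<Rightarrow> linf" where
  "cderiv F z = (SOME D. has_cderiv F D z)"

definition strip :: "complex set" where
  "strip = {z. 0 \<le> Re z \<and> Re z \<le> 1}"

definition open_strip :: "complex set" where
  "open_strip = {z. 0 < Re z \<and> Re z < 1}"

definition continuous_vanishing :: "linf set \<Rightarrow> (linf \<Rightarrow> real) \<Rightarrow> (real \<Rightarrow> linf) \<Rightarrow> bool" where
  "continuous_vanishing X N f \<longleftrightarrow>
     range f \<subseteq> X \<and>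
     (\<forall>t. ((\<lambda>s. N (f s - f t)) \<longlongrightarrow> 0) (at t)) \<and>
     ((\<lambda>t. N (f t)) \<longlongrightarrow> 0) at_infinity"

text \<open>A function on the closed strip is represented by its extension by zero to the whole plane.\<close>

definition calderon :: "(complex \<Rightarrow> linf) set" where
  "calderon = {F.
     (\<forall>z. z \<notin> strip \<longrightarrow> F z = 0) \<and>
     bounded (F ` strip) \<and>
     continuous_on strip F \<and>
     (\<forall>z\<in>open_strip. \<exists>D. has_cderiv F D z) \<and>
     continuous_vanishing UNIV norm (\<lambda>t. F (Complex 0 t)) \<and>
     continuous_vanishing l1 l1_norm (\<lambda>t. F (Complex 1 t))}"

definition calderon_norm :: "(complex \<Rightarrow> linf) \<Rightarrow> real" where
  "calderon_norm F = max (SUP t. norm (F (Complex 0 t))) (SUP t. l1_norm (F (Complex 1 t)))"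

definition Delta :: "nat \<Rightarrow> (complex \<Rightarrow> linf) \<Rightarrow> linf" where
  "Delta k F = (cderiv ^^ k) F (1/2) /\<^sub>R fact k"

definition Delta2 :: "nat \<Rightarrow> nat \<Rightarrow> (complex \<Rightarrow> linf) \<Rightarrow> linf \<times> linf" where
  "Delta2 a b F = (Delta a F, Delta b F)"

definition Delta3 :: "nat \<Rightarrow> nat \<Rightarrow> nat \<Rightarrow> (complex \<Rightarrow> linf) \<Rightarrow> linf \<times> linf \<times> linf" where
  "Delta3 a b c F = (Delta a F, Delta b F, Delta c F)"

definition ker_Delta :: "nat \<Rightarrow> (complex \<Rightarrow> linf) set" where
  "ker_Delta k = {F \<in> calderon. Delta k F = 0}"

definition quotient_norm ::
  "((complex \<Rightarrow> linf) \<Rightarrow> 'v) \<Rightarrow> (complex \<Rightarrow> linf) set \<Rightarrow> 'v \<Rightarrow> real" where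
  "quotient_norm T K x = Inf {calderon_norm F | F. F \<in> K \<and> T F = x}"

abbreviation scale_linf2 :: "complex \<Rightarrow> linf \<times> linf \<Rightarrow> linf \<times> linf" where
  "scale_linf2 \<equiv> module_prod.scale scale_linf scale_linf"

abbreviation scale_linf3 :: "complex \<Rightarrow> linf \<times> linf \<times> linf \<Rightarrow> linf \<times> linf \<times> linf" where
  "scale_linf3 \<equiv> module_prod.scale scale_linf scale_linf2"

section \<open>Hereditarily \<open>l2\<close> spaces\<close>

text \<open>A complex normed space is given by a scalar multiplication \<open>s\<close> on an ambient type,
  a carrier \<open>V\<close> and a function \<open>N\<close> whose values matter only on \<open>V\<close>.\<close>

definition closed_subspace ::
  "(complex \<Rightarrow> 'v::ab_group_add \<Rightarrow> 'v) \<Rightarrow> 'v set \<Rightarrow> ('v \<Rightarrow> real) \<Rightarrow> 'v set \<Rightarrow> bool" where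
  "closed_subspace s V N Y \<longleftrightarrow>
     module.subspace s Y \<and> Y \<subseteq> V \<and>
     (\<forall>y\<in>V. (\<forall>e>0. \<exists>x\<in>Y. N (y - x) < e) \<longrightarrow> y \<in> Y)"

definition infinite_dimensional ::
  "(complex \<Rightarrow> 'v::ab_group_add \<Rightarrow> 'v) \<Rightarrow> 'v set \<Rightarrow> bool" where
  "infinite_dimensional s Y \<longleftrightarrow> \<not> (\<exists>B. finite B \<and> Y \<subseteq> module.span s B)"

definition isomorphic_spaces ::
  "(complex \<Rightarrow> 'v::ab_group_add \<Rightarrow> 'v) \<Rightarrow> 'v set \<Rightarrow> ('v \<Rightarrow> real) \<Rightarrow>
   (complex \<Rightarrow> 'w::ab_group_add \<Rightarrow> 'w) \<Rightarrow> 'w set \<Rightarrow> ('w \<Rightarrow> real) \<Rightarrow> bool" where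
  "isomorphic_spaces s V N s' W M \<longleftrightarrow>
     (\<exists>T. bij_betw T V W \<and>
        (\<forall>x\<in>V. \<forall>y\<in>V. T (x + y) = T x + T y) \<and>
        (\<forall>c. \<forall>x\<in>V. T (s c x) = s' c (T x)) \<and>
        (\<exists>A. \<forall>x\<in>V. M (T x) \<le> A * N x) \<and>
        (\<exists>B. \<forall>x\<in>V. N x \<le> B * M (T x)))"

definition hereditarily_l2 ::
  "(complex \<Rightarrow> 'v::ab_group_add \<Rightarrow> 'v) \<Rightarrow> 'v set \<Rightarrow> ('v \<Rightarrow> real) \<Rightarrow> bool" where
  "hereditarily_l2 s V N \<longleftrightarrow>
     (\<forall>Y. closed_subspace s V N Y \<and> infinite_dimensional s Y \<longrightarrow>
        (\<exists>Z. module.subspace s Z \<and> Z \<subseteq> Y \<and> isomorphic_spaces scale_linf l2 l2_norm s Z N))"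

definition image_hereditarily_l2 ::
  "(complex \<Rightarrow> 'v::ab_group_add \<Rightarrow> 'v) \<Rightarrow> ((complex \<Rightarrow> linf) \<Rightarrow> 'v) \<Rightarrow>
   (complex \<Rightarrow> linf) set \<Rightarrow> bool" where
  "image_hereditarily_l2 s T K \<longleftrightarrow> hereditarily_l2 s (T ` K) (quotient_norm T K)"

end

theory Submission
  imports Defs "HOL-Complex_Analysis.Complex_Analysis" "HOL-Library.Function_Algebras"
begin

text \<open>With \<open>w = z - 1/2\<close>, a function \<open>F\<close> in the unit ball has coordinates
  \<open>b x\<^sub>0 + w b x\<^sub>1 + w\<^sup>2 (x\<^sub>2 + O(w))\<close>, where \<open>b x\<close> is \<open>x |x| ^ (2 w)\<close> up to a decay factor, and \<open>x\<^sub>0, x\<^sub>1, x\<^sub>2\<close>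
  are bounded in \<open>\<ell>\<^sub>2\<close>. Hence if a set \<open>B\<close> of the \<open>\<Delta>\<close> is required to vanish, the quotient norm of a
  single further \<open>\<Delta>\<^sub>a\<close> is, in the cases needed, that of an Orlicz sequence space with function
  \<open>(t / |ln t| ^ k)\<^sup>2\<close> near 0, in which blocks with rapidly decreasing sup norms span \<open>\<ell>\<^sub>2\<close>.
  A three-space argument for block sequences extends the existence of such blocks to several
  \<open>\<Delta>\<close> at once. A gliding hump reduces closed subspaces to block sequences. Since the spaces with
  vanishing conditions sit isometrically in those without, only the seven nonempty sets of indices
  have to be treated.\<close>

section \<open>The three lines theorem\<close>

text \<open>The logarithms come from \<open>exp (L * (z - 1/2))\<close>, whose Taylor coefficients
  at the midpoint are 1, \<open>L\<close>, \<open>L\<^sup>2 / 2\<close>: an entry x is carried with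
  L = 2 ln |x|, so each order of differentiation may gain a factor ln |x|, and the resulting Orlicz
  function is not homogeneous. Decreasing sup norms repair this. If the entries of the j-th block
  are at most exp (- (j + 2)), a coefficient of modulus above 2^(-j) changes the relevant logarithms
  only by a bounded factor, and smaller coefficients are square summable in any case. A second
  obstacle is that the conditions \<open>Delta b F = 0\<close> are nonlinear in the \<ell>_2 data of
  the decomposition. Adding indices in increasing order leaves just one truly nonlinear condition,
  \<open>Delta 1 F = 0\<close> without \<open>Delta 0 F = 0\<close>, and it can be solved. Vectors
  are kept as functions with seminorms instead of elements of quotients: coordinate projections act
  on functions, and the jet spaces are represented by seminorms on one vector space, so that they
  can be compared.\<close>

lemma open_strip_subset: "open_strip \<subseteq> strip"
  by (auto simp: open_strip_def strip_def)

lemma open_open_strip: "open open_strip"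
proof -
  have *: "open_strip = {z. 0 < Re z} \<inter> {z. Re z < 1}"
    by (auto simp: open_strip_def)
  show ?thesis
    unfolding * by (intro open_Int open_halfspace_Re_gt open_halfspace_Re_lt)
qed

lemma half_in_open_strip [simp]: "1/2 \<in> open_strip"
  by (simp add: open_strip_def)

lemma half_in_strip [simp]: "1/2 \<in> strip"
  by (simp add: strip_def)

lemma edge_in_strip [simp]: "Complex 0 t \<in> strip" "Complex 1 t \<in> strip"
  by (auto simp: strip_def)

lemma norm_exp_square_shift:
  "cmod (exp (of_real e * (z - 1/2)\<^sup>2)) = exp (e * ((Re z - 1/2)\<^sup>2 - (Im z)\<^sup>2))"
  by (simp add: Re_power2)

lemma Re_shift_square_le:
  assumes "z \<in> strip"
  shows "(Re z - 1/2)\<^sup>2 \<le> 1/4"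
proof -
  have "\<bar>Re z - 1/2\<bar> \<le> 1/2"
    using assms by (auto simp: strip_def abs_if)
  then have "\<bar>Re z - 1/2\<bar>\<^sup>2 \<le> (1/2)\<^sup>2"
    by (intro power_mono) auto
  then show ?thesis by (simp add: power2_eq_square)
qed

text \<open>The factor \<open>exp (e * (z - 1/2)\<^sup>2)\<close> decays like a Gaussian in
  \<open>Im z\<close> and is at most \<open>exp (e/4)\<close> in modulus on the strip, so the
  maximum principle on a tall rectangle suffices.\<close>

lemma three_lines_aux:
  assumes "continuous_on strip f" "f holomorphic_on open_strip"
    and M: "\<And>z. z \<in> strip \<Longrightarrow> cmod (f z) \<le> M"
    and B0: "\<And>t. cmod (f (Complex 0 t)) \<le> B" and B1: "\<And>t. cmod (f (Complex 1 t)) \<le> B"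
    and "B > 0" and z: "z \<in> strip" and "e > 0"
  shows "cmod (f z * exp (of_real e * (z - 1/2)\<^sup>2)) \<le> B * exp (e/4)"
proof -
  \<comment> \<open>On the horizontal sides the decay \<open>exp (- e * R\<^sup>2)\<close> has to
    bring the global bound \<open>M\<close> below \<open>B\<close>. As \<open>R \<ge> 1\<close>,
    also \<open>R\<^sup>2 \<ge> \<bar>M\<bar> / (B * e)\<close>, and x \<le> exp x finishes.\<close>
  define R where "R = \<bar>Im z\<bar> + 1 + \<bar>M\<bar> / (B * e)"
  define S where "S = cbox (Complex 0 (-R)) (Complex 1 R)"
  let ?g = "\<lambda>z. f z * exp (of_real e * (z - 1/2)\<^sup>2)"
  have R1: "R \<ge> 1" "R \<ge> \<bar>Im z\<bar>" "R \<ge> \<bar>M\<bar> / (B * e)"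
    using \<open>B > 0\<close> \<open>e > 0\<close> by (auto simp: R_def)
  have "R * 1 \<le> R * R" using R1 by (intro mult_left_mono) auto
  then have "\<bar>M\<bar> / (B * e) \<le> R\<^sup>2" using R1(3) unfolding power2_eq_square by linarith
  then have "\<bar>M\<bar> / B \<le> e * R\<^sup>2"
    using \<open>B > 0\<close> \<open>e > 0\<close> by (simp add: field_simps)
  also have "\<dots> \<le> exp (e * R\<^sup>2)" using exp_ge_add_one_self[of "e * R\<^sup>2"] by linarith
  finally have MR: "\<bar>M\<bar> \<le> B * exp (e * R\<^sup>2)"
    using \<open>B > 0\<close> by (simp add: field_simps)
  have SS: "S \<subseteq> strip" "interior S \<subseteq> open_strip"
    by (auto simp: S_def strip_def open_strip_def in_cbox_complex_iff in_box_complex_iff interior_cbox)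
  show ?thesis
  proof (rule maximum_modulus_frontier[of ?g S])
    show "?g holomorphic_on interior S"
      using holomorphic_on_subset[OF assms(2) SS(2)] by (intro holomorphic_intros) auto
    show "continuous_on (closure S) ?g"
      using continuous_on_subset[OF assms(1) SS(1)] by (auto simp: S_def intro!: continuous_intros)
    show "bounded S" by (simp add: S_def bounded_cbox)
    show "z \<in> S" using z R1 by (auto simp: S_def in_cbox_complex_iff strip_def)
    fix u assume u: "u \<in> frontier S"
    then have us: "u \<in> strip" using SS by (auto simp: frontier_def S_def)
    have "(Re u = 0 \<or> Re u = 1) \<or> \<bar>Im u\<bar> = R"
      using u by (auto simp: frontier_def S_def interior_cbox in_cbox_complex_iff in_box_complex_iff)
    then show "cmod (?g u) \<le> B * exp (e/4)"
    proof
      assume "Re u = 0 \<or> Re u = 1"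
      then have "u = Complex 0 (Im u) \<or> u = Complex 1 (Im u)" by (auto simp: complex_eq_iff)
      then have "cmod (f u) \<le> B" using B0[of "Im u"] B1[of "Im u"] by metis
      moreover have "cmod (exp (of_real e * (u - 1/2)\<^sup>2)) \<le> exp (e/4)"
      proof -
        have "(Re u - 1/2)\<^sup>2 - (Im u)\<^sup>2 \<le> 1/4"
          using Re_shift_square_le[OF us] zero_le_power2[of "Im u"] by linarith
        then have "e * ((Re u - 1/2)\<^sup>2 - (Im u)\<^sup>2) \<le> e * (1/4)"
          using \<open>e > 0\<close> by (intro mult_left_mono) auto
        then show ?thesis unfolding norm_exp_square_shift by simp
      qed
      ultimately show ?thesis using \<open>B > 0\<close> by (simp only: norm_mult) (intro mult_mono, auto)
    next
      assume "\<bar>Im u\<bar> = R"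
      then have "(Im u)\<^sup>2 = R\<^sup>2" by (metis power2_abs)
      then have "(Re u - 1/2)\<^sup>2 - (Im u)\<^sup>2 \<le> 1/4 - R\<^sup>2"
        using Re_shift_square_le[OF us] by linarith
      then have "e * ((Re u - 1/2)\<^sup>2 - (Im u)\<^sup>2) \<le> e * (1/4 - R\<^sup>2)"
        using \<open>e > 0\<close> by (intro mult_left_mono) auto
      then have "cmod (exp (of_real e * (u - 1/2)\<^sup>2)) \<le> exp (e/4 - e * R\<^sup>2)"
        unfolding norm_exp_square_shift by (simp add: algebra_simps)
      moreover have "cmod (f u) \<le> B * exp (e * R\<^sup>2)" using M[OF us] MR by linarith
      ultimately have "cmod (?g u) \<le> (B * exp (e * R\<^sup>2)) * exp (e/4 - e * R\<^sup>2)"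
        using \<open>B > 0\<close> by (simp only: norm_mult) (intro mult_mono, auto)
      then show ?thesis by (simp add: exp_diff)
    qed
  qed
qed

text \<open>The point \<open>z\<close> stays fixed while the Gaussian parameter \<open>e\<close>
  tends to 0. The detour through all \<open>C > B\<close> supplies the strictly positive bound that
  \<open>three_lines_aux\<close> asks for, since \<open>B\<close> may be 0.\<close>

lemma three_lines:
  assumes "continuous_on strip f" "f holomorphic_on open_strip" "bounded (f ` strip)"
    and "\<And>t. cmod (f (Complex 0 t)) \<le> B" "\<And>t. cmod (f (Complex 1 t)) \<le> B"
    and z: "z \<in> strip"
  shows "cmod (f z) \<le> B"
proof -
  obtain M where M: "\<And>z. z \<in> strip \<Longrightarrow> cmod (f z) \<le> M"
    using assms(3) by (auto simp: bounded_iff)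
  have *: "cmod (f z) \<le> C" if "B < C" for C
  proof -
    have C: "C > 0" using that assms(4)[of 0] norm_ge_zero[of "f (Complex 0 0)"] by linarith
    have "((\<lambda>e. C * exp (e/4)) \<longlongrightarrow> C * exp (0/4)) (at_right 0)"
      by (intro tendsto_intros) auto
    moreover have "((\<lambda>e. cmod (f z * exp (of_real e * (z - 1/2)\<^sup>2))) \<longlongrightarrow>
        cmod (f z * exp (of_real 0 * (z - 1/2)\<^sup>2))) (at_right 0)"
      by (intro tendsto_intros)
    moreover have "\<forall>\<^sub>F e in at_right 0. cmod (f z * exp (of_real e * (z - 1/2)\<^sup>2)) \<le> C * exp (e/4)"
      using eventually_at_right_less[of "0::real"]
    proof eventually_elim
      case (elim e)
      show ?case
        by (rule three_lines_aux[OF assms(1,2) M _ _ C z elim])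
           (use assms(4,5) that in \<open>meson less_imp_le order_trans\<close>)+
    qed
    ultimately have "cmod (f z * exp (of_real 0 * (z - 1/2)\<^sup>2)) \<le> C * exp (0/4)"
      by (intro tendsto_le[OF trivial_limit_at_right_real])
    then show ?thesis by simp
  qed
  show ?thesis by (rule dense_ge) (use * in auto)
qed

section \<open>Bounded analytic scalar functions on the strip\<close>

definition strip_fun :: "(complex \<Rightarrow> complex) \<Rightarrow> bool" where
  "strip_fun f \<longleftrightarrow> continuous_on strip f \<and> f holomorphic_on open_strip \<and> bounded (f ` strip)"

lemma strip_fun_bound:
  assumes "strip_fun f"
  obtains M where "M > 0" "\<And>z. z \<in> strip \<Longrightarrow> cmod (f z) \<le> M"
  using assms unfolding strip_fun_def bounded_pos by auto

lemma strip_funI: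
  assumes "continuous_on strip f" "f holomorphic_on open_strip"
    and "\<And>z. z \<in> strip \<Longrightarrow> cmod (f z) \<le> M"
  shows "strip_fun f"
  using assms by (auto simp: strip_fun_def bounded_iff)

lemma strip_fun_add:
  assumes "strip_fun f" "strip_fun g"
  shows "strip_fun (\<lambda>z. f z + g z)"
proof -
  obtain M where M: "\<And>z. z \<in> strip \<Longrightarrow> cmod (f z) \<le> M"
    using strip_fun_bound[OF assms(1)] by blast
  obtain N where N: "\<And>z. z \<in> strip \<Longrightarrow> cmod (g z) \<le> N"
    using strip_fun_bound[OF assms(2)] by blast
  show ?thesis
  proof (rule strip_funI)
    show "cmod (f z + g z) \<le> M + N" if "z \<in> strip" for z
      by (rule order_trans[OF norm_triangle_ineq add_mono[OF M N]]) (rule that)+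
  qed (use assms in \<open>auto simp: strip_fun_def intro: continuous_intros holomorphic_intros\<close>)
qed

lemma strip_fun_mult:
  assumes "strip_fun f" "strip_fun g"
  shows "strip_fun (\<lambda>z. f z * g z)"
proof -
  obtain M where M: "\<And>z. z \<in> strip \<Longrightarrow> cmod (f z) \<le> M" "M > 0"
    using strip_fun_bound[OF assms(1)] by blast
  obtain N where N: "\<And>z. z \<in> strip \<Longrightarrow> cmod (g z) \<le> N"
    using strip_fun_bound[OF assms(2)] by blast
  show ?thesis
  proof (rule strip_funI)
    show "cmod (f z * g z) \<le> M * N" if "z \<in> strip" for z
      unfolding norm_mult using M N that by (intro mult_mono) auto
  qed (use assms in \<open>auto simp: strip_fun_def intro: continuous_intros holomorphic_intros\<close>)
qed

lemma strip_fun_const: "strip_fun (\<lambda>z. c)"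
  by (rule strip_funI[where M = "cmod c"]) auto

lemma strip_fun_sum:
  "(\<And>i. i \<in> I \<Longrightarrow> strip_fun (f i)) \<Longrightarrow> strip_fun (\<lambda>z. \<Sum>i\<in>I. f i z)"
  by (induction I rule: infinite_finite_induct) (auto intro: strip_fun_const strip_fun_add)

text \<open>For c > 0 this is \<open>c\<close> to the power 2z - 1, the usual weight of complex
  interpolation: 1 at the midpoint, of modulus 1/c on the left edge and c on the right one.\<close>

definition pw :: "real \<Rightarrow> complex \<Rightarrow> complex" where
  "pw c z = exp (of_real (2 * ln c) * (z - 1/2))"

lemma norm_pw: "cmod (pw c z) = exp (ln c * (2 * Re z - 1))"
  by (simp add: pw_def algebra_simps)

lemma pw_half [simp]: "pw c (1/2) = 1"
  by (simp add: pw_def)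

lemma norm_pw_left: "c > 0 \<Longrightarrow> cmod (pw c (Complex 0 t)) = 1 / c"
  unfolding norm_pw by (simp add: exp_minus divide_inverse)

lemma norm_pw_right: "c > 0 \<Longrightarrow> cmod (pw c (Complex 1 t)) = c"
  by (simp add: norm_pw)

lemma strip_fun_pw: "strip_fun (pw c)"
proof (rule strip_funI[where M = "exp \<bar>ln c\<bar>"])
  show "continuous_on strip (pw c)" "pw c holomorphic_on open_strip"
    unfolding pw_def by (intro continuous_intros holomorphic_intros)+
  fix z assume z: "z \<in> strip"
  have "\<bar>ln c\<bar> * \<bar>2 * Re z - 1\<bar> \<le> \<bar>ln c\<bar> * 1"
    using z by (intro mult_left_mono) (auto simp: strip_def abs_if)
  then show "cmod (pw c z) \<le> exp \<bar>ln c\<bar>"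
    by (simp add: norm_pw flip: abs_mult)
qed

text \<open>One half of the fact that the midpoint space between \<ell>_\<infinity> and \<ell>_1 is
  \<ell>_2. The midpoint values are paired with their own conjugates, each term carrying a weight
  \<open>pw\<close> that trades one edge against the other, and the three lines theorem is applied
  to the scalar sum \<open>h\<close>.\<close>

lemma sum_norm_square_le:
  fixes f :: "nat \<Rightarrow> complex \<Rightarrow> complex"
  assumes "finite S" and sf: "\<And>n. n \<in> S \<Longrightarrow> strip_fun (f n)"
    and A: "\<And>n t. n \<in> S \<Longrightarrow> cmod (f n (Complex 0 t)) \<le> A"
    and B: "\<And>t. (\<Sum>n\<in>S. cmod (f n (Complex 1 t))) \<le> B"
    and "A > 0" "B > 0"
  shows "(\<Sum>n\<in>S. (cmod (f n (1/2)))\<^sup>2) \<le> A * B"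
proof -
  define x where "x n = f n (1/2)" for n
  define S' where "S' = {n\<in>S. x n \<noteq> 0}"
  have fin: "finite S'" using assms(1) by (auto simp: S'_def)
  define s where "s = (\<Sum>n\<in>S'. (cmod (x n))\<^sup>2)"
  have s: "(\<Sum>n\<in>S. (cmod (f n (1/2)))\<^sup>2) = s"
    unfolding s_def x_def[symmetric] S'_def using assms(1) by (intro sum.mono_neutral_right) auto
  have "s \<ge> 0" by (auto simp: s_def intro: sum_nonneg)
  show ?thesis
  proof (cases "s = 0")
    case True
    then show ?thesis using s assms by simp
  next
    case False
    then have "s > 0" using \<open>s \<ge> 0\<close> by simp
    \<comment> \<open>The function \<open>h\<close> below is bounded by \<open>A * s / k\<close> on
      the left edge and by \<open>k * B\<close> on the right one; this \<open>k\<close> makes the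
      two bounds equal.\<close>
    define k where "k = sqrt (A * s / B)"
    have k: "k > 0" using \<open>s > 0\<close> assms by (simp add: k_def)
    have k2: "k\<^sup>2 = A * s / B" using \<open>s > 0\<close> assms by (simp add: k_def)
    have kk: "A * s / k = k * B"
    proof -
      have "A * s = k\<^sup>2 * B" using k2 \<open>B > 0\<close> by simp
      then show ?thesis using k by (simp add: power2_eq_square)
    qed
    define h where "h z = (\<Sum>n\<in>S'. f n z * (cnj (x n) * pw (k / cmod (x n)) z))" for z
    have sh: "strip_fun h"
      unfolding h_def using sf
      by (intro strip_fun_sum strip_fun_mult strip_fun_const strip_fun_pw) (auto simp: S'_def)
    have "cmod (h (1/2)) \<le> k * B"
    proof (rule three_lines[where f = h and z = "1/2"])
      fix t
      have "cmod (h (Complex 0 t)) \<le> (\<Sum>n\<in>S'. A * (cmod (x n))\<^sup>2 / k)"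
        unfolding h_def
      proof (rule sum_norm_le)
        fix n assume n: "n \<in> S'"
        then have "x n \<noteq> 0" by (auto simp: S'_def)
        then have "cmod (f n (Complex 0 t) * (cnj (x n) * pw (k / cmod (x n)) (Complex 0 t)))
          = cmod (f n (Complex 0 t)) * ((cmod (x n))\<^sup>2 / k)"
          using k by (simp add: norm_mult norm_pw_left power2_eq_square)
        also have "\<dots> \<le> A * ((cmod (x n))\<^sup>2 / k)"
          using n k A by (intro mult_right_mono) (auto simp: S'_def)
        finally show "cmod (f n (Complex 0 t) * (cnj (x n) * pw (k / cmod (x n)) (Complex 0 t)))
          \<le> A * (cmod (x n))\<^sup>2 / k" by simp
      qed
      also have "\<dots> = A * s / k"
        by (simp add: s_def sum_divide_distrib sum_distrib_left)
      finally show "cmod (h (Complex 0 t)) \<le> k * B" using kk by simp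
      have "cmod (h (Complex 1 t)) \<le> (\<Sum>n\<in>S'. k * cmod (f n (Complex 1 t)))"
        unfolding h_def
      proof (rule sum_norm_le)
        fix n assume n: "n \<in> S'"
        then have "x n \<noteq> 0" by (auto simp: S'_def)
        then show "cmod (f n (Complex 1 t) * (cnj (x n) * pw (k / cmod (x n)) (Complex 1 t)))
          \<le> k * cmod (f n (Complex 1 t))"
          using k by (simp add: norm_mult norm_pw_right)
      qed
      also have "\<dots> \<le> k * (\<Sum>n\<in>S. cmod (f n (Complex 1 t)))"
        unfolding sum_distrib_left[symmetric] using k assms(1)
        by (intro mult_left_mono sum_mono2) (auto simp: S'_def)
      also have "\<dots> \<le> k * B" using k B by (intro mult_left_mono) auto
      finally show "cmod (h (Complex 1 t)) \<le> k * B" .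
    qed (use sh in \<open>auto simp: strip_fun_def\<close>)
    moreover have "h (1/2) = of_real s"
    proof -
      have "h (1/2) = (\<Sum>n\<in>S'. x n * cnj (x n))" by (simp add: h_def x_def)
      then show ?thesis by (simp add: s_def complex_norm_square del: of_real_power)
    qed
    ultimately have "s \<le> k * B" using \<open>s > 0\<close> by simp
    then have "s\<^sup>2 \<le> (k * B)\<^sup>2" using \<open>s > 0\<close> by (intro power_mono) auto
    also have "\<dots> = A * s * B" unfolding power_mult_distrib k2 using \<open>B > 0\<close> by (simp add: power2_eq_square)
    finally have "s \<le> A * B" using \<open>s > 0\<close> by (simp add: power2_eq_square)
    then show ?thesis using s by simp
  qed
qed

section \<open>Jets at the midpoint of the strip\<close>

text \<open>Both edges have distance at least 1/2 from the midpoint, so dividing out the zero at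
  most doubles the edge values. The quotient is bounded near the midpoint by compactness, and
  elsewhere by the bound of \<open>f\<close> divided by the radius.\<close>

lemma strip_fun_divide:
  assumes f: "strip_fun f" and "f (1/2) = 0"
  obtains g where "strip_fun g" "\<And>z. z \<in> strip \<Longrightarrow> f z = (z - 1/2) * g z"
    "\<And>t. cmod (g (Complex 0 t)) \<le> 2 * cmod (f (Complex 0 t))"
    "\<And>t. cmod (g (Complex 1 t)) \<le> 2 * cmod (f (Complex 1 t))"
proof -
  define g where "g z = (if z = 1/2 then deriv f (1/2) else f z / (z - 1/2))" for z
  have fg: "f z = (z - 1/2) * g z" for z
  proof (cases "z = 1/2")
    case True
    show ?thesis unfolding True using assms by simp
  qed (simp add: g_def)
  have hol: "g holomorphic_on open_strip"
    by (rule pole_theorem_open_0[of f _ "1/2"])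
      (use assms open_open_strip in \<open>auto simp: strip_fun_def g_def\<close>)
  obtain e where e: "e > 0" "cball (1/2) e \<subseteq> open_strip"
    using open_contains_cball open_open_strip half_in_open_strip by metis
  have "continuous_on (cball (1/2) e) g"
    using holomorphic_on_imp_continuous_on[OF holomorphic_on_subset[OF hol e(2)]] .
  then have "bounded (g ` cball (1/2) e)"
    by (intro compact_imp_bounded compact_continuous_image compact_cball)
  then obtain N where N: "N > 0" "\<And>z. z \<in> cball (1/2) e \<Longrightarrow> cmod (g z) \<le> N"
    by (auto simp: bounded_pos)
  obtain M where M: "M > 0" "\<And>z. z \<in> strip \<Longrightarrow> cmod (f z) \<le> M"
    using strip_fun_bound[OF f] by blast
  have bd: "cmod (g z) \<le> N + M / e" if z: "z \<in> strip" for z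
  proof (cases "z \<in> cball (1/2) e")
    case True
    then show ?thesis using N(2)[OF True] M e by (intro order_trans[OF N(2)]) auto
  next
    case False
    then have d: "e < cmod (z - 1/2)" by (simp add: dist_norm norm_minus_commute)
    then have "z \<noteq> 1/2" using e by (intro notI) simp
    then have "cmod (g z) = cmod (f z) / cmod (z - 1/2)" by (simp add: g_def norm_divide)
    also have "\<dots> \<le> M / e" using M z d e by (intro frac_le) auto
    finally show ?thesis using N by simp
  qed
  have cont: "continuous_on strip g"
    unfolding continuous_on_eq_continuous_within
  proof
    fix z assume z: "z \<in> strip"
    show "continuous (at z within strip) g"
    proof (cases "z = 1/2")
      case True
      have "continuous_on open_strip g" using hol by (rule holomorphic_on_imp_continuous_on)
      then have "continuous (at z) g"
        using True open_open_strip continuous_on_eq_continuous_at half_in_open_strip by blast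
      then show ?thesis by (rule continuous_at_imp_continuous_within)
    next
      case False
      have "continuous (at z within strip) (\<lambda>z. f z / (z - 1/2))"
        using f z False unfolding strip_fun_def continuous_on_eq_continuous_within
        by (intro continuous_intros) auto
      moreover have "\<forall>\<^sub>F x in at z within strip. f x / (x - 1/2) = g x"
      proof -
        have "open (- {1/2::complex})" by auto
        then have "\<forall>\<^sub>F x in at z. x \<in> - {1/2}"
          using False by (intro eventually_at_in_open') auto
        then have "\<forall>\<^sub>F x in at z within strip. x \<in> - {1/2}"
          by (rule filter_leD[OF at_le[OF subset_UNIV]])
        then show ?thesis by eventually_elim (auto simp: g_def)
      qed
      ultimately have "(g \<longlongrightarrow> f z / (z - 1/2)) (at z within strip)"
        unfolding continuous_within by (rule Lim_transform_eventually)
      moreover have "f z / (z - 1/2) = g z" using False by (simp add: g_def)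
      ultimately show ?thesis unfolding continuous_within by metis
    qed
  qed
  have half: "cmod (g z) \<le> 2 * cmod (f z)" if "1/2 \<le> cmod (z - 1/2)" for z
  proof -
    have "cmod (f z) = cmod (z - 1/2) * cmod (g z)" by (subst fg) (simp add: norm_mult)
    moreover have "1/2 * cmod (g z) \<le> cmod (z - 1/2) * cmod (g z)"
      using that by (intro mult_right_mono) auto
    ultimately show ?thesis by simp
  qed
  have e0: "1/2 \<le> cmod (Complex 0 t - 1/2)" "1/2 \<le> cmod (Complex 1 t - 1/2)" for t
    using abs_Re_le_cmod[of "Complex 0 t - 1/2"] abs_Re_le_cmod[of "Complex 1 t - 1/2"] by auto
  show ?thesis
    by (rule that[of g]) (use strip_funI[OF cont hol bd] fg half e0 in auto)
qed

text \<open>The polynomial cancels the quadratic term of the exponential: with w = z - 1/2 the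
  product is 1 + O(w^4). Multiplication by it produces decay along the strip and leaves the
  derivatives at the midpoint up to order 2 alone.\<close>

definition gauss :: "complex \<Rightarrow> complex" where
  "gauss z = (1 - (z - 1/2)\<^sup>2) * exp ((z - 1/2)\<^sup>2)"

text \<open>With u = |z - 1/2|^2 the estimate in question is (1 + u)^3 exp (1/2 - u) \<le> 27 exp
  (3/2), that is, x \<le> exp x at x = (1 + u) / 3, cubed.\<close>

definition gauss_const :: real where
  "gauss_const = 27 * exp (3/2)"

lemma gauss_const_ge_1: "gauss_const \<ge> 1"
  using one_le_exp_iff[of "3/2"] unfolding gauss_const_def by linarith

text \<open>Of the two factors 1 + |z - 1/2|^2 on the left, one will absorb a quadratic polynomial
  and the other will leave decay at infinity.\<close>

lemma gauss_bound:
  assumes "z \<in> strip"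
  shows "cmod (gauss z) * (1 + (cmod (z - 1/2))\<^sup>2)\<^sup>2 \<le> gauss_const"
proof -
  define u where "u = (cmod (z - 1/2))\<^sup>2"
  have u: "u = (Re z - 1/2)\<^sup>2 + (Im z)\<^sup>2"
    by (simp add: u_def cmod_power2)
  have "u \<ge> 0" by (simp add: u_def)
  have "cmod (exp ((z - 1/2)\<^sup>2)) = exp ((Re z - 1/2)\<^sup>2 - (Im z)\<^sup>2)"
    using norm_exp_square_shift[of 1 z] by simp
  also have "\<dots> \<le> exp (1/2 - u)"
    using Re_shift_square_le[OF assms] by (simp add: u)
  finally have e: "cmod (exp ((z - 1/2)\<^sup>2)) \<le> exp (1/2 - u)" .
  have "cmod (1 - (z - 1/2)\<^sup>2) \<le> 1 + u"
    using norm_triangle_ineq4[of 1 "(z - 1/2)\<^sup>2"] by (simp add: u_def norm_power)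
  then have "cmod (gauss z) \<le> (1 + u) * exp (1/2 - u)"
    unfolding gauss_def norm_mult using e \<open>u \<ge> 0\<close> by (intro mult_mono) auto
  then have "cmod (gauss z) * (1 + u)\<^sup>2 \<le> (1 + u) * exp (1/2 - u) * (1 + u)\<^sup>2"
    by (intro mult_right_mono) auto
  also have "\<dots> = (1 + u) ^ 3 * exp (1/2 - u)"
    by (simp add: power3_eq_cube power2_eq_square)
  also have "\<dots> \<le> 27 * exp (1 + u) * exp (1/2 - u)"
  proof (intro mult_right_mono)
    have "0 \<le> (1 + u) / 3" using \<open>u \<ge> 0\<close> by simp
    then have "((1 + u) / 3) ^ 3 \<le> (exp ((1 + u) / 3)) ^ 3"
      using exp_ge_add_one_self[of "(1 + u) / 3"] by (intro power_mono) linarith+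
    also have "\<dots> = exp (1 + u)" by (simp flip: exp_of_nat_mult)
    finally show "(1 + u) ^ 3 \<le> 27 * exp (1 + u)" by (simp add: power_divide)
  qed auto
  also have "\<dots> = gauss_const"
    by (simp add: gauss_const_def flip: exp_add)
  finally show ?thesis by (simp add: u_def)
qed

text \<open>The building block of all explicit elements: \<open>L\<close> shifts size between the
  edges, the three coefficients adjust the jet, and \<open>gauss\<close> makes the function vanish
  at infinity.\<close>

definition kern :: "real \<Rightarrow> complex \<Rightarrow> complex \<Rightarrow> complex \<Rightarrow> complex \<Rightarrow> complex" where
  "kern L al be ga z =
     gauss z * (al + be * (z - 1/2) + ga * (z - 1/2)\<^sup>2) * exp (of_real L * (z - 1/2))"

lemma norm_kern_le:
  assumes "z \<in> strip" "cmod al \<le> c" "cmod be \<le> c" "cmod ga \<le> c"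
  shows "cmod (kern L al be ga z) * (1 + (cmod (z - 1/2))\<^sup>2)
    \<le> 2 * gauss_const * c * exp (L * (Re z - 1/2))"
proof -
  define r where "r = cmod (z - 1/2)"
  have r: "r \<ge> 0" by (simp add: r_def)
  have c: "c \<ge> 0" using assms(2) norm_ge_zero[of al] by linarith
  have "cmod (al + be * (z - 1/2) + ga * (z - 1/2)\<^sup>2) \<le> cmod al + cmod be * r + cmod ga * r\<^sup>2"
    by (intro norm_triangle_le add_mono order_refl) (auto simp: norm_mult norm_power r_def)
  also have "\<dots> \<le> c + c * r + c * r\<^sup>2"
    using assms r by (intro add_mono mult_right_mono) auto
  also have "\<dots> \<le> 2 * c * (1 + r\<^sup>2)"
  proof -
    have "r \<le> 1 + r\<^sup>2" using r sum_power2_ge_zero[of "r - 1" 0] by (simp add: power2_eq_square algebra_simps)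
    then have "c * r \<le> c * (1 + r\<^sup>2)" using c by (rule mult_left_mono)
    then show ?thesis by (simp add: algebra_simps)
  qed
  finally have p: "cmod (al + be * (z - 1/2) + ga * (z - 1/2)\<^sup>2) \<le> 2 * c * (1 + r\<^sup>2)" .
  have "cmod (kern L al be ga z) * (1 + r\<^sup>2)
    = cmod (gauss z) * (1 + r\<^sup>2) * cmod (al + be * (z - 1/2) + ga * (z - 1/2)\<^sup>2) * exp (L * (Re z - 1/2))"
    by (simp add: kern_def norm_mult)
  also have "\<dots> \<le> cmod (gauss z) * (1 + r\<^sup>2) * (2 * c * (1 + r\<^sup>2)) * exp (L * (Re z - 1/2))"
    using p by (intro mult_right_mono mult_left_mono) auto
  also have "\<dots> = (cmod (gauss z) * (1 + r\<^sup>2)\<^sup>2) * (2 * c * exp (L * (Re z - 1/2)))"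
    by (simp add: power2_eq_square)
  also have "\<dots> \<le> gauss_const * (2 * c * exp (L * (Re z - 1/2)))"
    using gauss_bound[OF assms(1)] c by (intro mult_right_mono) (auto simp: r_def)
  finally show ?thesis by (simp add: r_def mult_ac)
qed

lemma norm_kern_le':
  assumes "z \<in> strip" "cmod al \<le> c" "cmod be \<le> c" "cmod ga \<le> c"
  shows "cmod (kern L al be ga z) \<le> 2 * gauss_const * c * exp (L * (Re z - 1/2))"
proof -
  have "cmod (kern L al be ga z) * 1 \<le> cmod (kern L al be ga z) * (1 + (cmod (z - 1/2))\<^sup>2)"
    by (intro mult_left_mono) auto
  also have "\<dots> \<le> 2 * gauss_const * c * exp (L * (Re z - 1/2))"
    by (rule norm_kern_le[OF assms])
  finally show ?thesis by simp
qed

lemma kern_holomorphic: "kern L al be ga holomorphic_on A"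
  unfolding kern_def gauss_def by (intro holomorphic_intros)

lemma strip_fun_kern: "strip_fun (kern L al be ga)"
proof (rule strip_funI)
  show "continuous_on strip (kern L al be ga)"
    using kern_holomorphic holomorphic_on_imp_continuous_on by blast
  show "kern L al be ga holomorphic_on open_strip" by (rule kern_holomorphic)
  fix z assume z: "z \<in> strip"
  define c where "c = max (cmod al) (max (cmod be) (cmod ga))"
  have "L * (Re z - 1/2) \<le> \<bar>L\<bar> * 1"
  proof -
    have "L * (Re z - 1/2) \<le> \<bar>L\<bar> * \<bar>Re z - 1/2\<bar>" by (metis abs_ge_self abs_mult)
    also have "\<dots> \<le> \<bar>L\<bar> * 1" using z by (intro mult_left_mono) (auto simp: strip_def abs_if)
    finally show ?thesis .
  qed
  moreover have "0 \<le> 2 * gauss_const * c"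
    using gauss_const_ge_1 by (auto simp: c_def le_max_iff_disj intro!: mult_nonneg_nonneg)
  ultimately have "2 * gauss_const * c * exp (L * (Re z - 1/2)) \<le> 2 * gauss_const * c * exp \<bar>L\<bar>"
    by (intro mult_left_mono) auto
  moreover have "cmod (kern L al be ga z) \<le> 2 * gauss_const * c * exp (L * (Re z - 1/2))"
    by (rule norm_kern_le'[OF z]) (auto simp: c_def)
  ultimately show "cmod (kern L al be ga z) \<le> 2 * gauss_const * c * exp \<bar>L\<bar>"
    by (rule order_trans[rotated])
qed

section \<open>Extremal functions through given midpoint values\<close>

definition lam :: "complex \<Rightarrow> real" where
  "lam x = 2 * ln (cmod x)"

text \<open>Up to the Gaussian factor this is x |x|^(2w) with w = z - 1/2, the extremal function
  through \<open>x\<close>, of size 1 on the left edge and |x|^2 on the right one. For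
  \<open>x = 0\<close> the value of the logarithm is harmless, because the kernel has the factor
  \<open>x\<close>.\<close>

definition canon :: "complex \<Rightarrow> complex \<Rightarrow> complex" where
  "canon x = kern (lam x) x 0 0"

lemma canon_half [simp]: "canon x (1/2) = x"
  by (simp add: canon_def kern_def gauss_def)

lemma norm_canon_left: "cmod (canon x (Complex 0 t)) \<le> 2 * gauss_const"
proof (cases "x = 0")
  case True
  then show ?thesis using gauss_const_ge_1 by (simp add: canon_def kern_def)
next
  case False
  then show ?thesis
    using norm_kern_le'[of "Complex 0 t" x "cmod x" 0 0 "lam x"]
    by (simp add: canon_def lam_def exp_minus mult.assoc)
qed

lemma norm_canon_right: "cmod (canon x (Complex 1 t)) \<le> 2 * gauss_const * (cmod x)\<^sup>2"
proof (cases "x = 0")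
  case True
  then show ?thesis by (simp add: canon_def kern_def)
next
  case False
  then show ?thesis
    using norm_kern_le'[of "Complex 1 t" x "cmod x" 0 0 "lam x"]
    by (simp add: canon_def lam_def power2_eq_square)
qed

text \<open>Subtracting the extremal functions through the midpoint values leaves functions
  vanishing there. As the midpoint values are square summable, the subtracted functions obey edge
  bounds of the same kind, and division by z - 1/2 only doubles them. The quotients satisfy the
  hypotheses again with larger constants, so the step can be repeated.\<close>

lemma canon_step:
  fixes f :: "nat \<Rightarrow> complex \<Rightarrow> complex"
  assumes "finite S" and sf: "\<And>n. n \<in> S \<Longrightarrow> strip_fun (f n)"
    and A: "\<And>n t. n \<in> S \<Longrightarrow> cmod (f n (Complex 0 t)) \<le> A"
    and B: "\<And>t. (\<Sum>n\<in>S. cmod (f n (Complex 1 t))) \<le> B"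
    and "A \<ge> 1" "B > 0"
  shows "\<exists>g. (\<forall>n\<in>S. strip_fun (g n)) \<and>
    (\<forall>n\<in>S. \<forall>z\<in>strip. f n z = canon (f n (1/2)) z + (z - 1/2) * g n z) \<and>
    (\<forall>n\<in>S. \<forall>t. cmod (g n (Complex 0 t)) \<le> 6 * gauss_const * A) \<and>
    (\<forall>t. (\<Sum>n\<in>S. cmod (g n (Complex 1 t))) \<le> 6 * gauss_const * (A * B))"
proof -
  have l2: "(\<Sum>n\<in>S. (cmod (f n (1/2)))\<^sup>2) \<le> A * B"
    by (rule sum_norm_square_le) (use assms in auto)
  have "\<exists>g. strip_fun g \<and> (\<forall>z\<in>strip. f n z - canon (f n (1/2)) z = (z - 1/2) * g z) \<and>
    (\<forall>t. cmod (g (Complex 0 t)) \<le> 2 * cmod (f n (Complex 0 t) - canon (f n (1/2)) (Complex 0 t))) \<and>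
    (\<forall>t. cmod (g (Complex 1 t)) \<le> 2 * cmod (f n (Complex 1 t) - canon (f n (1/2)) (Complex 1 t)))"
    if "n \<in> S" for n
  proof -
    have "strip_fun (\<lambda>z. f n z + (-1) * canon (f n (1/2)) z)"
      unfolding canon_def using sf[OF that]
      by (intro strip_fun_add strip_fun_mult strip_fun_const strip_fun_kern)
    then have sd: "strip_fun (\<lambda>z. f n z - canon (f n (1/2)) z)" by simp
    show ?thesis
      by (rule strip_fun_divide[OF sd]) auto
  qed
  then obtain g where g: "\<And>n. n \<in> S \<Longrightarrow> strip_fun (g n)"
    "\<And>n z. n \<in> S \<Longrightarrow> z \<in> strip \<Longrightarrow> f n z - canon (f n (1/2)) z = (z - 1/2) * g n z"
    "\<And>n t. n \<in> S \<Longrightarrow> cmod (g n (Complex 0 t)) \<le> 2 * cmod (f n (Complex 0 t) - canon (f n (1/2)) (Complex 0 t))"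
    "\<And>n t. n \<in> S \<Longrightarrow> cmod (g n (Complex 1 t)) \<le> 2 * cmod (f n (Complex 1 t) - canon (f n (1/2)) (Complex 1 t))"
    by metis
  show ?thesis
  proof (intro exI[of _ g] conjI ballI allI)
    fix n t assume n: "n \<in> S"
    have "cmod (f n (Complex 0 t) - canon (f n (1/2)) (Complex 0 t)) \<le> A + 2 * gauss_const"
      by (rule order_trans[OF norm_triangle_ineq4 add_mono[OF A[OF n] norm_canon_left]])
    then have "cmod (g n (Complex 0 t)) \<le> 2 * (A + 2 * gauss_const)"
      using g(3)[OF n, of t] by (smt (verit))
    \<comment> \<open>Here \<open>A \<ge> 1\<close> folds the sum
      \<open>2 * A + 4 * gauss_const\<close> into a single product.\<close>
    moreover have "A \<le> A * gauss_const" "gauss_const \<le> gauss_const * A"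
      using \<open>A \<ge> 1\<close> gauss_const_ge_1
      using mult_left_mono[of 1 gauss_const A] mult_left_mono[of 1 A gauss_const] by auto
    ultimately show "cmod (g n (Complex 0 t)) \<le> 6 * gauss_const * A"
      by (simp add: mult.commute)
  next
    fix t
    have "(\<Sum>n\<in>S. cmod (g n (Complex 1 t)))
      \<le> (\<Sum>n\<in>S. 2 * cmod (f n (Complex 1 t)) + 4 * gauss_const * (cmod (f n (1/2)))\<^sup>2)"
    proof (rule sum_mono)
      fix n assume n: "n \<in> S"
      show "cmod (g n (Complex 1 t)) \<le> 2 * cmod (f n (Complex 1 t)) + 4 * gauss_const * (cmod (f n (1/2)))\<^sup>2"
        using g(4)[OF n, of t] norm_canon_right[of "f n (1/2)" t]
          norm_triangle_ineq4[of "f n (Complex 1 t)" "canon (f n (1/2)) (Complex 1 t)"] by linarith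
    qed
    also have "\<dots> \<le> 2 * B + 4 * gauss_const * (A * B)"
      unfolding sum.distrib sum_distrib_left[symmetric]
      using B[of t] l2 gauss_const_ge_1 by (intro add_mono mult_left_mono) auto
    also have "\<dots> \<le> 2 * (gauss_const * (A * B)) + 4 * gauss_const * (A * B)"
    proof -
      have "1 * (1 * B) \<le> gauss_const * (A * B)"
        using assms gauss_const_ge_1 by (intro mult_mono) auto
      then show ?thesis by linarith
    qed
    also have "\<dots> = 6 * gauss_const * (A * B)" by simp
    finally show "(\<Sum>n\<in>S. cmod (g n (Complex 1 t))) \<le> 6 * gauss_const * (A * B)" .
  qed (use g in \<open>auto simp: algebra_simps\<close>)
qed

text \<open>The remainder is kept as a holomorphic cofactor of (z - 1/2)^3 instead of an O-term,
  which turns sums and products of jets into polynomial identities.\<close>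

definition jet :: "(complex \<Rightarrow> complex) \<Rightarrow> complex \<Rightarrow> complex \<Rightarrow> complex \<Rightarrow> bool" where
  "jet f a b c \<longleftrightarrow> (\<exists>h. h holomorphic_on open_strip \<and>
     (\<forall>z\<in>open_strip. f z = a + b * (z - 1/2) + c * (z - 1/2)\<^sup>2 + (z - 1/2) ^ 3 * h z))"

lemma jet_derivs:
  assumes "jet f a b c"
  shows "f (1/2) = a" "deriv f (1/2) = b" "deriv (deriv f) (1/2) = 2 * c"
proof -
  obtain h where h: "h holomorphic_on open_strip"
    and f: "\<And>z. z \<in> open_strip \<Longrightarrow> f z = a + b * (z - 1/2) + c * (z - 1/2)\<^sup>2 + (z - 1/2) ^ 3 * h z"
    using assms by (auto simp: jet_def)
  have h': "deriv h holomorphic_on open_strip"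
    by (rule holomorphic_deriv[OF h open_open_strip])
  have dh: "(k has_field_derivative deriv k z) (at z)"
    if "z \<in> open_strip" "k holomorphic_on open_strip" for k z
    using holomorphic_derivI[OF that(2) open_open_strip that(1)] by simp
  show "f (1/2) = a" using f[OF half_in_open_strip] by simp
  have df: "deriv f z = b + 2 * c * (z - 1/2) + (z - 1/2)\<^sup>2 * (3 * h z + (z - 1/2) * deriv h z)"
    if z: "z \<in> open_strip" for z
  proof -
    have "((\<lambda>z. a + b * (z - 1/2) + c * (z - 1/2)\<^sup>2 + (z - 1/2) ^ 3 * h z) has_field_derivative
       b + 2 * c * (z - 1/2) + (z - 1/2)\<^sup>2 * (3 * h z + (z - 1/2) * deriv h z)) (at z)"
      by (rule derivative_eq_intros dh[OF z h] refl | simp)+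
        (simp add: algebra_simps power2_eq_square power3_eq_cube)
    then have "(f has_field_derivative
       b + 2 * c * (z - 1/2) + (z - 1/2)\<^sup>2 * (3 * h z + (z - 1/2) * deriv h z)) (at z)"
      by (rule has_field_derivative_transform_within_open[OF _ open_open_strip z]) (simp add: f)
    then show ?thesis by (rule DERIV_imp_deriv)
  qed
  then show "deriv f (1/2) = b" using df[OF half_in_open_strip] by simp
  have "((\<lambda>z. b + 2 * c * (z - 1/2) + (z - 1/2)\<^sup>2 * (3 * h z + (z - 1/2) * deriv h z))
    has_field_derivative 2 * c) (at (1/2))"
    by (rule derivative_eq_intros dh[OF half_in_open_strip h] dh[OF half_in_open_strip h'] refl | simp)+
  then have "(deriv f has_field_derivative 2 * c) (at (1/2))"
    by (rule has_field_derivative_transform_within_open[OF _ open_open_strip half_in_open_strip])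
      (simp add: df)
  then show "deriv (deriv f) (1/2) = 2 * c" by (rule DERIV_imp_deriv)
qed

lemma holomorphic_divide_shift:
  assumes "f holomorphic_on open_strip"
  obtains g where "g holomorphic_on open_strip" "\<And>z. z \<in> open_strip \<Longrightarrow> f z = f (1/2) + (z - 1/2) * g z"
proof -
  define k where "k z = f z - f (1/2)" for z
  define g where "g z = (if z = 1/2 then deriv k (1/2) else k z / (z - 1/2))" for z
  have "k holomorphic_on open_strip" unfolding k_def using assms by (intro holomorphic_intros)
  then have "g holomorphic_on open_strip"
    by (rule pole_theorem_open_0[of k _ "1/2"]) (use open_open_strip in \<open>auto simp: g_def k_def\<close>)
  moreover have "f z = f (1/2) + (z - 1/2) * g z" for z
  proof (cases "z = 1/2")
    case True
    show ?thesis unfolding True by simp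
  qed (simp add: g_def k_def)
  ultimately show ?thesis using that by blast
qed

text \<open>The zero of f - f(1/2) is divided out three times; the coefficients found on the way are
  recognised as derivatives by \<open>jet_derivs\<close>.\<close>

lemma jet_exists:
  assumes "f holomorphic_on open_strip"
  shows "jet f (f (1/2)) (deriv f (1/2)) (deriv (deriv f) (1/2) / 2)"
proof -
  obtain f1 where f1: "f1 holomorphic_on open_strip"
    "\<And>z. z \<in> open_strip \<Longrightarrow> f z = f (1/2) + (z - 1/2) * f1 z"
    using holomorphic_divide_shift[OF assms] by blast
  obtain f2 where f2: "f2 holomorphic_on open_strip"
    "\<And>z. z \<in> open_strip \<Longrightarrow> f1 z = f1 (1/2) + (z - 1/2) * f2 z"
    using holomorphic_divide_shift[OF f1(1)] by blast
  obtain f3 where f3: "f3 holomorphic_on open_strip"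
    "\<And>z. z \<in> open_strip \<Longrightarrow> f2 z = f2 (1/2) + (z - 1/2) * f3 z"
    using holomorphic_divide_shift[OF f2(1)] by blast
  have "jet f (f (1/2)) (f1 (1/2)) (f2 (1/2))"
    unfolding jet_def
  proof (intro exI[of _ f3] conjI ballI f3(1))
    fix z assume z: "z \<in> open_strip"
    show "f z = f (1/2) + f1 (1/2) * (z - 1/2) + f2 (1/2) * (z - 1/2)\<^sup>2 + (z - 1/2) ^ 3 * f3 z"
      unfolding f1(2)[OF z] f2(2)[OF z] f3(2)[OF z] by algebra
  qed
  then show ?thesis using jet_derivs by force
qed

lemma jet_mult:
  assumes "jet f a b c" "jet g a' b' c'"
  shows "jet (\<lambda>z. f z * g z) (a * a') (a * b' + b * a') (a * c' + b * b' + c * a')"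
proof -
  obtain h where h: "h holomorphic_on open_strip"
    "\<And>z. z \<in> open_strip \<Longrightarrow> f z = a + b * (z - 1/2) + c * (z - 1/2)\<^sup>2 + (z - 1/2) ^ 3 * h z"
    using assms(1) by (auto simp: jet_def)
  obtain k where k: "k holomorphic_on open_strip"
    "\<And>z. z \<in> open_strip \<Longrightarrow> g z = a' + b' * (z - 1/2) + c' * (z - 1/2)\<^sup>2 + (z - 1/2) ^ 3 * k z"
    using assms(2) by (auto simp: jet_def)
  \<comment> \<open>All terms of degree at least 3 in the product, divided by (z - 1/2)^3.\<close>
  define m where "m z = h z * (a' + b' * (z - 1/2) + c' * (z - 1/2)\<^sup>2 + (z - 1/2) ^ 3 * k z)
    + (a + b * (z - 1/2) + c * (z - 1/2)\<^sup>2) * k z + b * c' + c * b' + c * c' * (z - 1/2)" for z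
  show ?thesis
    unfolding jet_def
  proof (intro exI[of _ m] conjI ballI)
    show "m holomorphic_on open_strip"
      unfolding m_def using h(1) k(1) by (intro holomorphic_intros)
    fix z assume z: "z \<in> open_strip"
    show "f z * g z = a * a' + (a * b' + b * a') * (z - 1/2) + (a * c' + b * b' + c * a') * (z - 1/2)\<^sup>2
      + (z - 1/2) ^ 3 * m z"
      unfolding h(2)[OF z] k(2)[OF z] m_def by algebra
  qed
qed

lemma jet_add:
  assumes "jet f a b c" "jet g a' b' c'"
  shows "jet (\<lambda>z. f z + g z) (a + a') (b + b') (c + c')"
proof -
  obtain h where h: "h holomorphic_on open_strip"
    "\<And>z. z \<in> open_strip \<Longrightarrow> f z = a + b * (z - 1/2) + c * (z - 1/2)\<^sup>2 + (z - 1/2) ^ 3 * h z"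
    using assms(1) by (auto simp: jet_def)
  obtain k where k: "k holomorphic_on open_strip"
    "\<And>z. z \<in> open_strip \<Longrightarrow> g z = a' + b' * (z - 1/2) + c' * (z - 1/2)\<^sup>2 + (z - 1/2) ^ 3 * k z"
    using assms(2) by (auto simp: jet_def)
  show ?thesis
    unfolding jet_def
  proof (intro exI[of _ "\<lambda>z. h z + k z"] conjI ballI)
    show "(\<lambda>z. h z + k z) holomorphic_on open_strip"
      using h(1) k(1) by (intro holomorphic_intros)
  qed (simp add: h(2) k(2) algebra_simps)
qed

lemma jet_cong:
  assumes "jet f a b c" "\<And>z. z \<in> open_strip \<Longrightarrow> f z = g z"
  shows "jet g a b c"
  using assms by (auto simp: jet_def)

lemma jet_poly: "jet (\<lambda>z. a + b * (z - 1/2) + c * (z - 1/2)\<^sup>2) a b c"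
  unfolding jet_def by (rule exI[of _ "\<lambda>z. 0"]) auto

lemma jet_exp: "jet (\<lambda>z. exp (L * (z - 1/2))) 1 L (L\<^sup>2 / 2)"
proof -
  have d: "deriv (\<lambda>z. c * exp (L * (z - 1/2))) = (\<lambda>z. c * L * exp (L * (z - 1/2)))" for c
    by (rule ext, rule DERIV_imp_deriv) (auto intro!: derivative_eq_intros)
  have "jet (\<lambda>z. exp (L * (z - 1/2))) (exp (L * (1/2 - 1/2))) (deriv (\<lambda>z. exp (L * (z - 1/2))) (1/2))
    (deriv (deriv (\<lambda>z. exp (L * (z - 1/2)))) (1/2) / 2)"
    by (rule jet_exists) (intro holomorphic_intros)
  then show ?thesis using d[of 1] d[of L] by (simp add: power2_eq_square)
qed

lemma jet_gauss: "jet gauss 1 0 0"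
proof -
  have e: "jet (\<lambda>z. exp ((z - 1/2)\<^sup>2)) 1 0 1"
  proof -
    have d1: "deriv (\<lambda>z. exp ((z - 1/2)\<^sup>2)) = (\<lambda>z. 2 * (z - 1/2) * exp ((z - 1/2)\<^sup>2))"
      by (rule ext, rule DERIV_imp_deriv) (auto intro!: derivative_eq_intros)
    have d2: "deriv (\<lambda>z. 2 * (z - 1/2) * exp ((z - 1/2)\<^sup>2)) (1/2) = (2::complex)"
      by (rule DERIV_imp_deriv) (auto intro!: derivative_eq_intros)
    have "jet (\<lambda>z. exp ((z - 1/2)\<^sup>2)) (exp ((1/2 - 1/2)\<^sup>2)) (deriv (\<lambda>z. exp ((z - 1/2)\<^sup>2)) (1/2))
      (deriv (deriv (\<lambda>z. exp ((z - 1/2)\<^sup>2))) (1/2) / 2)"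
      by (rule jet_exists) (intro holomorphic_intros)
    then show ?thesis unfolding d1 d2 by simp
  qed
  show ?thesis
    using jet_mult[OF jet_poly[of 1 0 "-1"] e] by (auto elim: jet_cong simp: gauss_def)
qed

text \<open>The jet of \<open>gauss\<close> is that of the constant 1, so only the polynomial and
  the exponential contribute.\<close>

lemma jet_kern:
  "jet (kern L al be ga) al (al * L + be) (al * L\<^sup>2 / 2 + be * L + ga)"
  using jet_mult[OF jet_mult[OF jet_gauss jet_poly[of al be ga]] jet_exp[of L]]
  unfolding kern_def[abs_def] by (simp add: add_ac)

text \<open>A function in the unit ball is \<open>canon x\<^sub>0 + w * canon x\<^sub>1 + w\<^sup>2 * (x\<^sub>2 + O(w))\<close> with
  \<open>w = z - 1/2\<close> and \<open>x\<^sub>0, x\<^sub>1, x\<^sub>2\<close> in \<open>\<ell>\<^sub>2\<close>, since the vanishing remainder can be divided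
  by \<open>w\<close> and the argument repeated.\<close>

lemma jets_decomposition:
  fixes f :: "nat \<Rightarrow> complex \<Rightarrow> complex"
  assumes "finite S" and sf: "\<And>n. n \<in> S \<Longrightarrow> strip_fun (f n)"
    and A: "\<And>n t. n \<in> S \<Longrightarrow> cmod (f n (Complex 0 t)) \<le> 1"
    and B: "\<And>t. (\<Sum>n\<in>S. cmod (f n (Complex 1 t))) \<le> d"
    and "d > 0"
  obtains x0 x1 x2 where
    "\<And>n. n \<in> S \<Longrightarrow> jet (f n) (x0 n) (x0 n * lam (x0 n) + x1 n)
       (x0 n * (lam (x0 n))\<^sup>2 / 2 + x1 n * lam (x1 n) + x2 n)"
    "(\<Sum>n\<in>S. (cmod (x0 n))\<^sup>2 + (cmod (x1 n))\<^sup>2 + (cmod (x2 n))\<^sup>2) \<le> 3 * (6 * gauss_const) ^ 5 * d"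
proof -
  let ?K = "6 * gauss_const"
  have K: "?K \<ge> 1" using gauss_const_ge_1 by simp
  obtain g where g: "\<And>n. n \<in> S \<Longrightarrow> strip_fun (g n)"
    "\<And>n z. n \<in> S \<Longrightarrow> z \<in> strip \<Longrightarrow> f n z = canon (f n (1/2)) z + (z - 1/2) * g n z"
    "\<And>n t. n \<in> S \<Longrightarrow> cmod (g n (Complex 0 t)) \<le> ?K * 1"
    "\<And>t. (\<Sum>n\<in>S. cmod (g n (Complex 1 t))) \<le> ?K * (1 * d)"
    using canon_step[OF assms(1) sf A B order_refl \<open>d > 0\<close>] by blast
  have g3: "cmod (g n (Complex 0 t)) \<le> ?K" if "n \<in> S" for n t using g(3)[OF that] by simp
  have g4: "(\<Sum>n\<in>S. cmod (g n (Complex 1 t))) \<le> ?K * d" for t using g(4) by simp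
  have Kd: "?K * d > 0" using \<open>d > 0\<close> K by (intro mult_pos_pos) auto
  obtain h where h: "\<And>n. n \<in> S \<Longrightarrow> strip_fun (h n)"
    "\<And>n z. n \<in> S \<Longrightarrow> z \<in> strip \<Longrightarrow> g n z = canon (g n (1/2)) z + (z - 1/2) * h n z"
    "\<And>n t. n \<in> S \<Longrightarrow> cmod (h n (Complex 0 t)) \<le> ?K * ?K"
    "\<And>t. (\<Sum>n\<in>S. cmod (h n (Complex 1 t))) \<le> ?K * (?K * (?K * d))"
    using canon_step[OF assms(1) g(1) g3 g4 K Kd] by blast
  \<comment> \<open>Each sum of squares is bounded by the product of a left and a right edge bound.
    This gives the powers 0, 2 and 5 of \<open>6 * gauss_const\<close>, all raised to the fifth by
    the fact \<open>pw\<close>.\<close>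
  have b0: "(\<Sum>n\<in>S. (cmod (f n (1/2)))\<^sup>2) \<le> 1 * d"
    by (rule sum_norm_square_le[OF assms(1) sf A B _ \<open>d > 0\<close>]) auto
  have b1: "(\<Sum>n\<in>S. (cmod (g n (1/2)))\<^sup>2) \<le> ?K * (?K * d)"
    by (rule sum_norm_square_le[OF assms(1) g(1) g3 g4 _ Kd]) (use K in auto)
  have b2: "(\<Sum>n\<in>S. (cmod (h n (1/2)))\<^sup>2) \<le> (?K * ?K) * (?K * (?K * (?K * d)))"
    by (rule sum_norm_square_le[OF assms(1) h(1) h(3) h(4)]) (use K Kd in \<open>auto intro!: mult_pos_pos\<close>)
  have pw: "?K ^ i * d \<le> ?K ^ 5 * d" if "i \<le> 5" for i
    using K that \<open>d > 0\<close> by (intro mult_right_mono power_increasing) auto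
  show ?thesis
  proof (rule that[of "\<lambda>n. f n (1/2)" "\<lambda>n. g n (1/2)" "\<lambda>n. h n (1/2)"])
    fix n assume n: "n \<in> S"
    have hn: "h n holomorphic_on open_strip" using h(1)[OF n] by (simp add: strip_fun_def)
    have w: "jet (\<lambda>z. z - 1/2) 0 1 0" using jet_poly[of 0 1 0] by simp
    obtain b c where jh: "jet (h n) (h n (1/2)) b c"
      using jet_exists[OF hn] by blast
    have eg: "kern (lam (g n (1/2))) (g n (1/2)) 0 0 z + (z - 1/2) * h n z = g n z" if "z \<in> open_strip" for z
      using h(2)[OF n, of z] that open_strip_subset by (auto simp: canon_def)
    have jg: "jet (g n) (g n (1/2)) (g n (1/2) * lam (g n (1/2)) + h n (1/2))
       (g n (1/2) * (lam (g n (1/2)))\<^sup>2 / 2 + b)"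
      using jet_cong[OF jet_add[OF jet_kern[of "lam (g n (1/2))" "g n (1/2)" 0 0] jet_mult[OF w jh]] eg]
      by simp
    have ef: "kern (lam (f n (1/2))) (f n (1/2)) 0 0 z + (z - 1/2) * g n z = f n z" if "z \<in> open_strip" for z
      using g(2)[OF n, of z] that open_strip_subset by (auto simp: canon_def)
    show "jet (f n) (f n (1/2)) (f n (1/2) * lam (f n (1/2)) + g n (1/2))
       (f n (1/2) * (lam (f n (1/2)))\<^sup>2 / 2 + g n (1/2) * lam (g n (1/2)) + h n (1/2))"
      using jet_cong[OF jet_add[OF jet_kern[of "lam (f n (1/2))" "f n (1/2)" 0 0] jet_mult[OF w jg]] ef]
      by (simp add: add_ac)
  next
    have "(\<Sum>n\<in>S. (cmod (f n (1/2)))\<^sup>2 + (cmod (g n (1/2)))\<^sup>2 + (cmod (h n (1/2)))\<^sup>2)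
      \<le> ?K ^ 0 * d + ?K ^ 2 * d + ?K ^ 5 * d"
      unfolding sum.distrib using b0 b1 b2
      by (intro add_mono) (simp_all add: power2_eq_square eval_nat_numeral mult_ac)
    also have "\<dots> \<le> ?K ^ 5 * d + ?K ^ 5 * d + ?K ^ 5 * d"
      by (intro add_mono pw order_refl) auto
    also have "\<dots> = 3 * ?K ^ 5 * d" by simp
    finally show "(\<Sum>n\<in>S. (cmod (f n (1/2)))\<^sup>2 + (cmod (g n (1/2)))\<^sup>2 + (cmod (h n (1/2)))\<^sup>2)
      \<le> 3 * ?K ^ 5 * d" .
  qed
qed

section \<open>Block sequences\<close>

text \<open>The maps \<open>R S\<close> are commuting coordinate projections. In the application the
  vectors are functions on the strip, and \<open>R\<close> restricts their values to a set of
  coordinates.\<close>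

locale block_space = vector_space s
  for s :: "complex \<Rightarrow> 'v::ab_group_add \<Rightarrow> 'v" +
  fixes R :: "nat set \<Rightarrow> 'v \<Rightarrow> 'v"
  assumes R_add: "R S (x + y) = R S x + R S y"
    and R_scale: "R S (s c x) = s c (R S x)"
    and R_R: "R S (R T x) = R (S \<inter> T) x"
    and R_empty: "R {} x = 0"
begin

text \<open>Seminorms instead of norms, because the vectors will be functions measured by a quotient
  norm of some of their derivatives at the midpoint, which vanishes on many functions.\<close>

definition seminorm_on :: "'v set \<Rightarrow> ('v \<Rightarrow> real) \<Rightarrow> bool" where
  "seminorm_on V N \<longleftrightarrow> subspace V \<and>
     (\<forall>x\<in>V. \<forall>S. R S x \<in> V \<and> N (R S x) \<le> N x) \<and>
     (\<forall>x\<in>V. \<forall>y\<in>V. N (x + y) \<le> N x + N y) \<and>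
     (\<forall>c. \<forall>x\<in>V. N (s c x) = cmod c * N x)"

definition blocks :: "'v set \<Rightarrow> (nat \<Rightarrow> 'v) \<Rightarrow> bool" where
  "blocks V y \<longleftrightarrow> (\<exists>m. strict_mono m \<and> (\<forall>n. y n \<in> V \<and> R {m n..<m (Suc n)} (y n) = y n))"

text \<open>Blocks with respect to the index of the sequence and not to coordinates, so that the
  notion also applies to sequences that are merely close to block sequences.\<close>

definition sub_blocks :: "(nat \<Rightarrow> 'v) \<Rightarrow> (nat \<Rightarrow> 'v) \<Rightarrow> bool" where
  "sub_blocks y v \<longleftrightarrow> (\<exists>p. strict_mono p \<and> (\<forall>j. v j \<in> span (y ` {p j..<p (Suc j)})))"

definition l2_bounds :: "real \<Rightarrow> real \<Rightarrow> ('v \<Rightarrow> real) \<Rightarrow> (nat \<Rightarrow> 'v) \<Rightarrow> bool" where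
  "l2_bounds c C N v \<longleftrightarrow> (\<forall>a n.
     c * sqrt (\<Sum>j<n. (cmod (a j))\<^sup>2) \<le> N (\<Sum>j<n. s (a j) (v j)) \<and>
     N (\<Sum>j<n. s (a j) (v j)) \<le> C * sqrt (\<Sum>j<n. (cmod (a j))\<^sup>2))"

definition l2_basis :: "('v \<Rightarrow> real) \<Rightarrow> (nat \<Rightarrow> 'v) \<Rightarrow> bool" where
  "l2_basis N v \<longleftrightarrow> (\<exists>c>0. \<exists>C. l2_bounds c C N v)"

definition l2_block_property :: "'v set \<Rightarrow> ('v \<Rightarrow> real) \<Rightarrow> bool" where
  "l2_block_property V N \<longleftrightarrow>
     (\<forall>y. blocks V y \<and> (\<forall>n. N (y n) > 0) \<longrightarrow> (\<exists>v. sub_blocks y v \<and> l2_basis N v))"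

lemma R_zero [simp]: "R S 0 = 0"
  using R_scale[of S 0 0] by simp

lemma R_sum: "R S (\<Sum>i\<in>I. f i) = (\<Sum>i\<in>I. R S (f i))"
  by (induction I rule: infinite_finite_induct) (auto simp: R_add)

lemma R_disjoint:
  assumes "R T x = x" "S \<inter> T = {}"
  shows "R S x = 0"
  using R_R[of S T x] assms R_empty by simp

lemma R_superset:
  assumes "R T x = x" "T \<subseteq> S"
  shows "R S x = x"
  using R_R[of S T x] assms by (simp add: Int_absorb1)

context
  fixes V N
  assumes N: "seminorm_on V N"
begin

lemma seminorm_subspace: "subspace V"
  using N by (simp add: seminorm_on_def)

lemma seminorm_R: "x \<in> V \<Longrightarrow> R S x \<in> V" "x \<in> V \<Longrightarrow> N (R S x) \<le> N x"
  using N by (auto simp: seminorm_on_def)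

lemma seminorm_add: "x \<in> V \<Longrightarrow> y \<in> V \<Longrightarrow> N (x + y) \<le> N x + N y"
  using N by (auto simp: seminorm_on_def)

lemma seminorm_scale: "x \<in> V \<Longrightarrow> N (s c x) = cmod c * N x"
  using N by (auto simp: seminorm_on_def)

lemma seminorm_zero: "N 0 = 0"
  using seminorm_scale[of 0 0] subspace_0[OF seminorm_subspace] by simp

lemma seminorm_minus: "x \<in> V \<Longrightarrow> N (- x) = N x"
  using seminorm_scale[of x "-1"] by simp

lemma seminorm_nonneg: "x \<in> V \<Longrightarrow> 0 \<le> N x"
  using seminorm_add[of x "- x"] seminorm_minus[of x] seminorm_zero
    subspace_neg[OF seminorm_subspace, of x] by simp

lemma seminorm_diff: "x \<in> V \<Longrightarrow> y \<in> V \<Longrightarrow> N (x - y) \<le> N x + N y"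
  using seminorm_add[of x "- y"] seminorm_minus[of y] subspace_neg[OF seminorm_subspace, of y] by simp

lemma seminorm_sum: "(\<And>i. i \<in> I \<Longrightarrow> f i \<in> V) \<Longrightarrow> N (\<Sum>i\<in>I. f i) \<le> (\<Sum>i\<in>I. N (f i))"
proof (induction I rule: infinite_finite_induct)
  case (insert x F)
  have "N (f x + sum f F) \<le> N (f x) + N (sum f F)"
    using insert.prems by (intro seminorm_add subspace_sum[OF seminorm_subspace]) auto
  then show ?case using insert by fastforce
qed (auto simp: seminorm_zero)

end

section \<open>Passing to further block sequences\<close>

lemma sub_blocks_in:
  assumes "subspace V" "\<And>n. y n \<in> V" "sub_blocks y v"
  shows "v n \<in> V"
proof -
  obtain p where "v n \<in> span (y ` {p n..<p (Suc n)})"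
    using assms(3) by (auto simp: sub_blocks_def)
  moreover have "span (y ` {p n..<p (Suc n)}) \<subseteq> V"
    using assms by (intro span_minimal) auto
  ultimately show ?thesis by auto
qed

lemma R_span:
  assumes "x \<in> span A" "\<And>a. a \<in> A \<Longrightarrow> R S a = a"
  shows "R S x = x"
  using assms(1) by (induction rule: span_induct)
    (auto simp: subspace_def R_add R_scale assms(2))

lemma blocks_sub_blocks:
  assumes "subspace V" "blocks V y" "sub_blocks y v"
  shows "blocks V v"
proof -
  obtain m where m: "strict_mono m" "\<And>n. y n \<in> V" "\<And>n. R {m n..<m (Suc n)} (y n) = y n"
    using assms(2) by (auto simp: blocks_def)
  obtain p where p: "strict_mono p" "\<And>j. v j \<in> span (y ` {p j..<p (Suc j)})"
    using assms(3) by (auto simp: sub_blocks_def)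
  have "R {m (p j)..<m (p (Suc j))} (v j) = v j" for j
  proof (rule R_span[OF p(2)])
    fix a assume "a \<in> y ` {p j..<p (Suc j)}"
    then obtain n where n: "a = y n" "p j \<le> n" "n < p (Suc j)" by auto
    have "m (p j) \<le> m n" "m (Suc n) \<le> m (p (Suc j))"
      using n m(1) by (auto simp: strict_mono_less_eq)
    then show "R {m (p j)..<m (p (Suc j))} a = a"
      unfolding n(1) by (intro R_superset[OF m(3)]) auto
  qed
  moreover have "strict_mono (\<lambda>j. m (p j))"
    using m(1) p(1) by (auto simp: strict_mono_def)
  ultimately show ?thesis
    unfolding blocks_def using sub_blocks_in[OF assms(1) m(2) assms(3)]
    by (intro exI[of _ "\<lambda>j. m (p j)"]) auto
qed

lemma sub_blocks_trans:
  assumes "sub_blocks y v" "sub_blocks v u"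
  shows "sub_blocks y u"
proof -
  obtain p where p: "strict_mono p" "\<And>j. v j \<in> span (y ` {p j..<p (Suc j)})"
    using assms(1) by (auto simp: sub_blocks_def)
  obtain q where q: "strict_mono q" "\<And>j. u j \<in> span (v ` {q j..<q (Suc j)})"
    using assms(2) by (auto simp: sub_blocks_def)
  have "u j \<in> span (y ` {p (q j)..<p (q (Suc j))})" for j
  proof -
    have "v ` {q j..<q (Suc j)} \<subseteq> span (y ` {p (q j)..<p (q (Suc j))})"
    proof (rule image_subsetI)
      fix i assume i: "i \<in> {q j..<q (Suc j)}"
      have "p (q j) \<le> p i" "p (Suc i) \<le> p (q (Suc j))"
        using i p(1) by (auto simp: strict_mono_less_eq)
      then have "y ` {p i..<p (Suc i)} \<subseteq> y ` {p (q j)..<p (q (Suc j))}" by auto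
      then show "v i \<in> span (y ` {p (q j)..<p (q (Suc j))})"
        using p(2)[of i] span_mono by blast
    qed
    then show ?thesis using q(2)[of j] span_minimal[OF _ subspace_span] by blast
  qed
  moreover have "strict_mono (\<lambda>j. p (q j))"
    using p(1) q(1) by (auto simp: strict_mono_def)
  ultimately show ?thesis
    unfolding sub_blocks_def by (intro exI[of _ "\<lambda>j. p (q j)"]) auto
qed

lemma sub_blocks_shift: "sub_blocks (\<lambda>n. y (n + k)) v \<Longrightarrow> sub_blocks y v"
proof -
  assume "sub_blocks (\<lambda>n. y (n + k)) v"
  then obtain p where p: "strict_mono p" "\<And>j. v j \<in> span ((\<lambda>n. y (n + k)) ` {p j..<p (Suc j)})"
    by (auto simp: sub_blocks_def)
  have "(\<lambda>n. y (n + k)) ` {p j..<p (Suc j)} = y ` {p j + k..<p (Suc j) + k}" for j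
    unfolding image_add_atLeastLessThan'[symmetric] image_image by (rule refl)
  then show ?thesis
    unfolding sub_blocks_def using p
    by (intro exI[of _ "\<lambda>j. p j + k"]) (auto simp: strict_mono_def)
qed

lemma span_coeffs:
  assumes "x \<in> span (y ` {p..<q::nat})"
  obtains c where "x = (\<Sum>n\<in>{p..<q}. s (c n) (y n))"
proof -
  let ?W = "{x. \<exists>c. x = (\<Sum>n\<in>{p..<q}. s (c n) (y n))}"
  have "subspace ?W"
    unfolding subspace_def
  proof (intro conjI ballI allI)
    show "0 \<in> ?W" by (auto intro!: exI[of _ "\<lambda>n. 0"])
    fix x z assume "x \<in> ?W" "z \<in> ?W"
    then obtain c d where "x = (\<Sum>n\<in>{p..<q}. s (c n) (y n))" "z = (\<Sum>n\<in>{p..<q}. s (d n) (y n))"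
      by auto
    then show "x + z \<in> ?W"
      by (auto intro!: exI[of _ "\<lambda>n. c n + d n"] simp: scale_left_distrib sum.distrib)
  next
    fix a x assume "x \<in> ?W"
    then obtain c where "x = (\<Sum>n\<in>{p..<q}. s (c n) (y n))" by auto
    then show "s a x \<in> ?W"
      by (auto intro!: exI[of _ "\<lambda>n. a * c n"] simp: scale_sum_right)
  qed
  moreover have "y ` {p..<q} \<subseteq> ?W"
  proof (rule image_subsetI)
    fix i assume "i \<in> {p..<q}"
    then have "y i = (\<Sum>n\<in>{p..<q}. s (if n = i then 1 else 0) (y n))"
      by (simp add: if_distrib[of "\<lambda>c. s c _"] cong: if_cong)
    then show "y i \<in> ?W" unfolding mem_Collect_eq by (rule exI[of _ "\<lambda>n. if n = i then 1 else 0"])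
  qed
  ultimately have "span (y ` {p..<q}) \<subseteq> ?W" by (rule span_minimal[rotated])
  then show ?thesis using assms that by blast
qed

lemma span_tail:
  assumes "x \<in> span (y ` {k..})"
  obtains q where "q > k" "x \<in> span (y ` {k..<q::nat})"
proof -
  let ?W = "{x. \<exists>q>k. x \<in> span (y ` {k..<q})}"
  have mono: "x \<in> span (y ` {k..<q}) \<Longrightarrow> q \<le> q' \<Longrightarrow> x \<in> span (y ` {k..<q'})" for x q q'
    using span_mono[of "y ` {k..<q}" "y ` {k..<q'}"] by (auto simp: image_mono)
  have "subspace ?W"
    unfolding subspace_def
  proof (intro conjI ballI allI)
    show "0 \<in> ?W" by (auto intro!: exI[of _ "Suc k"] span_zero)
    fix x z assume "x \<in> ?W" "z \<in> ?W"
    then obtain q q' where q: "q > k" "x \<in> span (y ` {k..<q})" "z \<in> span (y ` {k..<q'})" by auto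
    have "x + z \<in> span (y ` {k..<max q q'})"
      using q mono[of _ _ "max q q'"] by (intro span_add) auto
    then show "x + z \<in> ?W" using q by (auto intro!: exI[of _ "max q q'"])
  qed (auto intro: span_scale)
  moreover have "y ` {k..} \<subseteq> ?W"
  proof (rule image_subsetI)
    fix i assume "i \<in> {k..}"
    then show "y i \<in> ?W" by (auto intro!: exI[of _ "Suc i"] span_base)
  qed
  ultimately have "span (y ` {k..}) \<subseteq> ?W" by (rule span_minimal[rotated])
  then show ?thesis using assms that by blast
qed

text \<open>A suitable vector exists arbitrarily far out and is a finite combination, so the next
  one can be sought beyond the last index used. The triples in the recursion hold start, end and
  vector.\<close>

lemma sub_blocks_choice:
  assumes "\<And>n k. \<exists>x\<in>span (y ` {k..}). Q n x"
  obtains v where "sub_blocks y v" "\<And>n. Q n (v n)"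
proof -
  let ?P = "\<lambda>n (k, q, x). k < q \<and> x \<in> span (y ` {k..<q}) \<and> Q n x"
  have ex: "\<exists>q x. ?P n (k, q, x)" for n k
  proof -
    obtain x where x: "x \<in> span (y ` {k..})" "Q n x" using assms by blast
    obtain q where "q > k" "x \<in> span (y ` {k..<q})" by (rule span_tail[OF x(1)])
    then show ?thesis using x(2) by auto
  qed
  have "\<exists>f. \<forall>n. ?P n (f n) \<and> fst (f (Suc n)) = fst (snd (f n))"
  proof (rule dependent_nat_choice)
    show "\<exists>t. ?P 0 t" using ex[of 0 0] by blast
    fix t n
    obtain q x where "?P (Suc n) (fst (snd t), q, x)" using ex by blast
    then show "\<exists>t'. ?P (Suc n) t' \<and> fst t' = fst (snd t)" by (intro exI[of _ "(fst (snd t), q, x)"]) auto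
  qed
  then obtain f where "\<forall>n. ?P n (f n) \<and> fst (f (Suc n)) = fst (snd (f n))" by (rule exE)
  then have f: "?P n (f n)" "fst (f (Suc n)) = fst (snd (f n))" for n by simp_all
  define p v where "p n = fst (f n)" and "v n = snd (snd (f n))" for n
  have pv: "p n < p (Suc n)" "v n \<in> span (y ` {p n..<p (Suc n)})" "Q n (v n)" for n
    using f(1)[of n] f(2)[of n] by (auto simp: p_def v_def split: prod.splits)
  show ?thesis
    by (rule that[of v]) (use pv in \<open>auto simp: sub_blocks_def strict_mono_Suc_iff intro!: exI[of _ p]\<close>)
qed

text \<open>The coefficients are preceded by \<open>k\<close> zeros.\<close>

lemma l2_bounds_shift:
  assumes "l2_bounds c C N v"
  shows "l2_bounds c C N (\<lambda>j. v (j + k))"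
  unfolding l2_bounds_def
proof (intro allI)
  fix a :: "nat \<Rightarrow> complex" and n
  define b where "b i = (if i < k then 0 else a (i - k))" for i
  have "(\<Sum>i<n + k. s (b i) (v i)) = (\<Sum>i\<in>{k..<n + k}. s (b i) (v i))"
    by (rule sum.mono_neutral_right) (auto simp: b_def)
  also have "\<dots> = (\<Sum>j<n. s (a j) (v (j + k)))"
    by (rule sum.reindex_bij_witness[of _ "\<lambda>j. j + k" "\<lambda>i. i - k"]) (auto simp: b_def)
  finally have 1: "(\<Sum>i<n + k. s (b i) (v i)) = (\<Sum>j<n. s (a j) (v (j + k)))" .
  have "(\<Sum>i<n + k. (cmod (b i))\<^sup>2) = (\<Sum>i\<in>{k..<n + k}. (cmod (b i))\<^sup>2)"
    by (rule sum.mono_neutral_right) (auto simp: b_def)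
  also have "\<dots> = (\<Sum>j<n. (cmod (a j))\<^sup>2)"
    by (rule sum.reindex_bij_witness[of _ "\<lambda>j. j + k" "\<lambda>i. i - k"]) (auto simp: b_def)
  finally have 2: "(\<Sum>i<n + k. (cmod (b i))\<^sup>2) = (\<Sum>j<n. (cmod (a j))\<^sup>2)" .
  show "c * sqrt (\<Sum>j<n. (cmod (a j))\<^sup>2) \<le> N (\<Sum>j<n. s (a j) (v (j + k))) \<and>
      N (\<Sum>j<n. s (a j) (v (j + k))) \<le> C * sqrt (\<Sum>j<n. (cmod (a j))\<^sup>2)"
    using assms unfolding l2_bounds_def 1[symmetric] 2[symmetric] by blast
qed

text \<open>Principle of small perturbations. Projections onto single blocks bound the coefficients
  of \<open>v'\<close> with respect to \<open>y'\<close>; the same coefficients applied to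
  \<open>y\<close> give vectors at geometrically small distance from \<open>v'\<close>. Dropping
  finitely many of them makes the total error at most half of the lower constant.\<close>

lemma l2_perturbation:
  assumes N: "seminorm_on V N" and y': "blocks V y'" "\<And>n. N (y' n) \<ge> 1/2"
    and y: "\<And>n. y n \<in> V" and close: "\<And>n. N (y n - y' n) \<le> (1/2) ^ n"
    and v': "sub_blocks y' v'" "l2_basis N v'"
  obtains v where "sub_blocks y v" "l2_basis N v"
proof -
  note sub = seminorm_subspace[OF N]
  obtain m where m: "strict_mono m" "\<And>n. y' n \<in> V" "\<And>n. R {m n..<m (Suc n)} (y' n) = y' n"
    using y'(1) by (auto simp: blocks_def)
  obtain p where p: "strict_mono p" "\<And>j. v' j \<in> span (y' ` {p j..<p (Suc j)})"
    using v'(1) by (auto simp: sub_blocks_def)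
  obtain c C where "c > 0" and cC0: "l2_bounds c C N v'"
    using v'(2) unfolding l2_basis_def by blast
  then have cC: "c * sqrt (\<Sum>j<n. (cmod (a j))\<^sup>2) \<le> N (\<Sum>j<n. s (a j) (v' j))"
    "N (\<Sum>j<n. s (a j) (v' j)) \<le> C * sqrt (\<Sum>j<n. (cmod (a j))\<^sup>2)" for a :: "nat \<Rightarrow> complex" and n
    unfolding l2_bounds_def by blast+
  have vV: "v' j \<in> V" for j by (rule sub_blocks_in[OF sub m(2) v'(1)])
  have NC: "N (v' j) \<le> C" for j
    using cC(2)[where n = "Suc j" and a = "\<lambda>i. if i = j then 1 else 0"]
    by (simp add: if_distrib[of "\<lambda>c. s c _"] if_distrib[of "\<lambda>c. (cmod c)\<^sup>2"] cong: if_cong)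
  have "C \<ge> 0" using NC[of 0] seminorm_nonneg[OF N vV[of 0]] by simp
  have "\<exists>e. v' j = (\<Sum>n\<in>{p j..<p (Suc j)}. s (e n) (y' n))" for j
    using span_coeffs[OF p(2)] by blast
  then obtain e where e: "\<And>j. v' j = (\<Sum>n\<in>{p j..<p (Suc j)}. s (e j n) (y' n))"
    by metis
  have e_le: "cmod (e j n) \<le> 2 * C" if n: "n \<in> {p j..<p (Suc j)}" for j n
  proof -
    have "R {m n..<m (Suc n)} (s (e j i) (y' i)) = (if i = n then s (e j n) (y' n) else 0)" for i
    proof (cases "i = n")
      case False
      have "{m n..<m (Suc n)} \<inter> {m i..<m (Suc i)} = {}"
      proof (cases "i < n")
        case True
        then have "m (Suc i) \<le> m n" using m(1) by (simp add: strict_mono_less_eq)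
        then show ?thesis by auto
      next
        case False
        then have "m (Suc n) \<le> m i" using m(1) \<open>i \<noteq> n\<close> by (simp add: strict_mono_less_eq)
        then show ?thesis by auto
      qed
      then show ?thesis using R_disjoint[OF m(3)] False by (simp add: R_scale)
    qed (simp add: R_scale m(3))
    then have "R {m n..<m (Suc n)} (v' j) = s (e j n) (y' n)"
      using n by (simp add: e R_sum)
    then have "cmod (e j n) * N (y' n) \<le> N (v' j)"
      using seminorm_R(2)[OF N vV, of "{m n..<m (Suc n)}" j] seminorm_scale[OF N m(2)] by simp
    moreover have "cmod (e j n) * (1/2) \<le> cmod (e j n) * N (y' n)"
      using y'(2) by (intro mult_left_mono) auto
    ultimately show ?thesis using NC[of j] by linarith
  qed
  define v where "v j = (\<Sum>n\<in>{p j..<p (Suc j)}. s (e j n) (y n))" for j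
  have vV': "v j \<in> V" for j
    unfolding v_def using y by (intro subspace_sum[OF sub] subspace_scale[OF sub])
  have diff: "N (v j - v' j) \<le> 4 * C * (1/2) ^ j" for j
  proof -
    have dV: "y n - y' n \<in> V" for n using y m(2) by (intro subspace_diff[OF sub])
    have "v j - v' j = (\<Sum>n\<in>{p j..<p (Suc j)}. s (e j n) (y n - y' n))"
      by (simp add: v_def e sum_subtractf scale_right_diff_distrib)
    then have "N (v j - v' j) \<le> (\<Sum>n\<in>{p j..<p (Suc j)}. N (s (e j n) (y n - y' n)))"
      using seminorm_sum[OF N, of "{p j..<p (Suc j)}" "\<lambda>n. s (e j n) (y n - y' n)"]
        subspace_scale[OF sub dV] by simp
    also have "\<dots> \<le> (\<Sum>n\<in>{p j..<p (Suc j)}. 2 * C * (1/2) ^ n)"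
      unfolding seminorm_scale[OF N dV]
      by (intro sum_mono mult_mono e_le close) (use \<open>C \<ge> 0\<close> seminorm_nonneg[OF N dV] in auto)
    also have "\<dots> \<le> 2 * C * (2 * (1/2) ^ j)"
      unfolding sum_distrib_left[symmetric]
    proof (intro mult_left_mono)
      have "j \<le> p j" using p(1) by (rule strict_mono_imp_increasing)
      have "(\<Sum>n\<in>{p j..<p (Suc j)}. (1/2::real) ^ n) \<le> (\<Sum>n\<in>{j..<p (Suc j)}. (1/2) ^ n)"
        using \<open>j \<le> p j\<close> by (intro sum_mono2) auto
      also have "\<dots> \<le> 2 * (1/2) ^ j"
      proof -
        \<comment> \<open>The rest of the geometric series is included in the claim so that the
          induction closes.\<close>
        have "(\<Sum>n\<in>{j..<q}. (1/2::real) ^ n) + (if j \<le> q then 2 * (1/2) ^ q else 0) \<le> 2 * (1/2) ^ j" for q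
          by (induction q) (auto simp: not_le le_Suc_eq)
        then have "(\<Sum>n\<in>{j..<p (Suc j)}. (1/2::real) ^ n) + (if j \<le> p (Suc j) then 2 * (1/2) ^ p (Suc j) else 0) \<le> 2 * (1/2) ^ j" .
        then show ?thesis by (auto split: if_splits intro: order_trans[rotated])
      qed
      finally show "(\<Sum>n\<in>{p j..<p (Suc j)}. (1/2::real) ^ n) \<le> 2 * (1/2) ^ j" .
    qed (use \<open>C \<ge> 0\<close> in auto)
    finally show ?thesis by simp
  qed
  \<comment> \<open>\<open>8 * C * (1/2) ^ J\<close> is the sum of the distances
    \<open>4 * C * (1/2) ^ j\<close> over all j \<ge> J.\<close>
  have "\<exists>J. 8 * C * (1/2) ^ J \<le> c / 2"
  proof -
    have "(\<lambda>J. 8 * C * (1/2) ^ J) \<longlonglongrightarrow> 8 * C * 0"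
      by (intro tendsto_intros LIMSEQ_realpow_zero) auto
    then have "\<forall>\<^sub>F J in sequentially. 8 * C * (1/2) ^ J < c / 2"
      using \<open>c > 0\<close> by (intro order_tendstoD(2)) auto
    then show ?thesis by (auto simp: eventually_sequentially intro: less_imp_le)
  qed
  then obtain J where J: "8 * C * (1/2) ^ J \<le> c / 2" by blast
  have cJ: "c * sqrt (\<Sum>j<n. (cmod (a j))\<^sup>2) \<le> N (\<Sum>j<n. s (a j) (v' (j + J)))"
    "N (\<Sum>j<n. s (a j) (v' (j + J))) \<le> C * sqrt (\<Sum>j<n. (cmod (a j))\<^sup>2)" for a :: "nat \<Rightarrow> complex" and n
    using l2_bounds_shift[OF cC0, of J] unfolding l2_bounds_def by blast+
  have near: "N ((\<Sum>j<n. s (a j) (v (j + J))) - (\<Sum>j<n. s (a j) (v' (j + J))))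
      \<le> c / 2 * sqrt (\<Sum>j<n. (cmod (a j))\<^sup>2)" for a :: "nat \<Rightarrow> complex" and n
  proof -
    have dV: "v j - v' j \<in> V" for j using vV vV' by (intro subspace_diff[OF sub])
    have "(\<Sum>j<n. s (a j) (v (j + J))) - (\<Sum>j<n. s (a j) (v' (j + J)))
      = (\<Sum>j<n. s (a j) (v (j + J) - v' (j + J)))"
      by (simp add: sum_subtractf scale_right_diff_distrib)
    then have "N ((\<Sum>j<n. s (a j) (v (j + J))) - (\<Sum>j<n. s (a j) (v' (j + J))))
      \<le> (\<Sum>j<n. N (s (a j) (v (j + J) - v' (j + J))))"
      using seminorm_sum[OF N, of "{..<n}" "\<lambda>j. s (a j) (v (j + J) - v' (j + J))"]
        subspace_scale[OF sub dV] by simp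
    also have "\<dots> \<le> (\<Sum>j<n. sqrt (\<Sum>j<n. (cmod (a j))\<^sup>2) * (4 * C * (1/2) ^ (j + J)))"
      unfolding seminorm_scale[OF N dV]
    proof (intro sum_mono mult_mono diff)
      fix j assume "j \<in> {..<n}"
      then have "(cmod (a j))\<^sup>2 \<le> (\<Sum>j<n. (cmod (a j))\<^sup>2)" by (intro member_le_sum) auto
      then show "cmod (a j) \<le> sqrt (\<Sum>j<n. (cmod (a j))\<^sup>2)" by (rule real_le_rsqrt)
    qed (use seminorm_nonneg[OF N dV] in \<open>auto intro: sum_nonneg\<close>)
    also have "\<dots> = sqrt (\<Sum>j<n. (cmod (a j))\<^sup>2) * (4 * C * (1/2) ^ J * (\<Sum>j<n. (1/2) ^ j))"
      by (simp add: sum_distrib_left power_add mult_ac)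
    also have "\<dots> \<le> sqrt (\<Sum>j<n. (cmod (a j))\<^sup>2) * (4 * C * (1/2) ^ J * 2)"
    proof (intro mult_left_mono)
      show "(\<Sum>j<n. (1/2::real) ^ j) \<le> 2" by (subst geometric_sum) (auto simp: field_simps)
    qed (use \<open>C \<ge> 0\<close> in \<open>auto intro: sum_nonneg\<close>)
    also have "\<dots> \<le> sqrt (\<Sum>j<n. (cmod (a j))\<^sup>2) * (c / 2)"
      using J by (intro mult_left_mono) (auto intro: sum_nonneg)
    finally show ?thesis by (simp add: mult_ac)
  qed
  have sV: "(\<Sum>j<n. s (a j) (v (j + J))) \<in> V" "(\<Sum>j<n. s (a j) (v' (j + J))) \<in> V" for a :: "nat \<Rightarrow> complex" and n
    using vV vV' by (intro subspace_sum[OF sub] subspace_scale[OF sub]; simp)+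
  show ?thesis
  proof (rule that[of "\<lambda>j. v (j + J)"])
    show "sub_blocks y (\<lambda>j. v (j + J))"
      unfolding sub_blocks_def
    proof (intro exI[of _ "\<lambda>j. p (j + J)"] conjI allI)
      show "strict_mono (\<lambda>j. p (j + J))" using p(1) by (auto simp: strict_mono_def)
      show "v (j + J) \<in> span (y ` {p (j + J)..<p (Suc j + J)})" for j
        unfolding v_def by (intro span_sum span_scale span_base) auto
    qed
    show "l2_basis N (\<lambda>j. v (j + J))"
      unfolding l2_basis_def l2_bounds_def
    proof (rule exI[of _ "c / 2"], intro exI[of _ "C + c / 2"] conjI allI)
      fix a :: "nat \<Rightarrow> complex" and n
      let ?A = "sqrt (\<Sum>j<n. (cmod (a j))\<^sup>2)"
      let ?x = "\<Sum>j<n. s (a j) (v (j + J))" and ?x' = "\<Sum>j<n. s (a j) (v' (j + J))"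
      have "N ?x' \<le> N ?x + N (?x - ?x')"
        using seminorm_diff[OF N sV(1)[of a n] subspace_diff[OF sub sV[of a n]]] by simp
      then show "c / 2 * ?A \<le> N ?x"
        using cJ(1)[of a n] near[of a n] by linarith
      have "N ?x \<le> N ?x' + N (?x - ?x')"
        using seminorm_add[OF N sV(2)[of a n] subspace_diff[OF sub sV[of a n]]] by simp
      then show "N ?x \<le> (C + c / 2) * ?A"
        using cJ(2)[of a n] near[of a n] by (simp add: algebra_simps)
    qed (use \<open>c > 0\<close> in auto)
  qed
qed

text \<open>The three-space argument: either \<open>N0\<close> controls \<open>N\<close> on a tail of the block sequence, and
  the blocks can be selected for \<open>N0\<close>, or there are blocks on which \<open>N0\<close> is negligible, and these are
  small perturbations of blocks in \<open>V0\<close>.\<close>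

lemma l2_block_property_three_space:
  assumes N: "seminorm_on V N" and N0: "seminorm_on V N0" and le: "\<And>x. x \<in> V \<Longrightarrow> N0 x \<le> N x"
    and V0: "V0 \<subseteq> V" and P0: "l2_block_property V N0" and P: "l2_block_property V0 N"
    and lift: "\<And>x S e. x \<in> V \<Longrightarrow> R S x = x \<Longrightarrow> e > 0 \<Longrightarrow>
      \<exists>x'\<in>V0. R S x' = x' \<and> N (x - x') \<le> N0 x + e"
  shows "l2_block_property V N"
  unfolding l2_block_property_def
proof (intro allI impI, elim conjE)
  fix y assume y: "blocks V y" "\<forall>n. N (y n) > 0"
  note sub = seminorm_subspace[OF N]
  obtain m where m: "strict_mono m" "\<And>n. y n \<in> V" "\<And>n. R {m n..<m (Suc n)} (y n) = y n"
    using y(1) by (auto simp: blocks_def)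
  have spV: "span (y ` A) \<subseteq> V" for A
    using m(2) by (intro span_minimal sub) auto
  show "\<exists>v. sub_blocks y v \<and> l2_basis N v"
  proof (cases "\<exists>k. \<exists>c>0. \<forall>x\<in>span (y ` {k..}). c * N x \<le> N0 x")
    case True
    then obtain k c where c: "c > 0" "\<And>x. x \<in> span (y ` {k..}) \<Longrightarrow> c * N x \<le> N0 x" by blast
    let ?y = "\<lambda>n. y (n + k)"
    have "blocks V ?y"
      unfolding blocks_def using m
      by (intro exI[of _ "\<lambda>n. m (n + k)"]) (auto simp: strict_mono_def)
    moreover have "N0 (?y n) > 0" for n
    proof -
      have "y (n + k) \<in> span (y ` {k..})" by (intro span_base) auto
      then have "c * N (y (n + k)) \<le> N0 (y (n + k))" by (rule c(2))
      moreover have "0 < c * N (y (n + k))" using c y(2) by (intro mult_pos_pos) auto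
      ultimately show ?thesis by linarith
    qed
    ultimately obtain v where v: "sub_blocks ?y v" "l2_basis N0 v"
      using P0 unfolding l2_block_property_def by blast
    obtain d D where "d > 0" and D: "l2_bounds d D N0 v"
      using v(2) by (auto simp: l2_basis_def)
    have vs: "v j \<in> span (y ` {k..})" for j
      by (rule sub_blocks_in[OF subspace_span _ v(1)]) (auto intro: span_base)
    have "l2_bounds d (D / c) N v"
      unfolding l2_bounds_def
    proof (intro allI conjI)
      fix a :: "nat \<Rightarrow> complex" and n
      let ?x = "\<Sum>j<n. s (a j) (v j)"
      have x: "?x \<in> span (y ` {k..})" using vs by (intro span_sum span_scale)
      have "N0 ?x \<le> N ?x" using x spV by (intro le) auto
      then show "d * sqrt (\<Sum>j<n. (cmod (a j))\<^sup>2) \<le> N ?x"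
        using D unfolding l2_bounds_def by (meson order_trans)
      have "c * N ?x \<le> D * sqrt (\<Sum>j<n. (cmod (a j))\<^sup>2)"
        using c(2)[OF x] D unfolding l2_bounds_def by (meson order_trans)
      then show "N ?x \<le> D / c * sqrt (\<Sum>j<n. (cmod (a j))\<^sup>2)"
        using c(1) by (simp add: field_simps)
    qed
    then show ?thesis
      using sub_blocks_shift[OF v(1)] \<open>d > 0\<close> by (auto simp: l2_basis_def)
  next
    case False
    \<comment> \<open>The exponent n + 2 leaves room for an equal error in the lifting. Both
      together are (1/2)^(n + 1), so the lifted blocks keep seminorm at least 1/2.\<close>
    have "\<exists>x\<in>span (y ` {k..}). N x = 1 \<and> N0 x \<le> (1/2) ^ (n + 2)" for n k
    proof -
      have "(1/2::real) ^ (n + 2) > 0" by simp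
      then obtain x where x: "x \<in> span (y ` {k..})" "(1/2) ^ (n + 2) * N x > N0 x"
        using False by (meson not_le)
      have xV: "x \<in> V" using x(1) spV by auto
      have "N x \<noteq> 0" using x(2) seminorm_nonneg[OF N0 xV] by auto
      then have pos: "N x > 0" using seminorm_nonneg[OF N xV] by simp
      let ?z = "s (of_real (1 / N x)) x"
      have "N ?z = 1" using pos by (simp add: seminorm_scale[OF N xV] norm_divide)
      moreover have "N0 ?z \<le> (1/2) ^ (n + 2)"
        using x(2) pos by (simp add: seminorm_scale[OF N0 xV] norm_divide field_simps)
      ultimately show ?thesis using span_scale[OF x(1)] by blast
    qed
    then obtain v where v: "sub_blocks y v" "\<And>n. N (v n) = 1 \<and> N0 (v n) \<le> (1/2) ^ (n + 2)"
      using sub_blocks_choice[of y "\<lambda>n x. N x = 1 \<and> N0 x \<le> (1/2) ^ (n + 2)"] by blast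
    have "blocks V v" by (rule blocks_sub_blocks[OF sub y(1) v(1)])
    then obtain q where q: "strict_mono q" "\<And>n. v n \<in> V" "\<And>n. R {q n..<q (Suc n)} (v n) = v n"
      by (auto simp: blocks_def)
    have "\<exists>x'\<in>V0. R {q n..<q (Suc n)} x' = x' \<and> N (v n - x') \<le> N0 (v n) + (1/2) ^ (n + 2)" for n
      by (rule lift[OF q(2,3)]) simp
    then obtain v' where v': "\<And>n. v' n \<in> V0" "\<And>n. R {q n..<q (Suc n)} (v' n) = v' n"
      "\<And>n. N (v n - v' n) \<le> N0 (v n) + (1/2) ^ (n + 2)"
      by metis
    have close: "N (v n - v' n) \<le> (1/2) ^ (n + 1)" for n
      using v'(3)[of n] v(2)[of n] by simp
    have half: "N (v' n) \<ge> 1/2" for n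
    proof -
      have "N (v n) \<le> N (v' n) + N (v n - v' n)"
        using seminorm_add[OF N, of "v' n" "v n - v' n"] subspace_diff[OF sub q(2)] v'(1) V0 by auto
      moreover have "(1/2::real) ^ (n + 1) \<le> 1/2"
        using power_decreasing[of 1 "n + 1" "1/2::real"] by simp
      ultimately show ?thesis using v(2)[of n] close[of n] by linarith
    qed
    have b0: "blocks V0 v'" using q(1) v'(1,2) by (auto simp: blocks_def)
    moreover have "N (v' n) > 0" for n using half[of n] by linarith
    ultimately obtain u' where u': "sub_blocks v' u'" "l2_basis N u'"
      using P unfolding l2_block_property_def by blast
    have b: "blocks V v'" using b0 V0 unfolding blocks_def by blast
    have cl: "N (v n - v' n) \<le> (1/2) ^ n" for n
      using close[of n] by (rule order_trans) simp
    obtain u where "sub_blocks v u" "l2_basis N u"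
      by (rule l2_perturbation[OF N b half q(2) cl u'])
    then show ?thesis using sub_blocks_trans[OF v(1)] by blast
  qed
qed

end

section \<open>Modular sequence spaces\<close>

text \<open>Up to constants the inverse of the Orlicz function (s / |ln s|^k)^2 near 0:
  \<open>t\<close> is the mass that an entry of modulus \<open>rho k t\<close> contributes to the
  modular. The function increases as long as - ln t \<ge> 2k; with k \<le> 2 this explains the
  threshold \<open>exp (-4)\<close>.\<close>

definition rho :: "nat \<Rightarrow> real \<Rightarrow> real" where
  "rho k t = sqrt t * (- ln t) ^ k"

lemma rho_0 [simp]: "rho k 0 = 0"
  by (simp add: rho_def)

lemma ln_le_minus_4: "0 < (t::real) \<Longrightarrow> t \<le> exp (-4) \<Longrightarrow> ln t \<le> -4"
  using ln_le_cancel_iff[of t "exp (-4)"] by simp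

lemma rho_nonneg: "0 \<le> t \<Longrightarrow> t \<le> exp (-4) \<Longrightarrow> 0 \<le> rho k t"
proof (cases "t = 0")
  case False
  assume "0 \<le> t" "t \<le> exp (-4)"
  with False have "0 \<le> - ln t" using ln_le_minus_4[of t] by linarith
  then show ?thesis
    unfolding rho_def using \<open>0 \<le> t\<close> by (intro mult_nonneg_nonneg zero_le_power) simp_all
qed simp

lemma sqrt_eq_exp: "t > 0 \<Longrightarrow> sqrt t = exp (ln t / 2)"
  by (rule real_sqrt_unique) (simp_all add: power2_eq_square flip: exp_add)

text \<open>With T = - ln u \<ge> 4 and q = ln u - ln t, the logarithm grows from T to T + q \<le> T
  exp (q/4). Its k-th power, k \<le> 2, thus gains at most exp (q/2), which is what the square root
  loses.\<close>

lemma rho_mono: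
  assumes "0 \<le> t" "t \<le> u" "u \<le> exp (-4)" "k \<le> 2"
  shows "rho k t \<le> rho k u"
proof (cases "t = 0")
  case True
  then show ?thesis using rho_nonneg assms by simp
next
  case False
  then have t: "t > 0" "u > 0" using assms by auto
  define q where "q = ln u - ln t"
  have q: "q \<ge> 0" using t assms by (simp add: q_def)
  define T where "T = - ln u"
  have T: "T \<ge> 4" using ln_le_minus_4[of u] t assms by (simp add: T_def)
  have "T + q \<le> T * (1 + q / 4)"
    using T q mult_right_mono[of 4 T "q / 4"] by (simp add: algebra_simps)
  also have "\<dots> \<le> T * exp (q / 4)" using T by (intro mult_left_mono) auto
  finally have "(T + q) ^ k \<le> (T * exp (q / 4)) ^ k" using T q by (intro power_mono) auto
  also have "\<dots> = T ^ k * exp (q / 4) ^ k" by (simp add: power_mult_distrib)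
  also have "\<dots> \<le> T ^ k * exp (q / 4) ^ 2"
    using T q assms by (intro mult_left_mono power_increasing) auto
  also have "exp (q / 4) ^ 2 = exp (q / 2)" by (simp add: power2_eq_square flip: exp_add)
  finally have le: "(T + q) ^ k \<le> T ^ k * exp (q / 2)" .
  have "rho k t = exp (- ln u / 2 * -1) * exp (- q / 2) * (T + q) ^ k"
    using t by (simp add: rho_def sqrt_eq_exp T_def q_def flip: exp_add) (simp add: field_simps)
  also have "\<dots> \<le> exp (- ln u / 2 * -1) * exp (- q / 2) * (T ^ k * exp (q / 2))"
    using le by (intro mult_left_mono) auto
  also have "\<dots> = exp (- q / 2) * exp (q / 2) * (sqrt u * T ^ k)"
    using t by (simp add: sqrt_eq_exp)
  also have "\<dots> = rho k u" by (simp add: rho_def T_def flip: exp_add)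
  finally show ?thesis .
qed

text \<open>A crude bound free of logarithms: enough to bound entries and to see that entries of
  fixed size have masses bounded below.\<close>

lemma rho_le_root:
  assumes "0 \<le> t" "t \<le> exp (-4)" "k \<le> 2"
  shows "rho k t \<le> 32 * sqrt (sqrt t)"
proof (cases "t = 0")
  case False
  then have t: "t > 0" using assms by auto
  define u where "u = - ln t"
  have u: "u \<ge> 4" using ln_le_minus_4[of t] t assms by (simp add: u_def)
  have "u ^ k \<le> u ^ 2" using u assms by (intro power_increasing) auto
  also have "\<dots> \<le> 32 * exp (u / 4)"
    using exp_lower_Taylor_quadratic[of "u / 4"] u by (simp add: power_divide)
  finally have "u ^ k \<le> 32 * exp (u / 4)" .
  then have "sqrt t * u ^ k \<le> exp (- u / 2) * (32 * exp (u / 4))"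
    using t by (simp add: sqrt_eq_exp u_def)
  also have "\<dots> = 32 * (exp (- u / 2) * exp (u / 4))" by simp
  also have "exp (- u / 2) * exp (u / 4) = exp (- u / 4)" by (simp flip: exp_add)
  also have "exp (- u / 4) = sqrt (sqrt t)"
    using t by (simp add: sqrt_eq_exp u_def)
  finally show ?thesis by (simp add: rho_def u_def)
qed simp

text \<open>Shrinking a mass by \<open>exp (- q)\<close> gains \<open>exp (- q / 2)\<close> from the
  square root, and the logarithm gives back only a polynomial in q.\<close>

lemma rho_scale:
  assumes "0 \<le> t" "0 \<le> q" "t * exp q \<le> exp (-4)" "k \<le> 2"
  shows "rho k t \<le> exp (- q / 2) * (1 + q)\<^sup>2 * rho k (t * exp q)"
proof (cases "t = 0")
  case False
  then have t: "t > 0" using assms by auto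
  define u where "u = - ln (t * exp q)"
  have u: "u \<ge> 4" using ln_le_minus_4[of "t * exp q"] t assms by (simp add: u_def)
  have lt: "- ln t = u + q" using t by (simp add: u_def ln_mult)
  have "u + q \<le> u * (1 + q)"
    using mult_right_mono[of 1 u q] u assms by (simp add: algebra_simps)
  then have "(u + q) ^ k \<le> (u * (1 + q)) ^ k" using u assms by (intro power_mono) auto
  also have "\<dots> = u ^ k * (1 + q) ^ k" by (simp add: power_mult_distrib)
  also have "\<dots> \<le> u ^ k * (1 + q) ^ 2"
    using u assms by (intro mult_left_mono power_increasing) auto
  finally have le: "(u + q) ^ k \<le> u ^ k * (1 + q)\<^sup>2" .
  have sq: "sqrt t = exp (- q / 2) * sqrt (t * exp q)"
    using t by (simp add: sqrt_eq_exp ln_mult add_divide_distrib flip: exp_add)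
  have "rho k t = exp (- q / 2) * sqrt (t * exp q) * (u + q) ^ k"
    by (simp only: rho_def lt sq)
  also have "\<dots> \<le> exp (- q / 2) * sqrt (t * exp q) * (u ^ k * (1 + q)\<^sup>2)"
    using le t by (intro mult_left_mono) auto
  also have "\<dots> = exp (- q / 2) * (1 + q)\<^sup>2 * rho k (t * exp q)"
    by (simp add: rho_def u_def)
  finally show ?thesis .
qed simp

section \<open>Consecutive intervals of indices\<close>

lemma sum_blocks:
  fixes g :: "nat \<Rightarrow> real"
  assumes "strict_mono (m :: nat \<Rightarrow> nat)"
  shows "(\<Sum>i\<in>{m 0..<m n}. g i) = (\<Sum>j<n. \<Sum>i\<in>{m j..<m (Suc j)}. g i)"
proof (induction n)
  case (Suc n)
  have "m 0 \<le> m n" "m n \<le> m (Suc n)" using assms by (auto simp: strict_mono_less_eq)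
  then show ?case using Suc sum.atLeastLessThan_concat[of "m 0" "m n" "m (Suc n)" g] by simp
qed simp

lemma in_block_iff:
  assumes "strict_mono (m :: nat \<Rightarrow> nat)" "i \<in> {m j..<m (Suc j)}"
  shows "i \<in> {m l..<m (Suc l)} \<longleftrightarrow> l = j"
proof
  assume l: "i \<in> {m l..<m (Suc l)}"
  show "l = j"
  proof (rule ccontr)
    assume "l \<noteq> j"
    then have "m (Suc l) \<le> m j \<or> m (Suc j) \<le> m l"
      using assms(1) by (auto simp: strict_mono_less_eq)
    then show False using l assms(2) by auto
  qed
qed (use assms in simp)

lemma block_cover:
  assumes "strict_mono (m :: nat \<Rightarrow> nat)" "i \<in> {m 0..<m n}"
  obtains j where "j < n" "i \<in> {m j..<m (Suc j)}"
proof -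
  have "\<exists>j<n. i \<in> {m j..<m (Suc j)}"
    using assms(2)
  proof (induction n)
    case (Suc n)
    then show ?case by (cases "i < m n") (auto intro: less_SucI)
  qed simp
  then show ?thesis using that by blast
qed

text \<open>\<open>N\<close> is equivalent to the Luxemburg norm of the modular with inverse
  \<open>rho k\<close>, expressed through assignments \<open>t\<close> of masses to coordinates.
  Both halves involve only finite sets of coordinates, which fits block vectors and avoids infinite
  sums.\<close>

locale modular_space = block_space s R
  for s :: "complex \<Rightarrow> 'v::ab_group_add \<Rightarrow> 'v" and R +
  fixes V :: "'v set" and N :: "'v \<Rightarrow> real" and f :: "'v \<Rightarrow> nat \<Rightarrow> complex" and k :: nat
    and K d :: real
  assumes N: "seminorm_on V N"
    and f_add: "x \<in> V \<Longrightarrow> y \<in> V \<Longrightarrow> f (x + y) n = f x n + f y n"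
    and f_scale: "x \<in> V \<Longrightarrow> f (s c x) n = c * f x n"
    and f_R: "x \<in> V \<Longrightarrow> f (R S x) n = (if n \<in> S then f x n else 0)"
    and k: "k \<le> 2" and d: "d > 0"
    and upper: "x \<in> V \<Longrightarrow> finite S \<Longrightarrow> R S x = x \<Longrightarrow> (\<And>n. 0 \<le> t n) \<Longrightarrow>
      (\<Sum>n\<in>S. t n) \<le> exp (-4) \<Longrightarrow> (\<And>n. n \<in> S \<Longrightarrow> cmod (f x n) \<le> rho k (t n)) \<Longrightarrow> N x \<le> K"
    and lower: "x \<in> V \<Longrightarrow> N x \<le> d \<Longrightarrow> finite S \<Longrightarrow>
      \<exists>t. (\<forall>n. 0 \<le> t n) \<and> (\<Sum>n\<in>S. t n) \<le> exp (-4) \<and> (\<forall>n\<in>S. cmod (f x n) \<le> rho k (t n))"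
begin

lemmas sub = seminorm_subspace[OF N]
lemmas nonneg = seminorm_nonneg[OF N]
lemmas scale = seminorm_scale[OF N]

lemma f_zero: "f 0 n = 0"
  using f_scale[of 0 0 n] subspace_0[OF sub] by simp

lemma f_sum: "(\<And>i. i \<in> I \<Longrightarrow> x i \<in> V) \<Longrightarrow> f (\<Sum>i\<in>I. x i) n = (\<Sum>i\<in>I. f (x i) n)"
  by (induction I rule: infinite_finite_induct) (auto simp: f_zero f_add subspace_sum[OF sub])

lemma f_blocks:
  assumes "strict_mono m" "\<And>j. v j \<in> V" "\<And>j. R {m j..<m (Suc j)} (v j) = v j"
    and "finite J" "j \<in> J" "i \<in> {m j..<m (Suc j)}"
  shows "f (\<Sum>j\<in>J. s (a j) (v j)) i = a j * f (v j) i"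
proof -
  have "f (v l) i = (if l = j then f (v j) i else 0)" for l
    using f_R[OF assms(2)[of l], of "{m l..<m (Suc l)}" i] in_block_iff[OF assms(1,6), of l] assms(3)[of l]
    by (simp split: if_splits)
  then have "f (\<Sum>j\<in>J. s (a j) (v j)) i = (\<Sum>l\<in>J. a l * (if l = j then f (v j) i else 0))"
    by (simp add: f_sum f_scale assms(2) subspace_scale[OF sub])
  then show ?thesis using assms(4,5) by (simp add: if_distrib cong: if_cong)
qed

lemma f_outside:
  assumes "strict_mono m" "\<And>j. v j \<in> V" "\<And>j. R {m j..<m (Suc j)} (v j) = v j"
    and "\<And>j. j \<in> J \<Longrightarrow> i \<notin> {m j..<m (Suc j)}"
  shows "f (\<Sum>j\<in>J. s (a j) (v j)) i = 0"
proof -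
  have "f (v l) i = 0" if "l \<in> J" for l
    using f_R[OF assms(2)[of l], of "{m l..<m (Suc l)}" i] assms(3)[of l] assms(4)[OF that]
    by (simp split: if_splits)
  then show ?thesis
    by (simp add: f_sum f_scale assms(2) subspace_scale[OF sub])
qed

text \<open>Rescaling to N x = d makes a bound on the ball homogeneous. As \<open>N\<close> is only
  a seminorm, N x = 0 is a separate case: all multiples of \<open>x\<close> then stay in the ball,
  which forces g x = 0.\<close>

lemma homogeneous:
  assumes "x \<in> V" "P x" "\<And>c x. x \<in> V \<Longrightarrow> P x \<Longrightarrow> P (s (of_real c) x)"
    and "\<And>c x. x \<in> V \<Longrightarrow> c \<ge> 0 \<Longrightarrow> g (s (of_real c) x) = c * g x"
    and "\<And>x. x \<in> V \<Longrightarrow> P x \<Longrightarrow> N x \<le> d \<Longrightarrow> g x \<le> B" "g x \<ge> 0"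
  shows "g x \<le> B / d * N x"
proof (cases "N x = 0")
  case True
  have "c * g x \<le> B" if "c \<ge> 0" for c
  proof -
    have "g (s (of_real c) x) \<le> B"
      by (rule assms(5)[OF subspace_scale[OF sub assms(1)] assms(3)[OF assms(1,2)]])
        (use scale[OF assms(1)] d True in simp)
    then show ?thesis using assms(4)[OF assms(1) that] by simp
  qed
  from this[of "(\<bar>B\<bar> + 1) / g x"] have "g x = 0"
    using assms(6) by (cases "g x = 0") auto
  then show ?thesis using True by simp
next
  case False
  then have pos: "N x > 0" using nonneg[OF assms(1)] by simp
  have "g (s (of_real (d / N x)) x) \<le> B"
    by (rule assms(5)[OF subspace_scale[OF sub assms(1)] assms(3)[OF assms(1,2)]])
      (use scale[OF assms(1)] d pos in \<open>simp add: norm_divide\<close>)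
  then have "d / N x * g x \<le> B"
    using assms(4)[OF assms(1), of "d / N x"] d pos by simp
  then show ?thesis using pos d by (simp add: field_simps)
qed

lemma f_bound:
  assumes "x \<in> V"
  shows "cmod (f x n) \<le> 32 / d * N x"
proof (rule homogeneous[where P = "\<lambda>x. True" and g = "\<lambda>x. cmod (f x n)", OF assms])
  fix x assume "x \<in> V" "N x \<le> d"
  then obtain t where t: "0 \<le> t n" "t n \<le> exp (-4)" "cmod (f x n) \<le> rho k (t n)"
    using lower[of x "{n}"] by auto
  have "t n \<le> 1" using t(2) by (rule order_trans) simp
  then have "sqrt (sqrt (t n)) \<le> 1" using t by simp
  then show "cmod (f x n) \<le> 32" using rho_le_root[OF t(1,2) k] t(3) by linarith
qed (auto simp: f_scale norm_mult)

lemma rho_inverse_bound: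
  assumes "0 \<le> t" "t \<le> exp (-4)" "th \<le> rho k t" "th \<ge> 0"
  shows "(th / 32) ^ 4 \<le> t"
proof -
  have "th / 32 \<le> sqrt (sqrt t)" using rho_le_root[OF assms(1,2) k] assms(3) by linarith
  then have "(th / 32) ^ 4 \<le> (sqrt (sqrt t)) ^ 4" using assms by (intro power_mono) auto
  also have "(sqrt (sqrt t)) ^ 4 = ((sqrt (sqrt t))\<^sup>2)\<^sup>2" by (simp flip: power_mult)
  also have "\<dots> = t" using assms by simp
  finally show ?thesis .
qed

text \<open>If no normalised y_n beyond \<open>k0\<close> is flat, each has an entry above
  \<open>e\<close>. In long sums of them the entries stay below \<open>32 / d\<close>, because the
  supports are disjoint, while the seminorms are unbounded, because every tall entry takes up a
  fixed mass. Hence a normalised long sum is flat.\<close>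

lemma flat_vector:
  assumes y: "blocks V y" "\<And>n. N (y n) > 0" and e: "e > 0"
  shows "\<exists>x\<in>span (y ` {k0..}). N x = 1 \<and> (\<forall>n. cmod (f x n) \<le> e)"
proof (cases "\<exists>n\<ge>k0. \<forall>i. cmod (f (y n) i) \<le> e * N (y n)")
  case True
  then obtain n where n: "n \<ge> k0" "\<And>i. cmod (f (y n) i) \<le> e * N (y n)" by blast
  have yV: "y n \<in> V" using y(1) by (auto simp: blocks_def)
  let ?x = "s (of_real (1 / N (y n))) (y n)"
  have "?x \<in> span (y ` {k0..})" using n(1) by (intro span_scale span_base) auto
  moreover have "N ?x = 1" using y(2)[of n] by (simp add: scale[OF yV] norm_divide)
  moreover have "cmod (f ?x i) \<le> e" for i
    using n(2)[of i] y(2)[of n] by (simp add: f_scale[OF yV] norm_mult norm_divide field_simps)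
  ultimately show ?thesis by blast
next
  case False
  then obtain i where i: "\<And>n. n \<ge> k0 \<Longrightarrow> cmod (f (y n) (i n)) > e * N (y n)"
    by (metis not_le)
  obtain m where m: "strict_mono m" "\<And>n. y n \<in> V" "\<And>n. R {m n..<m (Suc n)} (y n) = y n"
    using y(1) by (auto simp: blocks_def)
  have i_in: "i n \<in> {m n..<m (Suc n)}" if "n \<ge> k0" for n
  proof (rule ccontr)
    assume "\<not> ?thesis"
    then have "f (R {m n..<m (Suc n)} (y n)) (i n) = 0" by (subst f_R[OF m(2)]) auto
    then have "f (y n) (i n) = 0" by (simp only: m(3))
    then show False using i[OF that] e y(2)[of n] by (simp add: mult_less_0_iff not_less)
  qed
  define X where "X M = (\<Sum>n\<in>{k0..<k0 + M}. s (of_real (1 / N (y n))) (y n))" for M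
  have XV: "X M \<in> V" for M
    unfolding X_def using m(2) by (intro subspace_sum[OF sub] subspace_scale[OF sub])
  have Xs: "X M \<in> span (y ` {k0..})" for M
    unfolding X_def by (intro span_sum span_scale span_base) auto
  define D where "D = 32 / d"
  have D: "D > 0" using d by (simp add: D_def)
  have fX: "cmod (f (X M) l) \<le> D" for M l
  proof (cases "\<exists>n\<in>{k0..<k0 + M}. l \<in> {m n..<m (Suc n)}")
    case True
    then obtain n where n: "n \<in> {k0..<k0 + M}" "l \<in> {m n..<m (Suc n)}" by blast
    have "f (X M) l = of_real (1 / N (y n)) * f (y n) l"
      unfolding X_def by (rule f_blocks[OF m _ n]) simp
    then have "cmod (f (X M) l) = cmod (f (y n) l) / N (y n)"
      using y(2)[of n] by (simp add: norm_mult norm_divide)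
    then show ?thesis
      using f_bound[OF m(2), of n l] y(2)[of n] by (simp only: D_def pos_divide_le_eq)
  next
    case False
    then have "f (X M) l = 0" unfolding X_def by (intro f_outside[OF m]) auto
    then show ?thesis using D by simp
  qed
  have "\<exists>M. N (X M) \<ge> D / e"
  proof (rule ccontr)
    assume "\<not> ?thesis"
    then have small: "N (X M) < D / e" for M by (meson not_le)
    define B where "B = D / e"
    have B: "B > 0" using D e by (simp add: B_def)
    define th where "th = d / B * e"
    have th: "th > 0" using B d e by (simp add: th_def)
    \<comment> \<open>After scaling into the ball of radius \<open>d\<close>, each of the
      \<open>M\<close> tall entries has modulus at least \<open>th\<close> and therefore mass at
      least \<open>(th / 32) ^ 4\<close>, whereas the total mass is at most 1.\<close>
    have bound: "real M * (th / 32) ^ 4 \<le> 1" for M :: nat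
    proof -
      let ?S = "i ` {k0..<k0 + M}"
      have inj: "inj_on i {k0..<k0 + M}"
        using i_in in_block_iff[OF m(1)] by (auto intro!: inj_onI) (metis)
      let ?x = "s (of_real (d / B)) (X M)"
      have "N ?x = d / B * N (X M)" using B d by (simp add: scale[OF XV] norm_divide)
      also have "\<dots> \<le> d / B * B"
        using small[of M] B d unfolding B_def[symmetric] by (intro mult_left_mono) auto
      finally have Nx: "N ?x \<le> d" using B by simp
      then obtain t where t: "\<And>n. 0 \<le> t n" "(\<Sum>n\<in>?S. t n) \<le> exp (-4)"
        "\<And>n. n \<in> ?S \<Longrightarrow> cmod (f ?x n) \<le> rho k (t n)"
        using lower[OF subspace_scale[OF sub XV] Nx, of ?S] finite_imageI[of "{k0..<k0 + M}" i] by blast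
      have "(th / 32) ^ 4 \<le> t (i n)" if n: "n \<in> {k0..<k0 + M}" for n
      proof (rule rho_inverse_bound)
        have "f (X M) (i n) = of_real (1 / N (y n)) * f (y n) (i n)"
          unfolding X_def by (rule f_blocks[OF m _ n]) (use n i_in in auto)
        then have "cmod (f ?x (i n)) = d / B * (cmod (f (y n) (i n)) / N (y n))"
          using B d y(2)[of n] by (simp add: f_scale[OF XV] norm_mult norm_divide)
        also have "\<dots> \<ge> d / B * e"
          using B d y(2)[of n] i[of n] n by (intro mult_left_mono) (auto simp: field_simps)
        finally show "th \<le> rho k (t (i n))" using t(3)[of "i n"] n by (auto simp: th_def)
        have "t (i n) \<le> (\<Sum>n\<in>?S. t n)" using n t(1) by (intro member_le_sum) auto
        then show "t (i n) \<le> exp (-4)" using t(2) by linarith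
      qed (use t th in auto)
      then have "(\<Sum>n\<in>{k0..<k0 + M}. (th / 32) ^ 4) \<le> (\<Sum>n\<in>{k0..<k0 + M}. t (i n))"
        by (intro sum_mono)
      also have "\<dots> = (\<Sum>n\<in>?S. t n)" using inj by (simp add: sum.reindex)
      also have "\<dots> \<le> 1" using t(2) by (rule order_trans) simp
      finally show ?thesis by simp
    qed
    obtain M :: nat where "M > 1 / (th / 32) ^ 4" using reals_Archimedean2 by blast
    then show False using bound[of M] th by (simp add: field_simps)
  qed
  then obtain M where M: "N (X M) \<ge> D / e" by blast
  then have pos: "N (X M) > 0" using D e by (smt (verit) divide_pos_pos)
  let ?x = "s (of_real (1 / N (X M))) (X M)"
  have "?x \<in> span (y ` {k0..})" using Xs by (intro span_scale)
  moreover have "N ?x = 1" using pos by (simp add: scale[OF XV] norm_divide)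
  moreover have "cmod (f ?x l) \<le> e" for l
  proof -
    have "cmod (f (X M) l) \<le> e * N (X M)"
      using fX[of M l] M e by (simp add: field_simps)
    then show ?thesis using pos by (simp add: f_scale[OF XV] norm_mult norm_divide field_simps)
  qed
  ultimately show ?thesis by blast
qed


text \<open>An exponent for which shrinking all masses by \<open>exp (- gap)\<close> outweighs
  \<open>K\<close> and the factor 4 lost in comparing logarithms. Here 864 = 4 * 216, where 216 =
  6^3 stems from cubing x \<le> exp x at x = (1 + gap) / 6.\<close>

definition gap :: real where
  "gap = 864 * \<bar>K\<bar> + 1"

lemma gap: "gap \<ge> 0" "4 * \<bar>K\<bar> * (exp (- gap / 2) * (1 + gap)\<^sup>2) < 1"
proof -
  show g: "gap \<ge> 0" by (simp add: gap_def)
  have "((1 + gap) / 6) ^ 3 \<le> exp (gap / 6) ^ 3"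
  proof (rule power_mono)
    have "(1 + gap) / 6 \<le> 1 + gap / 6" by (simp add: add_divide_distrib)
    then show "(1 + gap) / 6 \<le> exp (gap / 6)" using exp_ge_add_one_self[of "gap / 6"] by linarith
  qed (use g in simp)
  also have "\<dots> = exp (gap / 2)" by (simp flip: exp_of_nat_mult)
  finally have e: "(1 + gap) ^ 3 \<le> 216 * exp (gap / 2)" by (simp add: power_divide)
  have "(1 + gap) * (exp (- gap / 2) * (1 + gap)\<^sup>2) = exp (- gap / 2) * (1 + gap) ^ 3"
    by (simp add: power3_eq_cube power2_eq_square)
  also have "\<dots> \<le> exp (- gap / 2) * (216 * exp (gap / 2))"
    using e by (intro mult_left_mono) auto
  also have "\<dots> = 216" by (simp add: exp_minus)
  finally have *: "(1 + gap) * (exp (- gap / 2) * (1 + gap)\<^sup>2) \<le> 216" .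
  have "4 * \<bar>K\<bar> * (exp (- gap / 2) * (1 + gap)\<^sup>2) * (1 + gap)
    = 4 * \<bar>K\<bar> * ((1 + gap) * (exp (- gap / 2) * (1 + gap)\<^sup>2))" by simp
  also have "\<dots> \<le> 4 * \<bar>K\<bar> * 216" using * by (intro mult_left_mono) auto
  also have "\<dots> < 1 * (1 + gap)" by (simp add: gap_def)
  finally show "4 * \<bar>K\<bar> * (exp (- gap / 2) * (1 + gap)\<^sup>2) < 1"
    by (rule mult_right_less_imp_less) (use g in simp)
qed

text \<open>Suppose the masses \<open>t\<close> of the multiple of \<open>v\<close> by
  \<open>a\<close> had a total far below |a|^2. Divided by |a|^2 they almost serve as masses for
  \<open>v\<close> itself: flatness allows them to be capped at \<open>exp (-2 * (j + 2))\<close>,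
  and then |a| > 2^(-j) ensures that dividing by |a|^2 affects logarithms by a factor of at most 2.
  By the choice of \<open>gap\<close> the seminorm of \<open>v\<close> would be below 1.\<close>

lemma mass_lower_bound:
  fixes j :: nat
  assumes v: "v \<in> V" "R S v = v" "finite S" "N v = 1"
    and flat: "\<And>i. cmod (f v i) \<le> exp (- real (j + 2))"
    and t: "\<And>i. i \<in> S \<Longrightarrow> 0 \<le> t i" "\<And>i. i \<in> S \<Longrightarrow> t i \<le> exp (-4)"
      "\<And>i. i \<in> S \<Longrightarrow> cmod a * cmod (f v i) \<le> rho k (t i)"
    and a: "cmod a > (1/2) ^ j"
  shows "(cmod a)\<^sup>2 \<le> exp (gap + 4) * (\<Sum>i\<in>S. t i)"
proof (rule ccontr)
  assume "\<not> ?thesis"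
  then have big: "exp (gap + 4) * (\<Sum>i\<in>S. t i) < (cmod a)\<^sup>2" by simp
  have a0: "cmod a > 0" using a by (rule order.strict_trans[rotated]) simp
  \<comment> \<open>The cap is the square of the sup bound of \<open>v\<close>, so where it is
    active \<open>flat\<close> alone gives the estimate sought.\<close>
  define u where "u i = min (t i / (cmod a)\<^sup>2) (exp (-2 * real (j + 2)))" for i
  define u' where "u' i = (if i \<in> S then u i * exp gap else 0)" for i
  have u0: "0 \<le> u i" if "i \<in> S" for i using t(1)[OF that] by (simp add: u_def)
  have tu: "u i \<le> t i / (cmod a)\<^sup>2" for i by (simp add: u_def)
  have "(\<Sum>i\<in>S. u i) \<le> (\<Sum>i\<in>S. t i) / (cmod a)\<^sup>2"
    unfolding sum_divide_distrib by (intro sum_mono tu)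
  also have "\<dots> \<le> exp (- gap - 4)"
  proof -
    have "exp (gap + 4) * exp (- gap - 4) = 1" by (simp flip: exp_add)
    then have "(\<Sum>i\<in>S. t i) = exp (gap + 4) * (\<Sum>i\<in>S. t i) * exp (- gap - 4)" by (simp add: mult_ac)
    also have "\<dots> \<le> (cmod a)\<^sup>2 * exp (- gap - 4)" using big by (intro mult_right_mono) auto
    finally show ?thesis using a0 by (simp add: field_simps)
  qed
  finally have su: "(\<Sum>i\<in>S. u i) \<le> exp (- gap - 4)" .
  have su': "(\<Sum>i\<in>S. u' i) \<le> exp (-4)"
  proof -
    have "(\<Sum>i\<in>S. u' i) = (\<Sum>i\<in>S. u i) * exp gap"
      by (simp add: u'_def sum_distrib_right)
    also have "\<dots> \<le> exp (- gap - 4) * exp gap" using su by (intro mult_right_mono) auto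
    finally show ?thesis by (simp flip: exp_add)
  qed
  have fu: "cmod (f v i) \<le> 4 * rho k (u i)" if i: "i \<in> S" for i
  proof (cases "t i / (cmod a)\<^sup>2 \<le> exp (-2 * real (j + 2))")
    case False
    then have ui: "u i = exp (-2 * real (j + 2))" by (simp add: u_def)
    have "sqrt (u i) = exp (- real (j + 2))" unfolding ui by (subst sqrt_eq_exp) auto
    moreover have "1 \<le> (2 * real (j + 2)) ^ k" by (intro one_le_power) auto
    ultimately have "exp (- real (j + 2)) * 1 \<le> rho k (u i)"
      unfolding rho_def by (intro mult_mono) (auto simp: ui)
    moreover have "0 \<le> exp (- real (j + 2))" by simp
    ultimately show ?thesis using flat[of i] by linarith
  next
    case True
    show ?thesis
    proof (cases "t i = 0")
      case True
      then have "cmod (f v i) = 0" using t(3)[OF i] a0 by (simp add: mult_le_0_iff)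
      then show ?thesis using True by (simp add: u_def)
    next
      case False
      then have ti: "t i > 0" using t(1)[OF i] by simp
      have ui: "u i = t i / (cmod a)\<^sup>2" using True by (simp add: u_def)
      have upos: "u i > 0" using ti a0 by (simp add: ui)
      have "ln (u i) \<le> ln (exp (-2 * real (j + 2)))"
        using True upos by (subst ln_le_cancel_iff) (auto simp: ui)
      then have lu: "2 * real j + 4 \<le> - ln (u i)" by simp
      have "ln ((1/2) ^ j) < ln (cmod a)" using a a0 by (subst ln_less_cancel_iff) auto
      moreover have "ln ((1/2) ^ j) \<ge> - real j"
      proof -
        have "ln ((1/2::real) ^ j) = - (real j * ln 2)" by (simp add: ln_realpow ln_div)
        moreover have "real j * ln 2 \<le> real j * 1"
          using ln_le_minus_one[of "2::real"] by (intro mult_left_mono) auto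
        ultimately show ?thesis by linarith
      qed
      ultimately have la: "ln (cmod a) \<ge> - real j" by linarith
      have "ln (u i) = ln (t i) - 2 * ln (cmod a)"
        using ti a0 by (simp add: ui ln_div ln_realpow)
      \<comment> \<open>The two logarithms differ by - 2 ln |a| \<le> 2j, and the cap makes this at
        most - ln (u i).\<close>
      then have "- ln (t i) \<le> 2 * - ln (u i)" using lu la by linarith
      moreover have "- ln (t i) \<ge> 0" using ln_le_minus_4[OF ti t(2)[OF i]] by simp
      ultimately have "(- ln (t i)) ^ k \<le> (2 * - ln (u i)) ^ k" by (intro power_mono)
      also have "\<dots> = 2 ^ k * (- ln (u i)) ^ k" by (rule power_mult_distrib)
      also have "\<dots> \<le> 2 ^ 2 * (- ln (u i)) ^ k"
        using lu k by (intro mult_right_mono power_increasing zero_le_power) auto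
      finally have p: "(- ln (t i)) ^ k \<le> 4 * (- ln (u i)) ^ k" by simp
      have "cmod (f v i) \<le> sqrt (t i) / cmod a * (- ln (t i)) ^ k"
        using t(3)[OF i] a0 by (simp add: rho_def field_simps)
      also have "sqrt (t i) / cmod a = sqrt (u i)" using a0 by (simp add: ui real_sqrt_divide)
      also have "sqrt (u i) * (- ln (t i)) ^ k \<le> sqrt (u i) * (4 * (- ln (u i)) ^ k)"
        using p upos by (intro mult_left_mono) auto
      finally show ?thesis by (simp add: rho_def)
    qed
  qed
  define c where "c = 4 * (exp (- gap / 2) * (1 + gap)\<^sup>2)"
  have c: "c > 0" using gap(1) by (simp add: c_def)
  have fc: "cmod (f v i) \<le> c * rho k (u' i)" if i: "i \<in> S" for i
  proof -
    have "u' i \<le> (\<Sum>i\<in>S. u' i)"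
      using i \<open>finite S\<close> u0 by (intro member_le_sum) (auto simp: u'_def)
    then have "u i * exp gap \<le> exp (-4)" using su' i by (simp add: u'_def)
    then show ?thesis
      using fu[OF i] rho_scale[OF u0[OF i] gap(1) _ k] i by (simp add: c_def u'_def)
  qed
  let ?x = "s (of_real (1 / c)) v"
  have "N ?x \<le> K"
  proof (rule upper[of ?x S u'])
    show "?x \<in> V" by (rule subspace_scale[OF sub v(1)])
    show "R S ?x = ?x" by (simp add: R_scale v(2))
    show "0 \<le> u' n" for n using u0[of n] by (simp add: u'_def)
    show "cmod (f ?x n) \<le> rho k (u' n)" if "n \<in> S" for n
      using fc[OF that] c by (simp add: f_scale[OF v(1)] norm_mult norm_divide field_simps)
  qed (use v su' in auto)
  then have "1 \<le> K * c" using c v(4) by (simp add: scale[OF v(1)] norm_divide field_simps)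
  also have "\<dots> \<le> \<bar>K\<bar> * c" using c by (intro mult_right_mono) auto
  finally have "1 \<le> \<bar>K\<bar> * c" .
  then show False using gap(2) by (simp add: c_def)
qed

text \<open>The j-th block is chosen flat to the degree \<open>exp (- (j + 2))\<close>. For the
  upper estimate the masses of the single blocks are multiplied by |a_j|^2. For the lower one,
  coefficients with |a_j| \<le> 2^(-j) contribute a convergent series, and the others fall under
  \<open>mass_lower_bound\<close>.\<close>

theorem l2_block_property: "l2_block_property V N"
  unfolding l2_block_property_def
proof (intro allI impI, elim conjE)
  fix y assume y: "blocks V y" "\<forall>n. N (y n) > 0"
  obtain v where v: "sub_blocks y v" "\<And>n. N (v n) = 1 \<and> (\<forall>i. cmod (f (v n) i) \<le> exp (- real (n + 2)))"
    using sub_blocks_choice[of y "\<lambda>n x. N x = 1 \<and> (\<forall>i. cmod (f x i) \<le> exp (- real (n + 2)))"]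
      flat_vector[OF y(1)] y(2) by (metis exp_gt_zero)
  have "blocks V v" by (rule blocks_sub_blocks[OF sub y(1) v(1)])
  then obtain m where m: "strict_mono m" "\<And>n. v n \<in> V" "\<And>n. R {m n..<m (Suc n)} (v n) = v n"
    by (auto simp: blocks_def)
  define X where "X a n = (\<Sum>j<n. s (a j) (v j))" for a :: "nat \<Rightarrow> complex" and n
  have XV: "X a n \<in> V" for a n
    unfolding X_def using m(2) by (intro subspace_sum[OF sub] subspace_scale[OF sub])
  have Xs: "s c (X a n) = X (\<lambda>j. c * a j) n" for c a n
    by (simp add: X_def scale_sum_right)
  have fX: "f (X a n) i = a j * f (v j) i" if "j < n" "i \<in> {m j..<m (Suc j)}" for a n i j
    unfolding X_def by (rule f_blocks[OF m]) (use that in auto)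
  define e where "e a n = sqrt (\<Sum>j<n. (cmod (a j))\<^sup>2)" for a :: "nat \<Rightarrow> complex" and n
  have e0: "e a n \<ge> 0" for a n by (simp add: e_def sum_nonneg)
  have es: "e (\<lambda>j. of_real c * a j) n = \<bar>c\<bar> * e a n" for a c n
    by (simp add: e_def norm_mult power_mult_distrib real_sqrt_mult flip: sum_distrib_left)
  have up1: "N (X a n) \<le> K / d" if a: "e a n \<le> 1" for a n
  proof -
    have a1: "(\<Sum>j<n. (cmod (a j))\<^sup>2) \<le> 1" using a by (simp add: e_def)
    have "\<exists>t. (\<forall>i. 0 \<le> t i) \<and> (\<Sum>i\<in>{m j..<m (Suc j)}. t i) \<le> exp (-4) \<and>
      (\<forall>i\<in>{m j..<m (Suc j)}. cmod (f (s (of_real d) (v j)) i) \<le> rho k (t i))" for j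
      by (rule lower) (use m(2) v(2) d in \<open>auto simp: scale[OF m(2)] intro: subspace_scale[OF sub]\<close>)
    then obtain t where t: "\<And>j i. 0 \<le> t j i" "\<And>j. (\<Sum>i\<in>{m j..<m (Suc j)}. t j i) \<le> exp (-4)"
      "\<And>j i. i \<in> {m j..<m (Suc j)} \<Longrightarrow> cmod (f (s (of_real d) (v j)) i) \<le> rho k (t j i)"
      by metis
    have t4: "t j i \<le> exp (-4)" if "i \<in> {m j..<m (Suc j)}" for i j
    proof -
      have "t j i \<le> (\<Sum>i\<in>{m j..<m (Suc j)}. t j i)" using that t(1) by (intro member_le_sum) auto
      then show ?thesis using t(2)[of j] by linarith
    qed
    \<comment> \<open>These masses work since |a| \<open>rho k t\<close> is at most
      \<open>rho k\<close> at |a|^2 t for |a| \<le> 1: the square root scales exactly and the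
      logarithm only grows.\<close>
    define u where "u i = (\<Sum>j<n. if i \<in> {m j..<m (Suc j)} then (cmod (a j))\<^sup>2 * t j i else 0)" for i
    have u: "u i = (cmod (a j))\<^sup>2 * t j i" if "j < n" "i \<in> {m j..<m (Suc j)}" for i j
      using that(1) in_block_iff[OF m(1) that(2)] by (simp add: u_def)
    have aj: "(cmod (a j))\<^sup>2 \<le> 1" if "j < n" for j
    proof -
      have "(cmod (a j))\<^sup>2 \<le> (\<Sum>j<n. (cmod (a j))\<^sup>2)" using that by (intro member_le_sum) auto
      then show ?thesis using a1 by linarith
    qed
    have "N (X (\<lambda>j. of_real d * a j) n) \<le> K"
    proof (rule upper[of _ "{m 0..<m n}" u])
      show "R {m 0..<m n} (X (\<lambda>j. of_real d * a j) n) = X (\<lambda>j. of_real d * a j) n"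
        unfolding X_def R_sum R_scale
      proof (intro sum.cong refl arg_cong[where f = "s _"] R_superset[OF m(3)])
        fix j assume "j \<in> {..<n}"
        then have "m 0 \<le> m j" "m (Suc j) \<le> m n" using m(1) by (auto simp: strict_mono_less_eq)
        then show "{m j..<m (Suc j)} \<subseteq> {m 0..<m n}" by auto
      qed
      show "0 \<le> u i" for i unfolding u_def using t(1) by (intro sum_nonneg) auto
      have "(\<Sum>i\<in>{m 0..<m n}. u i) = (\<Sum>j<n. \<Sum>i\<in>{m j..<m (Suc j)}. (cmod (a j))\<^sup>2 * t j i)"
        unfolding sum_blocks[OF m(1)] using u by (intro sum.cong refl) auto
      also have "\<dots> \<le> (\<Sum>j<n. (cmod (a j))\<^sup>2 * exp (-4))"
        unfolding sum_distrib_left[symmetric] using t(2) by (intro sum_mono mult_left_mono) auto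
      also have "\<dots> \<le> 1 * exp (-4)"
        unfolding sum_distrib_right[symmetric] using a1 by (intro mult_right_mono) auto
      finally show "(\<Sum>i\<in>{m 0..<m n}. u i) \<le> exp (-4)" by simp
      fix i assume "i \<in> {m 0..<m n}"
      then obtain j where j: "j < n" "i \<in> {m j..<m (Suc j)}" by (rule block_cover[OF m(1)])
      have "cmod (f (X (\<lambda>j. of_real d * a j) n) i) = cmod (a j) * cmod (f (s (of_real d) (v j)) i)"
        by (simp add: fX[OF j] f_scale[OF m(2)] norm_mult)
      also have "\<dots> \<le> cmod (a j) * rho k (t j i)" using t(3)[OF j(2)] by (intro mult_left_mono) auto
      also have "\<dots> \<le> rho k (u i)"
      proof (cases "a j = 0 \<or> t j i = 0")
        case True
        then show ?thesis by (auto simp: u[OF j])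
      next
        case False
        then have pos: "cmod (a j) > 0" "t j i > 0" using t(1)[of j i] by auto
        have "(cmod (a j))\<^sup>2 * t j i \<le> 1 * t j i" using aj[OF j(1)] pos by (intro mult_right_mono) auto
        then have "ln (u i) \<le> ln (t j i)" using pos by (subst ln_le_cancel_iff) (auto simp: u[OF j])
        then have "(- ln (t j i)) ^ k \<le> (- ln (u i)) ^ k"
          using ln_le_minus_4[OF pos(2) t4[OF j(2)]] by (intro power_mono) auto
        then have "sqrt (u i) * (- ln (t j i)) ^ k \<le> rho k (u i)"
          unfolding rho_def using pos by (intro mult_left_mono) (auto simp: u[OF j])
        moreover have "sqrt (u i) = cmod (a j) * sqrt (t j i)"
          by (simp add: u[OF j] real_sqrt_mult)
        ultimately show ?thesis by (simp add: rho_def mult_ac)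
      qed
      finally show "cmod (f (X (\<lambda>j. of_real d * a j) n) i) \<le> rho k (u i)" .
    qed (use XV in auto)
    then have "N (s (of_real d) (X a n)) \<le> K" by (simp add: Xs)
    then show ?thesis using d by (simp add: scale[OF XV] field_simps)
  qed
  have up: "N (X a n) \<le> K / d * e a n" for a n
  proof (cases "e a n = 0")
    case True
    then have "\<forall>j<n. a j = 0" by (simp add: e_def sum_nonneg_eq_0_iff)
    then have "X a n = 0" by (simp add: X_def)
    then show ?thesis using True seminorm_zero[OF N] by simp
  next
    case False
    then have pos: "e a n > 0" using e0[of a n] by simp
    have "N (s (of_real (1 / e a n)) (X a n)) \<le> K / d"
      unfolding Xs by (rule up1) (use pos in \<open>simp only: es, simp\<close>)
    then show ?thesis using pos by (simp add: scale[OF XV] norm_divide field_simps)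
  qed
  \<comment> \<open>2 bounds the sum of the (1/4)^j from the small coefficients;
    \<open>exp gap\<close> is \<open>exp (gap + 4)\<close> times the total mass
    \<open>exp (-4)\<close>.\<close>
  define B where "B = 2 + exp gap"
  have low1: "(e a n)\<^sup>2 \<le> B" if a: "N (X a n) \<le> d" for a n
  proof -
    obtain t where t: "\<And>i. 0 \<le> t i" "(\<Sum>i\<in>{m 0..<m n}. t i) \<le> exp (-4)"
      "\<And>i. i \<in> {m 0..<m n} \<Longrightarrow> cmod (f (X a n) i) \<le> rho k (t i)"
      using lower[OF XV a, of "{m 0..<m n}"] by blast
    have "(cmod (a j))\<^sup>2 \<le> (1/4) ^ j + exp (gap + 4) * (\<Sum>i\<in>{m j..<m (Suc j)}. t i)" if j: "j < n" for j
    proof (cases "cmod (a j) > (1/2) ^ j")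
      case True
      have sb: "{m j..<m (Suc j)} \<subseteq> {m 0..<m n}"
      proof -
        have "m 0 \<le> m j" "m (Suc j) \<le> m n" using m(1) j by (auto simp: strict_mono_less_eq)
        then show ?thesis by auto
      qed
      have "(cmod (a j))\<^sup>2 \<le> exp (gap + 4) * (\<Sum>i\<in>{m j..<m (Suc j)}. t i)"
      proof (rule mass_lower_bound[OF m(2,3) _ _ _ _ _ _ True])
        fix i assume i: "i \<in> {m j..<m (Suc j)}"
        have "t i \<le> (\<Sum>i\<in>{m 0..<m n}. t i)" using i sb t(1) by (intro member_le_sum) auto
        then show "t i \<le> exp (-4)" using t(2) by linarith
        show "cmod (a j) * cmod (f (v j) i) \<le> rho k (t i)"
          using t(3)[of i] i sb fX[OF j i] by (auto simp: norm_mult)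
      qed (use v(2) t(1) in auto)
      then show ?thesis by (rule order_trans) simp
    next
      case False
      then have "(cmod (a j))\<^sup>2 \<le> ((1/2) ^ j)\<^sup>2" by (intro power_mono) auto
      also have "\<dots> = (1/4) ^ j" by (simp add: power2_eq_square flip: power_mult_distrib)
      finally show ?thesis
        using t(1) by (intro add_increasing2 mult_nonneg_nonneg sum_nonneg) auto
    qed
    then have "(\<Sum>j<n. (cmod (a j))\<^sup>2) \<le> (\<Sum>j<n. (1/4) ^ j + exp (gap + 4) * (\<Sum>i\<in>{m j..<m (Suc j)}. t i))"
      by (intro sum_mono) auto
    also have "\<dots> = (\<Sum>j<n. (1/4) ^ j) + exp (gap + 4) * (\<Sum>i\<in>{m 0..<m n}. t i)"
      by (simp add: sum.distrib sum_blocks[OF m(1)] sum_distrib_left)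
    also have "\<dots> \<le> 2 + exp (gap + 4) * exp (-4)"
    proof (intro add_mono mult_left_mono t(2))
      show "(\<Sum>j<n. (1/4::real) ^ j) \<le> 2" by (subst geometric_sum) (auto simp: field_simps)
    qed simp
    also have "\<dots> = B" by (simp add: B_def flip: exp_add)
    finally show ?thesis by (simp add: e_def sum_nonneg)
  qed
  have B: "B > 0" by (simp add: B_def add_pos_pos)
  have low: "e a n \<le> sqrt B / d * N (X a n)" for a n
  proof (cases "N (X a n) = 0")
    case True
    have "c * e a n \<le> sqrt B" if "c \<ge> 0" for c
    proof -
      have "(e (\<lambda>j. of_real c * a j) n)\<^sup>2 \<le> B"
        by (rule low1) (use True d in \<open>simp add: Xs[symmetric] scale[OF XV]\<close>)
      then have "e (\<lambda>j. of_real c * a j) n \<le> sqrt B" by (rule real_le_rsqrt)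
      then show ?thesis using that by (simp add: es)
    qed
    from this[of "(sqrt B + 1) / e a n"] have "e a n = 0"
      using e0[of a n] B by (cases "e a n = 0") auto
    then show ?thesis using True by simp
  next
    case False
    then have pos: "N (X a n) > 0" using nonneg[OF XV[of a n]] by simp
    have "N (s (of_real (d / N (X a n))) (X a n)) \<le> d"
      using pos d by (simp add: scale[OF XV] norm_divide)
    then have "(e (\<lambda>j. of_real (d / N (X a n)) * a j) n)\<^sup>2 \<le> B"
      unfolding Xs by (rule low1)
    then have "e (\<lambda>j. of_real (d / N (X a n)) * a j) n \<le> sqrt B" by (rule real_le_rsqrt)
    then have "d / N (X a n) * e a n \<le> sqrt B" unfolding es using pos d by simp
    then show ?thesis using pos d by (simp add: field_simps)
  qed
  have "l2_bounds (d / sqrt B) (K / d) N v"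
    unfolding l2_bounds_def
  proof (intro allI conjI)
    fix a :: "nat \<Rightarrow> complex" and n
    show "N (\<Sum>j<n. s (a j) (v j)) \<le> K / d * sqrt (\<Sum>j<n. (cmod (a j))\<^sup>2)"
      using up[of a n] by (simp add: X_def e_def)
    show "d / sqrt B * sqrt (\<Sum>j<n. (cmod (a j))\<^sup>2) \<le> N (\<Sum>j<n. s (a j) (v j))"
      using low[of a n] B d by (simp add: X_def e_def field_simps)
  qed
  moreover have "d / sqrt B > 0" using B d by simp
  ultimately show "\<exists>v. sub_blocks y v \<and> l2_basis N v"
    using v(1) unfolding l2_basis_def by blast
qed

end

section \<open>Functions with values in the sequence space\<close>

lemma norm_apply_le: "cmod (apply_bcontfun x n) \<le> norm (x :: linf)"
  by (rule norm_bounded)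

lemma apply_sum: "apply_bcontfun (\<Sum>i\<in>I. x i :: linf) n = (\<Sum>i\<in>I. apply_bcontfun (x i) n)"
  by (induction I rule: infinite_finite_induct) auto

lemma bounded_linear_apply: "bounded_linear (\<lambda>x :: linf. apply_bcontfun x n)"
  by (rule bounded_linear_intro[where K = 1]) (auto simp: norm_apply_le)

lemma apply_Bcontfun:
  assumes "\<And>n. cmod (g n) \<le> B"
  shows "apply_bcontfun (Bcontfun g :: linf) n = g n"
  using bcontfun_normI[of g B] assms by (simp add: Bcontfun_inverse)

definition rst :: "nat set \<Rightarrow> linf \<Rightarrow> linf" where
  "rst S x = Bcontfun (\<lambda>n. if n \<in> S then apply_bcontfun x n else 0)"

lemma apply_rst [simp]: "apply_bcontfun (rst S x) n = (if n \<in> S then apply_bcontfun x n else 0)"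
  unfolding rst_def by (rule apply_Bcontfun[where B = "norm x"]) (simp add: norm_apply_le)

lemma norm_rst_le: "norm (rst S x) \<le> norm x"
  by (rule norm_bound) (simp add: norm_apply_le)

lemma rst_diff: "rst S (x - y) = rst S x - rst S y"
  by (rule bcontfun_eqI) simp

lemma l1I:
  assumes "\<And>m. (\<Sum>n<m. cmod (apply_bcontfun x n)) \<le> B"
  shows "x \<in> l1" "l1_norm x \<le> B"
proof -
  have "summable (\<lambda>n. cmod (apply_bcontfun x n))"
    by (rule bounded_imp_summable[where B = B])
      (use assms[of "Suc _"] in \<open>auto simp: lessThan_Suc_atMost\<close>)
  then show "x \<in> l1" "l1_norm x \<le> B"
    using suminf_le_const[of "\<lambda>n. cmod (apply_bcontfun x n)" B] assms
    by (auto simp: l1_def l1_norm_def)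
qed

lemma sum_le_l1_norm: "x \<in> l1 \<Longrightarrow> finite S \<Longrightarrow> (\<Sum>n\<in>S. cmod (apply_bcontfun x n)) \<le> l1_norm x"
  unfolding l1_def l1_norm_def by (rule sum_le_suminf) auto

text \<open>The common features of \<ell>_\<infinity> and \<ell>_1 on the two edges, so that each
  closure property of \<open>continuous_vanishing\<close> is proved once.\<close>

definition edge_norm :: "linf set \<Rightarrow> (linf \<Rightarrow> real) \<Rightarrow> bool" where
  "edge_norm X N \<longleftrightarrow>
     (\<forall>x\<in>X. \<forall>y\<in>X. x + y \<in> X \<and> N (x + y) \<le> N x + N y) \<and>
     (\<forall>c. \<forall>x\<in>X. scale_linf c x \<in> X \<and> N (scale_linf c x) = cmod c * N x) \<and>
     (\<forall>S. \<forall>x\<in>X. rst S x \<in> X \<and> N (rst S x) \<le> N x) \<and> (\<forall>x\<in>X. norm x \<le> N x) \<and> 0 \<in> X"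

lemma edge_norm_linf: "edge_norm UNIV norm"
  by (auto simp: edge_norm_def norm_triangle_ineq norm_scale_linf norm_rst_le)

lemma edge_norm_l1: "edge_norm l1 l1_norm"
proof -
  have "x + y \<in> l1 \<and> l1_norm (x + y) \<le> l1_norm x + l1_norm y" if "x \<in> l1" "y \<in> l1" for x y
  proof -
    have "(\<Sum>n<m. cmod (apply_bcontfun (x + y) n)) \<le> l1_norm x + l1_norm y" for m
    proof -
      have "(\<Sum>n<m. cmod (apply_bcontfun (x + y) n))
        \<le> (\<Sum>n<m. cmod (apply_bcontfun x n)) + (\<Sum>n<m. cmod (apply_bcontfun y n))"
        unfolding sum.distrib[symmetric] by (intro sum_mono) (simp add: norm_triangle_ineq)
      then show ?thesis
        using sum_le_l1_norm[OF that(1), of "{..<m}"] sum_le_l1_norm[OF that(2), of "{..<m}"] by simp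
    qed
    then show ?thesis using l1I by blast
  qed
  moreover have "scale_linf c x \<in> l1 \<and> l1_norm (scale_linf c x) = cmod c * l1_norm x" if "x \<in> l1" for c x
    using that by (auto simp: l1_def l1_norm_def norm_mult summable_mult suminf_mult)
  moreover have "rst S x \<in> l1 \<and> l1_norm (rst S x) \<le> l1_norm x" if "x \<in> l1" for S x
  proof -
    have "(\<Sum>n<m. cmod (apply_bcontfun (rst S x) n)) \<le> l1_norm x" for m
    proof -
      have "(\<Sum>n<m. cmod (apply_bcontfun (rst S x) n)) \<le> (\<Sum>n<m. cmod (apply_bcontfun x n))"
        by (intro sum_mono) auto
      then show ?thesis using sum_le_l1_norm[OF that, of "{..<m}"] by simp
    qed
    then show ?thesis using l1I by blast
  qed
  moreover have "0 \<in> l1" by (simp add: l1_def)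
  ultimately show ?thesis
    by (auto simp: edge_norm_def norm_le_l1_norm)
qed

context
  fixes X N
  assumes XN: "edge_norm X N"
begin

lemma edge_add: "x \<in> X \<Longrightarrow> y \<in> X \<Longrightarrow> x + y \<in> X" "x \<in> X \<Longrightarrow> y \<in> X \<Longrightarrow> N (x + y) \<le> N x + N y"
  using XN by (auto simp: edge_norm_def)

lemma edge_scale: "x \<in> X \<Longrightarrow> scale_linf c x \<in> X" "x \<in> X \<Longrightarrow> N (scale_linf c x) = cmod c * N x"
  using XN by (auto simp: edge_norm_def)

lemma edge_rst: "x \<in> X \<Longrightarrow> rst S x \<in> X" "x \<in> X \<Longrightarrow> N (rst S x) \<le> N x"
  using XN by (auto simp: edge_norm_def)

lemma edge_zero: "0 \<in> X" "N 0 = 0"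
proof -
  show z: "0 \<in> X" using XN by (auto simp: edge_norm_def)
  have "scale_linf 0 0 = 0" by (rule bcontfun_eqI) simp
  then show "N 0 = 0" using edge_scale(2)[OF z, of 0] by simp
qed

lemma edge_nonneg: "x \<in> X \<Longrightarrow> 0 \<le> N x"
  using XN norm_ge_zero[of x] unfolding edge_norm_def by (meson order_trans)

lemma edge_minus: "x \<in> X \<Longrightarrow> - x \<in> X" "x \<in> X \<Longrightarrow> N (- x) = N x"
proof -
  assume x: "x \<in> X"
  have "scale_linf (-1) x = - x" by (rule bcontfun_eqI) simp
  then show "- x \<in> X" "N (- x) = N x" using edge_scale[OF x, of "-1"] by auto
qed

lemma edge_diff: "x \<in> X \<Longrightarrow> y \<in> X \<Longrightarrow> x - y \<in> X" "x \<in> X \<Longrightarrow> y \<in> X \<Longrightarrow> N (x - y) \<le> N x + N y"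
  using edge_add[of x "- y"] edge_minus[of y] by auto

lemma cv_in: "continuous_vanishing X N f \<Longrightarrow> f t \<in> X"
  by (auto simp: continuous_vanishing_def)

lemma null_comparison:
  assumes "(g \<longlongrightarrow> 0) F" "\<And>s. h s \<le> g s" "\<And>s. 0 \<le> h s"
  shows "((h :: real \<Rightarrow> real) \<longlongrightarrow> 0) F"
  by (rule Lim_null_comparison[OF _ assms(1)]) (use assms in auto)

lemma cv_add:
  assumes f: "continuous_vanishing X N f" and g: "continuous_vanishing X N g"
  shows "continuous_vanishing X N (\<lambda>t. f t + g t)"
  unfolding continuous_vanishing_def
proof (intro conjI allI)
  note i = cv_in[OF f] cv_in[OF g]
  show "range (\<lambda>t. f t + g t) \<subseteq> X" using i edge_add by auto
  show "((\<lambda>s. N (f s + g s - (f t + g t))) \<longlongrightarrow> 0) (at t)" for t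
  proof (rule null_comparison)
    show "((\<lambda>s. N (f s - f t) + N (g s - g t)) \<longlongrightarrow> 0) (at t)"
      using f g by (auto simp: continuous_vanishing_def intro: tendsto_add_zero)
    show "N (f s + g s - (f t + g t)) \<le> N (f s - f t) + N (g s - g t)" for s
      using edge_add(2)[of "f s - f t" "g s - g t"] i edge_diff(1) by (simp add: algebra_simps)
    show "0 \<le> N (f s + g s - (f t + g t))" for s
      by (intro edge_nonneg edge_diff(1) edge_add(1) i)
  qed
  show "((\<lambda>t. N (f t + g t)) \<longlongrightarrow> 0) at_infinity"
  proof (rule null_comparison)
    show "((\<lambda>s. N (f s) + N (g s)) \<longlongrightarrow> 0) at_infinity"
      using f g by (auto simp: continuous_vanishing_def intro: tendsto_add_zero)
  qed (use i edge_add edge_nonneg in auto)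
qed

lemma cv_rst:
  assumes f: "continuous_vanishing X N f"
  shows "continuous_vanishing X N (\<lambda>t. rst S (f t))"
  unfolding continuous_vanishing_def
proof (intro conjI allI)
  note i = cv_in[OF f]
  show "range (\<lambda>t. rst S (f t)) \<subseteq> X" using i edge_rst by auto
  show "((\<lambda>s. N (rst S (f s) - rst S (f t))) \<longlongrightarrow> 0) (at t)" for t
  proof (rule null_comparison)
    show "((\<lambda>s. N (f s - f t)) \<longlongrightarrow> 0) (at t)"
      using f by (auto simp: continuous_vanishing_def)
  qed (use i edge_diff edge_rst edge_nonneg in \<open>auto simp flip: rst_diff\<close>)
  show "((\<lambda>t. N (rst S (f t))) \<longlongrightarrow> 0) at_infinity"
  proof (rule null_comparison)
    show "((\<lambda>s. N (f s)) \<longlongrightarrow> 0) at_infinity"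
      using f by (auto simp: continuous_vanishing_def)
  qed (use i edge_rst edge_nonneg in auto)
qed

lemma cv_mult:
  assumes f: "continuous_vanishing X N f" and g: "continuous_on UNIV g" and M: "\<And>t. cmod (g t) \<le> M"
  shows "continuous_vanishing X N (\<lambda>t. scale_linf (g t) (f t))"
  unfolding continuous_vanishing_def
proof (intro conjI allI)
  note i = cv_in[OF f]
  show "range (\<lambda>t. scale_linf (g t) (f t)) \<subseteq> X" using i edge_scale by auto
  show "((\<lambda>s. N (scale_linf (g s) (f s) - scale_linf (g t) (f t))) \<longlongrightarrow> 0) (at t)" for t
  proof (rule null_comparison)
    have "isCont g t" using g by (simp add: continuous_on_eq_continuous_at)
    then have "((\<lambda>s. cmod (g s - g t) * N (f t)) \<longlongrightarrow> cmod (g t - g t) * N (f t)) (at t)"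
      unfolding isCont_def by (intro tendsto_intros)
    then have "((\<lambda>s. M * N (f s - f t) + cmod (g s - g t) * N (f t)) \<longlongrightarrow> M * 0 + 0) (at t)"
      using f by (intro tendsto_add tendsto_mult_left) (auto simp: continuous_vanishing_def)
    then show "((\<lambda>s. M * N (f s - f t) + cmod (g s - g t) * N (f t)) \<longlongrightarrow> 0) (at t)" by simp
    show "N (scale_linf (g s) (f s) - scale_linf (g t) (f t)) \<le> M * N (f s - f t) + cmod (g s - g t) * N (f t)" for s
    proof -
      have fX: "f s - f t \<in> X" using i edge_diff by auto
      have "scale_linf (g s) (f s) - scale_linf (g t) (f t)
        = scale_linf (g s) (f s - f t) + scale_linf (g s - g t) (f t)"
        by (rule bcontfun_eqI) (simp add: algebra_simps)
      then have "N (scale_linf (g s) (f s) - scale_linf (g t) (f t))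
        \<le> cmod (g s) * N (f s - f t) + cmod (g s - g t) * N (f t)"
        using edge_add(2)[OF edge_scale(1)[OF fX] edge_scale(1)[OF i], of "g s" "g s - g t" t]
        by (simp add: edge_scale(2)[OF fX] edge_scale(2)[OF i])
      moreover have "cmod (g s) * N (f s - f t) \<le> M * N (f s - f t)"
        using M edge_nonneg[OF fX] by (intro mult_right_mono)
      ultimately show ?thesis by linarith
    qed
    show "0 \<le> N (scale_linf (g s) (f s) - scale_linf (g t) (f t))" for s
      by (intro edge_nonneg edge_diff(1) edge_scale(1) i)
  qed
  show "((\<lambda>t. N (scale_linf (g t) (f t))) \<longlongrightarrow> 0) at_infinity"
  proof (rule null_comparison)
    have "((\<lambda>s. M * N (f s)) \<longlongrightarrow> M * 0) at_infinity"
      using f by (intro tendsto_mult_left) (auto simp: continuous_vanishing_def)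
    then show "((\<lambda>s. M * N (f s)) \<longlongrightarrow> 0) at_infinity" by simp
    show "N (scale_linf (g s) (f s)) \<le> M * N (f s)" for s
      unfolding edge_scale(2)[OF i] using M edge_nonneg[OF i] by (intro mult_right_mono)
  qed (use i edge_scale(1) edge_nonneg in auto)
qed

text \<open>Uniform limits in the sense of \<open>N\<close>, phrased by approximation because
  \<open>N\<close> is a function on a subset and not the norm of a type.\<close>

lemma cv_limit:
  assumes "\<And>e. e > 0 \<Longrightarrow> \<exists>g. continuous_vanishing X N g \<and> (\<forall>t. f t - g t \<in> X \<and> N (f t - g t) \<le> e)"
  shows "continuous_vanishing X N f"
proof -
  have i: "f t \<in> X" for t
  proof -
    obtain g where "continuous_vanishing X N g" "f t - g t \<in> X" using assms[of 1] by auto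
    then show ?thesis using edge_add(1)[of "f t - g t" "g t"] cv_in[of g t] by simp
  qed
  have "\<forall>\<^sub>F s in at t. N (f s - f t) < e" if e: "e > 0" for t e
  proof -
    obtain g where g: "continuous_vanishing X N g" "\<And>t. f t - g t \<in> X" "\<And>t. N (f t - g t) \<le> e / 4"
      using assms[of "e / 4"] e by auto
    have "((\<lambda>s. N (g s - g t)) \<longlongrightarrow> 0) (at t)" using g(1) by (simp add: continuous_vanishing_def)
    then have "\<forall>\<^sub>F s in at t. N (g s - g t) < e / 4" using e by (intro order_tendstoD(2)) auto
    then show ?thesis
    proof eventually_elim
      case (elim s)
      have gX: "g s - g t \<in> X" using cv_in[OF g(1)] edge_diff by auto
      have "f s - f t = (f s - g s) + ((g s - g t) - (f t - g t))" by simp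
      then have "N (f s - f t) \<le> N (f s - g s) + (N (g s - g t) + N (f t - g t))"
        using edge_add(2)[OF g(2)[of s] edge_diff(1)[OF gX g(2)[of t]]] edge_diff(2)[OF gX g(2)[of t]]
        by simp
      then show ?case using g(3)[of s] g(3)[of t] elim e by linarith
    qed
  qed
  moreover have "\<forall>\<^sub>F t in at_infinity. N (f t) < e" if e: "e > 0" for e
  proof -
    obtain g where g: "continuous_vanishing X N g" "\<And>t. f t - g t \<in> X" "\<And>t. N (f t - g t) \<le> e / 4"
      using assms[of "e / 4"] e by auto
    have "((\<lambda>s. N (g s)) \<longlongrightarrow> 0) at_infinity" using g(1) by (simp add: continuous_vanishing_def)
    then have "\<forall>\<^sub>F s in at_infinity. N (g s) < e / 4" using e by (intro order_tendstoD(2)) auto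
    then show ?thesis
    proof eventually_elim
      case (elim s)
      have "N (f s) \<le> N (f s - g s) + N (g s)"
        using edge_add(2)[OF g(2)[of s] cv_in[OF g(1), of s]] by simp
      then show ?case using g(3)[of s] elim e by linarith
    qed
  qed
  moreover have "0 \<le> N (f s - f t)" "0 \<le> N (f s)" for s t
    using i edge_nonneg edge_diff(1) by auto
  ultimately show ?thesis
    unfolding continuous_vanishing_def using i by (auto simp: tendsto_iff)
qed

text \<open>Continuity on a compact interval and smallness outside it. The suprema in
  \<open>calderon_norm\<close> are upper bounds because of this.\<close>

lemma cv_bounded:
  assumes f: "continuous_vanishing X N f"
  shows "bdd_above (range (\<lambda>t. N (f t)))"
proof -
  note i = cv_in[OF f]
  have "isCont (\<lambda>t. N (f t)) t" for t
    unfolding isCont_def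
  proof (rule Lim_transform)
    show "((\<lambda>s. N (f t)) \<longlongrightarrow> N (f t)) (at t)" by simp
    have "((\<lambda>s. N (f s - f t)) \<longlongrightarrow> 0) (at t)" using f by (simp add: continuous_vanishing_def)
    then show "((\<lambda>s. N (f s) - N (f t)) \<longlongrightarrow> 0) (at t)"
    proof (rule Lim_null_comparison[rotated], intro always_eventually allI)
      fix s
      have "N (f s) \<le> N (f s - f t) + N (f t)" using edge_add(2)[of "f s - f t" "f t"] i edge_diff(1) by simp
      moreover have "N (f t) \<le> N (f s) + N (f s - f t)"
        using edge_diff(2)[of "f s" "f s - f t"] i edge_diff(1) by simp
      ultimately show "norm (N (f s) - N (f t)) \<le> N (f s - f t)" by (simp add: abs_le_iff)
    qed
  qed
  then have cont: "continuous_on A (\<lambda>t. N (f t))" for A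
    using continuous_at_imp_continuous_on by blast
  have "((\<lambda>s. N (f s)) \<longlongrightarrow> 0) at_infinity" using f by (simp add: continuous_vanishing_def)
  then have "\<forall>\<^sub>F s in at_infinity. N (f s) < 1" by (intro order_tendstoD(2)) auto
  then obtain b where b: "\<And>t. b \<le> \<bar>t\<bar> \<Longrightarrow> N (f t) < 1" by (auto simp: eventually_at_infinity)
  have "compact ((\<lambda>t. N (f t)) ` {-b..b})" by (intro compact_continuous_image cont compact_Icc)
  then have "bdd_above ((\<lambda>t. N (f t)) ` {-b..b})"
    by (intro bounded_imp_bdd_above compact_imp_bounded)
  then obtain C where C: "\<And>t. t \<in> {-b..b} \<Longrightarrow> N (f t) \<le> C"
    unfolding bdd_above_def by blast
  have "N (f t) \<le> max 1 C" for t
  proof (cases "b \<le> \<bar>t\<bar>")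
    case False
    then have "t \<in> {-b..b}" by auto
    then show ?thesis using C by (simp add: le_max_iff_disj)
  qed (use b[of t] in \<open>simp add: le_max_iff_disj\<close>)
  then show ?thesis by (intro bdd_aboveI2)
qed

end

section \<open>Coordinatewise holomorphy and complex differentiability\<close>

lemma has_cderiv_apply:
  assumes "has_cderiv F D z"
  shows "((\<lambda>z. apply_bcontfun (F z) n) has_field_derivative apply_bcontfun D n) (at z)"
proof -
  have "((\<lambda>z. apply_bcontfun (F z) n) has_derivative (\<lambda>h. apply_bcontfun (scale_linf h D) n)) (at z)"
    by (rule bounded_linear.has_derivative[OF bounded_linear_apply assms[unfolded has_cderiv_def]])
  then show ?thesis
    unfolding has_field_derivative_def by (rule has_derivative_eq_rhs) (auto simp: mult.commute)
qed

text \<open>The weak form of analyticity: coordinates are holomorphic and norms are locally bounded.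
  It is easier to verify for limits, products and restrictions than
  \<open>has_cderiv\<close>.\<close>

definition coord_hol :: "(complex \<Rightarrow> linf) \<Rightarrow> bool" where
  "coord_hol F \<longleftrightarrow> (\<forall>n. (\<lambda>z. apply_bcontfun (F z) n) holomorphic_on open_strip) \<and>
     (\<forall>z\<in>open_strip. \<exists>r>0. \<exists>M. cball z r \<subseteq> open_strip \<and> (\<forall>w\<in>cball z r. norm (F w) \<le> M))"

lemma cauchy_bound:
  assumes "f holomorphic_on open_strip" "cball z r \<subseteq> open_strip" "r > 0"
    "\<And>w. w \<in> cball z r \<Longrightarrow> cmod (f w) \<le> M"
  shows "cmod ((deriv ^^ k) f z) \<le> fact k * M / r ^ k"
proof (rule Cauchy_inequality)
  show "f holomorphic_on ball z r"
    using assms ball_subset_cball by (intro holomorphic_on_subset[OF assms(1)]) blast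
  show "continuous_on (cball z r) f"
    by (intro holomorphic_on_imp_continuous_on holomorphic_on_subset[OF assms(1)] assms)
  show "cmod (f x) \<le> M" if "cmod (z - x) = r" for x
    using that by (intro assms(4)) (simp add: dist_norm)
qed (rule assms)

text \<open>Cauchy's estimates depend only on the local bound of the norm, so one constant bounds
  the second derivatives of all coordinates. Taylor's formula then has an error of order |w - z|^2
  uniformly in the coordinates, which is differentiability in the sup norm.\<close>

lemma coord_hol_has_cderiv:
  assumes F: "coord_hol F" and z: "z \<in> open_strip"
  shows "\<exists>D. has_cderiv F D z \<and> (\<forall>n. apply_bcontfun D n = deriv (\<lambda>z. apply_bcontfun (F z) n) z)"
proof -
  let ?f = "\<lambda>n z. apply_bcontfun (F z) n"
  have hol: "?f n holomorphic_on open_strip" for n using F by (simp add: coord_hol_def)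
  obtain r M where r: "r > 0" "cball z r \<subseteq> open_strip" and M: "\<And>w. w \<in> cball z r \<Longrightarrow> norm (F w) \<le> M"
    using F z unfolding coord_hol_def by blast
  have fM: "cmod (?f n w) \<le> M" if "w \<in> cball z r" for n w
    using norm_apply_le[of "F w" n] M[OF that] by linarith
  define D :: linf where "D = Bcontfun (\<lambda>n. deriv (?f n) z)"
  have D: "apply_bcontfun D n = deriv (?f n) z" for n
    unfolding D_def
  proof (rule apply_Bcontfun)
    show "cmod (deriv (?f n) z) \<le> M / r" for n
      using cauchy_bound[OF hol[of n] r(2,1) fM, where k = 1] by simp
  qed
  \<comment> \<open>Half the radius, so that discs of radius \<open>e\<close> about points of the
    smaller disc stay where the bound \<open>M\<close> holds.\<close>
  define e where "e = r / 2"
  define C where "C = 2 * M / e\<^sup>2"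
  have e: "e > 0" using r by (simp add: e_def)
  have sub: "cball x e \<subseteq> cball z r" if "x \<in> cball z e" for x
  proof
    fix w assume "w \<in> cball x e"
    then show "w \<in> cball z r" using that dist_triangle[of z w x] by (auto simp: e_def)
  qed
  have second: "cmod ((deriv ^^ 2) (?f n) x) \<le> C" if "x \<in> cball z e" for n x
    using cauchy_bound[OF hol[of n], of x e M 2] sub[OF that] r e fM unfolding C_def
    by (auto simp: subset_iff)
  have taylor: "cmod (?f n w - (?f n z + deriv (?f n) z * (w - z))) \<le> C * (cmod (w - z))\<^sup>2"
    if w: "w \<in> cball z e" for n w
  proof -
    have "cmod ((deriv ^^ 0) (?f n) w - (\<Sum>i\<le>1. (deriv ^^ i) (?f n) z * (w - z) ^ i / fact i))
      \<le> C * cmod (w - z) ^ Suc 1 / fact 1"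
    proof (rule complex_Taylor[of "cball z e"])
      fix i x assume x: "x \<in> cball z e"
      then have xs: "x \<in> open_strip" using r e by (auto simp: e_def subset_iff)
      have "(deriv ^^ i) (?f n) holomorphic_on open_strip"
        by (rule holomorphic_higher_deriv[OF hol open_open_strip])
      from holomorphic_derivI[OF this open_open_strip xs, of "cball z e"]
      show "((deriv ^^ i) (?f n) has_field_derivative (deriv ^^ Suc i) (?f n) x) (at x within cball z e)"
        by simp
    next
      show "cmod ((deriv ^^ Suc 1) (?f n) x) \<le> C" if "x \<in> cball z e" for x
        using second[OF that, of n] by (simp add: numeral_2_eq_2)
    qed (use w e in auto)
    then show ?thesis by (simp add: power2_eq_square)
  qed
  have "has_cderiv F D z"
    unfolding has_cderiv_def
  proof (rule has_derivativeI_sandwich[OF e])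
    show "bounded_linear (\<lambda>h. scale_linf h D)"
      by (rule bounded_linear_intro[where K = "norm D"])
        (auto simp: norm_scale_linf algebra_simps intro!: bcontfun_eqI)
    have "((\<lambda>w. C * cmod (w - z)) \<longlongrightarrow> C * cmod (z - z)) (at z)" by (intro tendsto_intros)
    then show "((\<lambda>w. C * cmod (w - z)) \<longlongrightarrow> 0) (at z)" by simp
    fix w assume w: "w \<noteq> z" "dist w z < e"
    have "norm (F w - F z - scale_linf (w - z) D) \<le> C * (cmod (w - z))\<^sup>2"
    proof (rule norm_bound)
      fix n
      show "cmod (apply_bcontfun (F w - F z - scale_linf (w - z) D) n) \<le> C * (cmod (w - z))\<^sup>2"
        using taylor[of w n] w by (simp add: D dist_commute algebra_simps)
    qed
    then have "norm (F w - F z - scale_linf (w - z) D) / cmod (w - z) \<le> C * (cmod (w - z))\<^sup>2 / cmod (w - z)"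
      by (rule divide_right_mono) simp
    then show "norm (F w - F z - scale_linf (w - z) D) / norm (w - z) \<le> C * cmod (w - z)"
      using w by (simp add: power2_eq_square)
  qed
  then show ?thesis using D by blast
qed

text \<open>The coordinates of any complex derivative are ordinary derivatives, so the choice made
  in \<open>cderiv\<close> cannot matter.\<close>

lemma cderiv_coord:
  assumes "coord_hol F" "z \<in> open_strip"
  shows "has_cderiv F (cderiv F z) z"
    "apply_bcontfun (cderiv F z) n = deriv (\<lambda>z. apply_bcontfun (F z) n) z"
proof -
  show h: "has_cderiv F (cderiv F z) z"
    unfolding cderiv_def using coord_hol_has_cderiv[OF assms] by (metis someI)
  show "apply_bcontfun (cderiv F z) n = deriv (\<lambda>z. apply_bcontfun (F z) n) z"
    using DERIV_imp_deriv[OF has_cderiv_apply[OF h]] by simp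
qed

lemma coord_hol_cderiv:
  assumes F: "coord_hol F"
  shows "coord_hol (cderiv F)"
  unfolding coord_hol_def
proof (intro conjI allI ballI)
  have hol: "(\<lambda>z. apply_bcontfun (F z) n) holomorphic_on open_strip" for n
    using F by (simp add: coord_hol_def)
  show "(\<lambda>z. apply_bcontfun (cderiv F z) n) holomorphic_on open_strip" for n
    by (rule holomorphic_transform[OF holomorphic_deriv[OF hol[of n] open_open_strip]])
      (simp add: cderiv_coord[OF F])
  fix z assume z: "z \<in> open_strip"
  obtain r M where r: "r > 0" "cball z r \<subseteq> open_strip" and M: "\<And>w. w \<in> cball z r \<Longrightarrow> norm (F w) \<le> M"
    using F z unfolding coord_hol_def by blast
  define e where "e = r / 2"
  have e: "e > 0" using r by (simp add: e_def)
  have sub: "cball x e \<subseteq> cball z r" if "x \<in> cball z e" for x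
  proof
    fix w assume "w \<in> cball x e"
    then show "w \<in> cball z r" using that dist_triangle[of z w x] by (auto simp: e_def)
  qed
  have "norm (cderiv F w) \<le> M / e" if w: "w \<in> cball z e" for w
  proof (rule norm_bound)
    fix n
    have ws: "w \<in> open_strip" using w r e by (auto simp: e_def subset_iff)
    have "cmod ((deriv ^^ 1) (\<lambda>z. apply_bcontfun (F z) n) w) \<le> fact 1 * M / e ^ 1"
    proof (rule cauchy_bound[OF hol _ e])
      show "cball w e \<subseteq> open_strip" using sub[OF w] r by auto
      show "cmod (apply_bcontfun (F u) n) \<le> M" if "u \<in> cball w e" for u
        using norm_apply_le[of "F u" n] M[of u] sub[OF w] that by fastforce
    qed
    then show "cmod (apply_bcontfun (cderiv F w) n) \<le> M / e" by (simp add: cderiv_coord[OF F ws])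
  qed
  moreover have "cball z e \<subseteq> open_strip" using r e by (auto simp: e_def subset_iff)
  ultimately show "\<exists>r>0. \<exists>M. cball z r \<subseteq> open_strip \<and> (\<forall>w\<in>cball z r. norm (cderiv F w) \<le> M)"
    using e by blast
qed

lemma higher_cderiv_coord:
  assumes F: "coord_hol F"
  shows "coord_hol ((cderiv ^^ k) F) \<and> (\<forall>z\<in>open_strip. \<forall>n.
    apply_bcontfun ((cderiv ^^ k) F z) n = (deriv ^^ k) (\<lambda>z. apply_bcontfun (F z) n) z)"
proof (induction k)
  case (Suc k)
  have "apply_bcontfun ((cderiv ^^ Suc k) F z) n = (deriv ^^ Suc k) (\<lambda>z. apply_bcontfun (F z) n) z"
    if z: "z \<in> open_strip" for z n
  proof -
    have "apply_bcontfun ((cderiv ^^ Suc k) F z) n = deriv (\<lambda>z. apply_bcontfun ((cderiv ^^ k) F z) n) z"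
      using cderiv_coord(2)[of "(cderiv ^^ k) F" z n] Suc z by simp
    also have "\<dots> = deriv ((deriv ^^ k) (\<lambda>z. apply_bcontfun (F z) n)) z"
    proof (rule deriv_cong_ev)
      show "\<forall>\<^sub>F x in nhds z. apply_bcontfun ((cderiv ^^ k) F x) n = (deriv ^^ k) (\<lambda>z. apply_bcontfun (F z) n) x"
        using eventually_nhds_in_open[OF open_open_strip z] by eventually_elim (use Suc in auto)
    qed simp
    finally show ?thesis by simp
  qed
  then show ?case using coord_hol_cderiv Suc by auto
qed (use F in auto)

section \<open>The Calderon space\<close>

lemma calderonD:
  assumes "F \<in> calderon"
  shows "z \<notin> strip \<Longrightarrow> F z = 0" "bounded (F ` strip)" "continuous_on strip F"
    "z \<in> open_strip \<Longrightarrow> \<exists>D. has_cderiv F D z"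
    "continuous_vanishing UNIV norm (\<lambda>t. F (Complex 0 t))"
    "continuous_vanishing l1 l1_norm (\<lambda>t. F (Complex 1 t))"
  using assms by (auto simp: calderon_def)

lemma calderon_strip_fun:
  assumes F: "F \<in> calderon"
  shows "strip_fun (\<lambda>z. apply_bcontfun (F z) n)"
proof -
  obtain M where M: "\<And>z. z \<in> strip \<Longrightarrow> norm (F z) \<le> M"
    using calderonD(2)[OF F] by (auto simp: bounded_iff)
  show ?thesis
  proof (rule strip_funI)
    show "continuous_on strip (\<lambda>z. apply_bcontfun (F z) n)"
      by (rule bounded_linear.continuous_on[OF bounded_linear_apply calderonD(3)[OF F]])
    show "(\<lambda>z. apply_bcontfun (F z) n) holomorphic_on open_strip"
      unfolding holomorphic_on_open[OF open_open_strip]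
      using calderonD(4)[OF F] has_cderiv_apply by blast
    show "cmod (apply_bcontfun (F z) n) \<le> M" if "z \<in> strip" for z
      using M[OF that] norm_apply_le[of "F z" n] by linarith
  qed
qed

lemma calderon_coord_hol:
  assumes F: "F \<in> calderon"
  shows "coord_hol F"
proof -
  obtain M where M: "\<And>z. z \<in> strip \<Longrightarrow> norm (F z) \<le> M"
    using calderonD(2)[OF F] by (auto simp: bounded_iff)
  have "\<exists>r>0. \<exists>M. cball z r \<subseteq> open_strip \<and> (\<forall>w\<in>cball z r. norm (F w) \<le> M)" if z: "z \<in> open_strip" for z
  proof -
    obtain r where "r > 0" "cball z r \<subseteq> open_strip"
      using open_contains_cball open_open_strip z by metis
    then show ?thesis using M open_strip_subset by blast
  qed
  then show ?thesis
    using calderon_strip_fun[OF F] by (auto simp: coord_hol_def strip_fun_def)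
qed

lemma calderonI:
  assumes "\<And>z. z \<notin> strip \<Longrightarrow> F z = 0" and M: "\<And>z. z \<in> strip \<Longrightarrow> norm (F z) \<le> M"
    and "continuous_on strip F" and hol: "\<And>n. (\<lambda>z. apply_bcontfun (F z) n) holomorphic_on open_strip"
    and "continuous_vanishing UNIV norm (\<lambda>t. F (Complex 0 t))"
    and "continuous_vanishing l1 l1_norm (\<lambda>t. F (Complex 1 t))"
  shows "F \<in> calderon"
proof -
  have "\<exists>r>0. \<exists>M. cball z r \<subseteq> open_strip \<and> (\<forall>w\<in>cball z r. norm (F w) \<le> M)" if z: "z \<in> open_strip" for z
  proof -
    obtain r where "r > 0" "cball z r \<subseteq> open_strip"
      using open_contains_cball open_open_strip z by metis
    then show ?thesis using M open_strip_subset by blast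
  qed
  then have "coord_hol F" using hol by (auto simp: coord_hol_def)
  then have "\<exists>D. has_cderiv F D z" if "z \<in> open_strip" for z
    using coord_hol_has_cderiv that by blast
  moreover have "bounded (F ` strip)" using M by (auto simp: bounded_iff)
  ultimately show ?thesis using assms by (auto simp: calderon_def)
qed

lemma calderon_norm_left:
  assumes "F \<in> calderon"
  shows "norm (F (Complex 0 t)) \<le> calderon_norm F"
proof -
  have "norm (F (Complex 0 t)) \<le> (SUP t. norm (F (Complex 0 t)))"
    by (rule cSUP_upper[OF UNIV_I cv_bounded[OF edge_norm_linf calderonD(5)[OF assms]]])
  then show ?thesis by (simp add: calderon_norm_def)
qed

lemma calderon_norm_right:
  assumes "F \<in> calderon"
  shows "l1_norm (F (Complex 1 t)) \<le> calderon_norm F"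
proof -
  have "l1_norm (F (Complex 1 t)) \<le> (SUP t. l1_norm (F (Complex 1 t)))"
    by (rule cSUP_upper[OF UNIV_I cv_bounded[OF edge_norm_l1 calderonD(6)[OF assms]]])
  then show ?thesis by (simp add: calderon_norm_def)
qed

lemma calderon_l1: "F \<in> calderon \<Longrightarrow> F (Complex 1 t) \<in> l1"
  by (rule cv_in[OF edge_norm_l1 calderonD(6)])

lemma calderon_normI:
  assumes "\<And>t. norm (F (Complex 0 t)) \<le> B" "\<And>t. l1_norm (F (Complex 1 t)) \<le> B"
  shows "calderon_norm F \<le> B"
  unfolding calderon_norm_def using assms by (auto intro: cSUP_least)

lemma calderon_norm_nonneg: "F \<in> calderon \<Longrightarrow> 0 \<le> calderon_norm F"
  using calderon_norm_left[of F 0] norm_ge_zero[of "F (Complex 0 0)"] by linarith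

text \<open>The three lines theorem in each coordinate, the \<ell>_1 norm dominating the entries on
  the right edge. Smallness in \<open>calderon_norm\<close> thereby becomes uniform smallness on the
  strip.\<close>

lemma norm_le_calderon_norm:
  assumes F: "F \<in> calderon"
  shows "norm (F z) \<le> calderon_norm F"
proof (cases "z \<in> strip")
  case True
  show ?thesis
  proof (rule norm_bound)
    fix n
    show "cmod (apply_bcontfun (F z) n) \<le> calderon_norm F"
    proof (rule three_lines[where f = "\<lambda>z. apply_bcontfun (F z) n", OF _ _ _ _ _ True])
      show "cmod (apply_bcontfun (F (Complex 0 t)) n) \<le> calderon_norm F" for t
        using norm_apply_le[of "F (Complex 0 t)" n] calderon_norm_left[OF F, of t] by linarith
      show "cmod (apply_bcontfun (F (Complex 1 t)) n) \<le> calderon_norm F" for t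
        using norm_apply_le[of "F (Complex 1 t)" n] calderon_norm_right[OF F, of t]
          norm_le_l1_norm[OF calderon_l1[OF F], of t] by linarith
    qed (use calderon_strip_fun[OF F, of n] in \<open>auto simp: strip_fun_def\<close>)
  qed
next
  case False
  then show ?thesis using calderonD(1)[OF F] calderon_norm_nonneg[OF F] by simp
qed

section \<open>Operations on functions of the Calderon space\<close>

definition scale_fun :: "complex \<Rightarrow> (complex \<Rightarrow> linf) \<Rightarrow> complex \<Rightarrow> linf" where
  "scale_fun c F z = scale_linf c (F z)"

definition rst_fun :: "nat set \<Rightarrow> (complex \<Rightarrow> linf) \<Rightarrow> complex \<Rightarrow> linf" where
  "rst_fun S F z = rst S (F z)"

definition mult_fun :: "(complex \<Rightarrow> complex) \<Rightarrow> (complex \<Rightarrow> linf) \<Rightarrow> complex \<Rightarrow> linf" where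
  "mult_fun g F z = scale_linf (g z) (F z)"

lemma scale_linf_0 [simp]: "scale_linf c 0 = 0" "scale_linf 0 x = 0"
  by (rule bcontfun_eqI, simp)+

lemma rst_0 [simp]: "rst S 0 = 0"
  by (rule bcontfun_eqI) simp

lemma calderon_add:
  assumes F: "F \<in> calderon" and G: "G \<in> calderon"
  shows "F + G \<in> calderon"
proof (rule calderonI)
  show "norm ((F + G) z) \<le> calderon_norm F + calderon_norm G" for z
    using norm_triangle_ineq[of "F z" "G z"] norm_le_calderon_norm[OF F, of z]
      norm_le_calderon_norm[OF G, of z] by simp
  show "continuous_on strip (F + G)"
    unfolding plus_fun_def using calderonD(3)[OF F] calderonD(3)[OF G] by (intro continuous_intros)
  show "(\<lambda>z. apply_bcontfun ((F + G) z) n) holomorphic_on open_strip" for n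
    using calderon_strip_fun[OF F, of n] calderon_strip_fun[OF G, of n]
    by (auto simp: strip_fun_def intro: holomorphic_intros)
  show "continuous_vanishing UNIV norm (\<lambda>t. (F + G) (Complex 0 t))"
    using cv_add[OF edge_norm_linf calderonD(5)[OF F] calderonD(5)[OF G]] by simp
  show "continuous_vanishing l1 l1_norm (\<lambda>t. (F + G) (Complex 1 t))"
    using cv_add[OF edge_norm_l1 calderonD(6)[OF F] calderonD(6)[OF G]] by simp
qed (use calderonD(1)[OF F] calderonD(1)[OF G] in auto)

lemma continuous_on_scale_linf:
  assumes "continuous_on A g" "continuous_on A F"
  shows "continuous_on A (\<lambda>z. scale_linf (g z) (F z))"
proof -
  have "((\<lambda>z. scale_linf (g z) (F z)) \<longlongrightarrow> scale_linf (g x) (F x)) (at x within A)" if x: "x \<in> A" for x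
  proof (rule Lim_null[THEN iffD2], rule Lim_null_comparison)
    have g: "(g \<longlongrightarrow> g x) (at x within A)" and F: "(F \<longlongrightarrow> F x) (at x within A)"
      using assms x by (auto simp: continuous_on_def)
    have "((\<lambda>z. cmod (g z) * norm (F z - F x) + cmod (g z - g x) * norm (F x)) \<longlongrightarrow>
       cmod (g x) * norm (F x - F x) + cmod (g x - g x) * norm (F x)) (at x within A)"
      by (intro tendsto_intros g F)
    then show "((\<lambda>z. cmod (g z) * norm (F z - F x) + cmod (g z - g x) * norm (F x)) \<longlongrightarrow> 0) (at x within A)"
      by simp
    have "norm (scale_linf (g z) (F z) - scale_linf (g x) (F x))
      \<le> cmod (g z) * norm (F z - F x) + cmod (g z - g x) * norm (F x)" for z
    proof -
      have "scale_linf (g z) (F z) - scale_linf (g x) (F x)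
        = scale_linf (g z) (F z - F x) + scale_linf (g z - g x) (F x)"
        by (rule bcontfun_eqI) (simp add: algebra_simps)
      then show ?thesis
        using norm_triangle_ineq[of "scale_linf (g z) (F z - F x)" "scale_linf (g z - g x) (F x)"]
        by (simp add: norm_scale_linf)
    qed
    then show "\<forall>\<^sub>F z in at x within A. norm (scale_linf (g z) (F z) - scale_linf (g x) (F x))
      \<le> cmod (g z) * norm (F z - F x) + cmod (g z - g x) * norm (F x)"
      by (intro always_eventually allI)
  qed
  then show ?thesis by (simp add: continuous_on_def)
qed

lemma continuous_on_edge:
  assumes "continuous_on strip g"
  shows "continuous_on UNIV (\<lambda>t. g (Complex 0 t))" "continuous_on UNIV (\<lambda>t. g (Complex 1 t))"
proof -
  have "continuous_on UNIV (\<lambda>t. Complex c t)" for c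
    unfolding Complex_eq by (intro continuous_intros)
  then show "continuous_on UNIV (\<lambda>t. g (Complex 0 t))" "continuous_on UNIV (\<lambda>t. g (Complex 1 t))"
    by (intro continuous_on_compose2[OF assms]; auto)+
qed

lemma calderon_mult:
  assumes F: "F \<in> calderon" and g: "strip_fun g"
  shows "mult_fun g F \<in> calderon"
proof -
  obtain M where M: "M > 0" "\<And>z. z \<in> strip \<Longrightarrow> cmod (g z) \<le> M"
    using strip_fun_bound[OF g] by blast
  have cg: "continuous_on strip g" using g by (simp add: strip_fun_def)
  show ?thesis
    unfolding mult_fun_def[abs_def]
  proof (rule calderonI)
    show "norm (scale_linf (g z) (F z)) \<le> M * calderon_norm F" if "z \<in> strip" for z
      unfolding norm_scale_linf using M that norm_le_calderon_norm[OF F, of z] by (intro mult_mono) auto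
    show "continuous_on strip (\<lambda>z. scale_linf (g z) (F z))"
      by (rule continuous_on_scale_linf[OF cg calderonD(3)[OF F]])
    show "(\<lambda>z. apply_bcontfun (scale_linf (g z) (F z)) n) holomorphic_on open_strip" for n
      using calderon_strip_fun[OF F, of n] g by (auto simp: strip_fun_def intro: holomorphic_intros)
    show "continuous_vanishing UNIV norm (\<lambda>t. scale_linf (g (Complex 0 t)) (F (Complex 0 t)))"
      by (rule cv_mult[OF edge_norm_linf calderonD(5)[OF F] continuous_on_edge(1)[OF cg]]) (rule M, simp)
    show "continuous_vanishing l1 l1_norm (\<lambda>t. scale_linf (g (Complex 1 t)) (F (Complex 1 t)))"
      by (rule cv_mult[OF edge_norm_l1 calderonD(6)[OF F] continuous_on_edge(2)[OF cg]]) (rule M, simp)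
  qed (use calderonD(1)[OF F] in auto)
qed

lemma calderon_scale: "F \<in> calderon \<Longrightarrow> scale_fun c F \<in> calderon"
  using calderon_mult[OF _ strip_fun_const[of c]] by (simp add: mult_fun_def[abs_def] scale_fun_def[abs_def])

lemma calderon_rst:
  assumes F: "F \<in> calderon"
  shows "rst_fun S F \<in> calderon"
  unfolding rst_fun_def[abs_def]
proof (rule calderonI)
  show "norm (rst S (F z)) \<le> calderon_norm F" for z
    using norm_rst_le[of S "F z"] norm_le_calderon_norm[OF F, of z] by linarith
  have "bounded_linear (rst S)"
    by (rule bounded_linear_intro[where K = 1]) (auto simp: norm_rst_le intro!: bcontfun_eqI)
  then show "continuous_on strip (\<lambda>z. rst S (F z))"
    using calderonD(3)[OF F] by (rule bounded_linear.continuous_on)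
  show "(\<lambda>z. apply_bcontfun (rst S (F z)) n) holomorphic_on open_strip" for n
    using calderon_strip_fun[OF F, of n] by (cases "n \<in> S") (auto simp: strip_fun_def)
  show "continuous_vanishing UNIV norm (\<lambda>t. rst S (F (Complex 0 t)))"
    by (rule cv_rst[OF edge_norm_linf calderonD(5)[OF F]])
  show "continuous_vanishing l1 l1_norm (\<lambda>t. rst S (F (Complex 1 t)))"
    by (rule cv_rst[OF edge_norm_l1 calderonD(6)[OF F]])
qed (use calderonD(1)[OF F] in auto)

lemma calderon_norm_add:
  assumes F: "F \<in> calderon" and G: "G \<in> calderon"
  shows "calderon_norm (F + G) \<le> calderon_norm F + calderon_norm G"
proof (rule calderon_normI)
  fix t
  show "norm ((F + G) (Complex 0 t)) \<le> calderon_norm F + calderon_norm G"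
    using norm_triangle_ineq[of "F (Complex 0 t)" "G (Complex 0 t)"]
      calderon_norm_left[OF F, of t] calderon_norm_left[OF G, of t] by simp
  show "l1_norm ((F + G) (Complex 1 t)) \<le> calderon_norm F + calderon_norm G"
    using edge_add(2)[OF edge_norm_l1 calderon_l1[OF F, of t] calderon_l1[OF G, of t]]
      calderon_norm_right[OF F, of t] calderon_norm_right[OF G, of t] by simp
qed

lemma calderon_norm_mult:
  assumes F: "F \<in> calderon" and "\<And>t. cmod (g (Complex 0 t)) \<le> M" "\<And>t. cmod (g (Complex 1 t)) \<le> M"
  shows "calderon_norm (mult_fun g F) \<le> M * calderon_norm F"
proof (rule calderon_normI)
  have "M \<ge> 0" using assms(2)[of 0] norm_ge_zero[of "g (Complex 0 0)"] by linarith
  fix t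
  show "norm (mult_fun g F (Complex 0 t)) \<le> M * calderon_norm F"
    unfolding mult_fun_def norm_scale_linf
    using assms calderon_norm_left[OF F, of t] \<open>M \<ge> 0\<close> by (intro mult_mono) auto
  show "l1_norm (mult_fun g F (Complex 1 t)) \<le> M * calderon_norm F"
    unfolding mult_fun_def edge_scale(2)[OF edge_norm_l1 calderon_l1[OF F]]
    using assms calderon_norm_right[OF F, of t] \<open>M \<ge> 0\<close> edge_nonneg[OF edge_norm_l1 calderon_l1[OF F], of t]
    by (intro mult_mono) auto
qed

lemma calderon_norm_scale_le: "F \<in> calderon \<Longrightarrow> calderon_norm (scale_fun c F) \<le> cmod c * calderon_norm F"
  using calderon_norm_mult[of F "\<lambda>z. c" "cmod c"]
  by (simp add: mult_fun_def[abs_def] scale_fun_def[abs_def])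

lemma calderon_norm_rst:
  assumes F: "F \<in> calderon"
  shows "calderon_norm (rst_fun S F) \<le> calderon_norm F"
proof (rule calderon_normI)
  fix t
  show "norm (rst_fun S F (Complex 0 t)) \<le> calderon_norm F"
    unfolding rst_fun_def using norm_rst_le[of S "F (Complex 0 t)"] calderon_norm_left[OF F, of t] by linarith
  show "l1_norm (rst_fun S F (Complex 1 t)) \<le> calderon_norm F"
    unfolding rst_fun_def
    using edge_rst(2)[OF edge_norm_l1 calderon_l1[OF F], of S t] calderon_norm_right[OF F, of t] by linarith
qed

section \<open>Explicit elements with finitely many nonzero coordinates\<close>

definition coord :: "nat \<Rightarrow> linf" where
  "coord n = Bcontfun (\<lambda>i. if i = n then 1 else 0)"

lemma apply_coord [simp]: "apply_bcontfun (coord n) i = (if i = n then 1 else 0)"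
  unfolding coord_def by (rule apply_Bcontfun[where B = 1]) simp

lemma l1_finite_support:
  assumes "finite S" "\<And>n. n \<notin> S \<Longrightarrow> apply_bcontfun x n = 0"
  shows "x \<in> l1" "l1_norm x \<le> (\<Sum>n\<in>S. cmod (apply_bcontfun x n))"
proof -
  have "(\<Sum>n<m. cmod (apply_bcontfun x n)) \<le> (\<Sum>n\<in>S. cmod (apply_bcontfun x n))" for m
  proof -
    have "(\<Sum>n<m. cmod (apply_bcontfun x n)) = (\<Sum>n\<in>{..<m} \<inter> S. cmod (apply_bcontfun x n))"
      using assms by (intro sum.mono_neutral_right) auto
    also have "\<dots> \<le> (\<Sum>n\<in>S. cmod (apply_bcontfun x n))"
      using assms(1) by (intro sum_mono2) auto
    finally show ?thesis .
  qed
  then show "x \<in> l1" "l1_norm x \<le> (\<Sum>n\<in>S. cmod (apply_bcontfun x n))" using l1I by blast+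
qed

lemma cv_single:
  assumes XN: "edge_norm X N" and x: "x \<in> X" and h: "continuous_on UNIV h" "(h \<longlongrightarrow> 0) at_infinity"
  shows "continuous_vanishing X N (\<lambda>t. scale_linf (h t) x)"
  unfolding continuous_vanishing_def
proof (intro conjI allI)
  show "range (\<lambda>t. scale_linf (h t) x) \<subseteq> X" using edge_scale(1)[OF XN x] by auto
  fix t
  have "isCont h t" using h by (simp add: continuous_on_eq_continuous_at)
  then have "((\<lambda>s. cmod (h s - h t) * N x) \<longlongrightarrow> cmod (h t - h t) * N x) (at t)"
    unfolding isCont_def by (intro tendsto_intros)
  moreover have "scale_linf (h s) x - scale_linf (h t) x = scale_linf (h s - h t) x" for s
    by (rule bcontfun_eqI) (simp add: algebra_simps)
  ultimately show "((\<lambda>s. N (scale_linf (h s) x - scale_linf (h t) x)) \<longlongrightarrow> 0) (at t)"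
    by (simp add: edge_scale(2)[OF XN x])
  have "((\<lambda>s. cmod (h s) * N x) \<longlongrightarrow> cmod 0 * N x) at_infinity"
    using h(2) by (intro tendsto_intros)
  then show "((\<lambda>t. N (scale_linf (h t) x)) \<longlongrightarrow> 0) at_infinity"
    by (simp add: edge_scale(2)[OF XN x])
qed

text \<open>The factor 1 + |z - 1/2|^2 retained in \<open>norm_kern_le\<close> supplies the
  decay.\<close>

lemma kern_vanishes:
  assumes c: "c = 0 \<or> c = 1"
  shows "((\<lambda>t. kern L al be ga (Complex c t)) \<longlongrightarrow> 0) at_infinity"
proof -
  define B where "B = max (cmod al) (max (cmod be) (cmod ga))"
  define E where "E = 2 * gauss_const * B * exp (L * (c - 1/2))"
  have z: "Complex c t \<in> strip" for t using c by auto
  have b: "cmod (kern L al be ga (Complex c t)) \<le> E / (1 + t\<^sup>2)" for t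
  proof -
    have "t\<^sup>2 \<le> (cmod (Complex c t - 1/2))\<^sup>2" by (simp add: cmod_power2)
    then have "cmod (kern L al be ga (Complex c t)) * (1 + t\<^sup>2)
      \<le> cmod (kern L al be ga (Complex c t)) * (1 + (cmod (Complex c t - 1/2))\<^sup>2)"
      by (intro mult_left_mono) auto
    also have "\<dots> \<le> E" unfolding E_def
      using norm_kern_le[OF z, of al B be ga L t] by (simp add: B_def)
    finally show ?thesis by (simp add: pos_le_divide_eq add_pos_nonneg)
  qed
  have E0: "E \<ge> 0" using order_trans[OF norm_ge_zero b[of 0]] by simp
  show ?thesis
    unfolding tendsto_iff eventually_at_infinity
  proof (intro allI impI)
    fix e :: real assume e: "e > 0"
    have "cmod (kern L al be ga (Complex c t)) < e" if t: "E / e + 1 \<le> \<bar>t\<bar>" for t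
    proof -
      have "\<bar>t\<bar> \<ge> 1" using t E0 e divide_nonneg_pos[of E e] by linarith
      then have "\<bar>t\<bar> * 1 \<le> \<bar>t\<bar> * \<bar>t\<bar>" by (intro mult_left_mono) auto
      then have "E / e < 1 + t\<^sup>2" using t by (simp add: power2_eq_square)
      then have "E / (1 + t\<^sup>2) < e" using e by (simp add: divide_less_eq add_pos_nonneg mult.commute)
      then show ?thesis using b[of t] by linarith
    qed
    then show "\<exists>b. \<forall>x. b \<le> norm x \<longrightarrow> dist (kern L al be ga (Complex c x)) 0 < e"
      by (intro exI[of _ "E / e + 1"]) auto
  qed
qed

lemma calderon_zero: "0 \<in> calderon"
proof (rule calderonI[where M = 0])
  have "continuous_vanishing X N (\<lambda>t. 0)" if "edge_norm X N" for X N
    using edge_zero[OF that] by (simp add: continuous_vanishing_def)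
  then show "continuous_vanishing UNIV norm (\<lambda>t. 0 (Complex 0 t))"
    "continuous_vanishing l1 l1_norm (\<lambda>t. 0 (Complex 1 t))"
    using edge_norm_linf edge_norm_l1 by auto
qed (auto simp: zero_fun_def)

definition kern_fun :: "nat \<Rightarrow> (complex \<Rightarrow> complex) \<Rightarrow> complex \<Rightarrow> linf" where
  "kern_fun n g z = (if z \<in> strip then scale_linf (g z) (coord n) else 0)"

lemma kern_fun_calderon: "kern_fun n (kern L al be ga) \<in> calderon"
proof -
  let ?g = "kern L al be ga"
  have sg: "strip_fun ?g" by (rule strip_fun_kern)
  obtain M where M: "M > 0" "\<And>z. z \<in> strip \<Longrightarrow> cmod (?g z) \<le> M"
    using strip_fun_bound[OF sg] by blast
  have cg: "continuous_on strip ?g" using sg by (simp add: strip_fun_def)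
  have c1: "coord n \<in> l1" by (rule l1_finite_support[of "{n}"]) auto
  show ?thesis
  proof (rule calderonI)
    show "norm (kern_fun n ?g z) \<le> M * norm (coord n)" if "z \<in> strip" for z
      using M that by (simp add: kern_fun_def norm_scale_linf mult_right_mono)
    have "continuous_on strip (\<lambda>z. scale_linf (?g z) (coord n))"
      by (rule continuous_on_scale_linf[OF cg]) auto
    then show "continuous_on strip (kern_fun n ?g)"
      by (rule continuous_on_eq) (simp add: kern_fun_def)
    show "(\<lambda>z. apply_bcontfun (kern_fun n ?g z) i) holomorphic_on open_strip" for i
    proof (rule holomorphic_transform)
      show "(\<lambda>z. ?g z * (if i = n then 1 else 0)) holomorphic_on open_strip"
        using sg by (auto simp: strip_fun_def intro: holomorphic_intros)
    qed (use open_strip_subset in \<open>auto simp: kern_fun_def\<close>)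
    show "continuous_vanishing UNIV norm (\<lambda>t. kern_fun n ?g (Complex 0 t))"
      using cv_single[OF edge_norm_linf UNIV_I continuous_on_edge(1)[OF cg] kern_vanishes]
      by (simp add: kern_fun_def)
    show "continuous_vanishing l1 l1_norm (\<lambda>t. kern_fun n ?g (Complex 1 t))"
      using cv_single[OF edge_norm_l1 c1 continuous_on_edge(2)[OF cg] kern_vanishes]
      by (simp add: kern_fun_def)
  qed (simp add: kern_fun_def)
qed

lemma sum_fun_apply: "(\<Sum>i\<in>I. F i) z = (\<Sum>i\<in>I. F i (z :: 'a) :: 'b :: comm_monoid_add)"
  by (induction I rule: infinite_finite_induct) auto

lemma calderon_sum: "(\<And>i. i \<in> I \<Longrightarrow> F i \<in> calderon) \<Longrightarrow> (\<Sum>i\<in>I. F i) \<in> calderon"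
  by (induction I rule: infinite_finite_induct) (auto simp: calderon_zero calderon_add)

text \<open>One kernel in each of finitely many coordinates; \<open>left\<close> and
  \<open>right\<close> are the two parts of \<open>calderon_norm\<close> written out.\<close>

lemma kern_sum:
  fixes S :: "nat set"
  assumes "finite S"
    and left: "\<And>n t. n \<in> S \<Longrightarrow> cmod (kern (L n) (al n) (be n) (ga n) (Complex 0 t)) \<le> B"
    and right: "\<And>t. (\<Sum>n\<in>S. cmod (kern (L n) (al n) (be n) (ga n) (Complex 1 t))) \<le> B"
    and "B \<ge> 0"
  obtains G where "G \<in> calderon" "calderon_norm G \<le> B"
    "\<And>n z. n \<in> S \<Longrightarrow> z \<in> strip \<Longrightarrow> apply_bcontfun (G z) n = kern (L n) (al n) (be n) (ga n) z"
    "\<And>n z. n \<notin> S \<Longrightarrow> apply_bcontfun (G z) n = 0"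
proof -
  let ?k = "\<lambda>n. kern (L n) (al n) (be n) (ga n)"
  define G where "G = (\<Sum>n\<in>S. kern_fun n (?k n))"
  have G: "G \<in> calderon" unfolding G_def by (intro calderon_sum kern_fun_calderon)
  have Gz: "apply_bcontfun (G z) n = (if n \<in> S then ?k n z else 0)" if "z \<in> strip" for n z
  proof -
    have "apply_bcontfun (G z) n = (\<Sum>i\<in>S. if n = i then ?k i z else 0)"
      unfolding G_def sum_fun_apply apply_sum using that
      by (intro sum.cong refl) (simp add: kern_fun_def)
    then show ?thesis using assms(1) by simp
  qed
  have G0: "apply_bcontfun (G z) n = 0" if "n \<notin> S" for n z
    using Gz[of z n] calderonD(1)[OF G, of z] that by (cases "z \<in> strip") auto
  show ?thesis
  proof (rule that[OF G])
    show "calderon_norm G \<le> B"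
    proof (rule calderon_normI)
      fix t
      show "norm (G (Complex 0 t)) \<le> B"
        by (rule norm_bound) (use left Gz[of "Complex 0 t"] \<open>B \<ge> 0\<close> in auto)
      have "l1_norm (G (Complex 1 t)) \<le> (\<Sum>n\<in>S. cmod (apply_bcontfun (G (Complex 1 t)) n))"
        by (rule l1_finite_support(2)[OF assms(1) G0])
      also have "\<dots> \<le> B" using right[of t] by (simp add: Gz)
      finally show "l1_norm (G (Complex 1 t)) \<le> B" .
    qed
  qed (use Gz G0 in auto)
qed

section \<open>The maps Delta as coefficients of jets\<close>

definition sel :: "nat \<Rightarrow> complex \<Rightarrow> complex \<Rightarrow> complex \<Rightarrow> complex" where
  "sel k a b c = (if k = 0 then a else if k = 1 then b else c)"

lemma jet_unique:
  assumes "jet f a b c" "jet f a' b' c'"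
  shows "a = a'" "b = b'" "c = c'"
  using jet_derivs[OF assms(1)] jet_derivs[OF assms(2)] by auto

lemma apply_Delta:
  assumes F: "F \<in> calderon"
  shows "apply_bcontfun (Delta k F) n = (deriv ^^ k) (\<lambda>z. apply_bcontfun (F z) n) (1/2) / fact k"
proof -
  have "apply_bcontfun ((cderiv ^^ k) F (1/2)) n = (deriv ^^ k) (\<lambda>z. apply_bcontfun (F z) n) (1/2)"
    using higher_cderiv_coord[OF calderon_coord_hol[OF F], of k] half_in_open_strip by blast
  then have "apply_bcontfun (Delta k F) n = inverse (fact k) * (deriv ^^ k) (\<lambda>z. apply_bcontfun (F z) n) (1/2)"
    by (simp add: Delta_def scaleR_conv_of_real)
  then show ?thesis by (simp only: divide_inverse mult.commute)
qed

lemma jet_Delta: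
  assumes F: "F \<in> calderon"
  shows "jet (\<lambda>z. apply_bcontfun (F z) n) (apply_bcontfun (Delta 0 F) n)
    (apply_bcontfun (Delta 1 F) n) (apply_bcontfun (Delta 2 F) n)"
proof -
  have "(\<lambda>z. apply_bcontfun (F z) n) holomorphic_on open_strip"
    using calderon_strip_fun[OF F] by (simp add: strip_fun_def)
  from jet_exists[OF this] show ?thesis
    unfolding apply_Delta[OF F] by (simp add: numeral_2_eq_2)
qed

lemma Delta_eq_sel:
  assumes F: "F \<in> calderon" and j: "jet (\<lambda>z. apply_bcontfun (F z) n) a b c" and "k \<le> 2"
  shows "apply_bcontfun (Delta k F) n = sel k a b c"
proof -
  have "k = 0 \<or> k = 1 \<or> k = 2" using \<open>k \<le> 2\<close> by auto
  then show ?thesis using jet_unique[OF jet_Delta[OF F] j] by (auto simp: sel_def)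
qed

lemma Delta_add:
  assumes F: "F \<in> calderon" and G: "G \<in> calderon" and k: "k \<le> 2"
  shows "Delta k (F + G) = Delta k F + Delta k G"
proof (rule bcontfun_eqI)
  fix n
  have j: "jet (\<lambda>z. apply_bcontfun ((F + G) z) n) (apply_bcontfun (Delta 0 F) n + apply_bcontfun (Delta 0 G) n)
    (apply_bcontfun (Delta 1 F) n + apply_bcontfun (Delta 1 G) n)
    (apply_bcontfun (Delta 2 F) n + apply_bcontfun (Delta 2 G) n)"
    using jet_add[OF jet_Delta[OF F] jet_Delta[OF G]] by simp
  have "k = 0 \<or> k = 1 \<or> k = 2" using k by auto
  then show "apply_bcontfun (Delta k (F + G)) n = apply_bcontfun (Delta k F + Delta k G) n"
    unfolding Delta_eq_sel[OF calderon_add[OF F G] j k] by (auto simp: sel_def)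
qed

text \<open>Serves for scalars, and with c = 1 for a multiplier that rebalances the edges without
  changing any Delta.\<close>

lemma Delta_mult:
  assumes F: "F \<in> calderon" and g: "strip_fun g" "jet g c 0 0" and k: "k \<le> 2"
  shows "Delta k (mult_fun g F) = scale_linf c (Delta k F)"
proof (rule bcontfun_eqI)
  fix n
  have j: "jet (\<lambda>z. apply_bcontfun (mult_fun g F z) n) (c * apply_bcontfun (Delta 0 F) n)
    (c * apply_bcontfun (Delta 1 F) n) (c * apply_bcontfun (Delta 2 F) n)"
    using jet_mult[OF g(2) jet_Delta[OF F]] by (simp add: mult_fun_def)
  have "k = 0 \<or> k = 1 \<or> k = 2" using k by auto
  then show "apply_bcontfun (Delta k (mult_fun g F)) n = apply_bcontfun (scale_linf c (Delta k F)) n"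
    unfolding Delta_eq_sel[OF calderon_mult[OF F g(1)] j k] by (auto simp: sel_def)
qed

lemma Delta_scale:
  assumes F: "F \<in> calderon" and k: "k \<le> 2"
  shows "Delta k (scale_fun c F) = scale_linf c (Delta k F)"
proof -
  have "jet (\<lambda>z. c) c 0 0" using jet_poly[of c 0 0] by simp
  then show ?thesis
    using Delta_mult[OF F strip_fun_const _ k] by (simp add: mult_fun_def[abs_def] scale_fun_def[abs_def])
qed

lemma Delta_rst:
  assumes F: "F \<in> calderon" and k: "k \<le> 2"
  shows "Delta k (rst_fun S F) = rst S (Delta k F)"
proof (rule bcontfun_eqI)
  fix n
  have "jet (\<lambda>z. 0) 0 0 0" using jet_poly[of 0 0 0] by simp
  then have j: "jet (\<lambda>z. apply_bcontfun (rst_fun S F z) n) (apply_bcontfun (rst S (Delta 0 F)) n)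
    (apply_bcontfun (rst S (Delta 1 F)) n) (apply_bcontfun (rst S (Delta 2 F)) n)"
    using jet_Delta[OF F, of n] by (simp add: rst_fun_def)
  have "k = 0 \<or> k = 1 \<or> k = 2" using k by auto
  then show "apply_bcontfun (Delta k (rst_fun S F)) n = apply_bcontfun (rst S (Delta k F)) n"
    unfolding Delta_eq_sel[OF calderon_rst[OF F] j k] by (auto simp: sel_def)
qed

text \<open>Cauchy's estimate on the disc of radius 1/4 about the midpoint; 16 = 4^2 covers the
  orders 0, 1 and 2.\<close>

lemma norm_Delta_le:
  assumes F: "F \<in> calderon" and k: "k \<le> 2"
  shows "cmod (apply_bcontfun (Delta k F) n) \<le> 16 * calderon_norm F"
proof -
  have sub: "cball (1/2) (1/4) \<subseteq> open_strip"
  proof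
    fix w :: complex assume "w \<in> cball (1/2) (1/4)"
    then have "\<bar>Re (1/2 - w)\<bar> \<le> 1/4"
      using abs_Re_le_cmod[of "1/2 - w"] by (simp add: dist_norm)
    then have "0 < Re w \<and> Re w < 1" by (simp add: abs_if split: if_splits)
    then show "w \<in> open_strip" by (simp add: open_strip_def)
  qed
  have "cmod ((deriv ^^ k) (\<lambda>z. apply_bcontfun (F z) n) (1/2)) \<le> fact k * calderon_norm F / (1/4) ^ k"
  proof (rule cauchy_bound[OF _ sub])
    show "cmod (apply_bcontfun (F w) n) \<le> calderon_norm F" for w
      using norm_apply_le[of "F w" n] norm_le_calderon_norm[OF F, of w] by linarith
  qed (use calderon_strip_fun[OF F, of n] in \<open>auto simp: strip_fun_def\<close>)
  then have "cmod (apply_bcontfun (Delta k F) n) \<le> 4 ^ k * calderon_norm F"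
    by (simp add: apply_Delta[OF F] norm_divide field_simps)
  also have "\<dots> \<le> 4 ^ 2 * calderon_norm F"
    using k calderon_norm_nonneg[OF F] by (intro mult_right_mono power_increasing) auto
  finally show ?thesis by simp
qed

section \<open>Completeness, tails and quotient seminorms\<close>

lemma calderon_minus:
  assumes "F \<in> calderon" "G \<in> calderon"
  shows "F - G \<in> calderon"
proof -
  have *: "F - G = F + scale_fun (-1) G"
    by (intro ext bcontfun_eqI) (simp add: scale_fun_def)
  show ?thesis unfolding * by (intro calderon_add calderon_scale assms)
qed

text \<open>Uniform limits preserve continuity and holomorphy of the coordinates, and
  \<open>cv_limit\<close> treats each edge in its own norm.\<close>

lemma calderon_limit:
  assumes off: "\<And>z. z \<notin> strip \<Longrightarrow> F z = 0"
    and lim: "\<And>e. e > 0 \<Longrightarrow> \<exists>G\<in>calderon. (\<forall>z. norm (F z - G z) \<le> e) \<and>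
      (\<forall>t. F (Complex 1 t) - G (Complex 1 t) \<in> l1 \<and> l1_norm (F (Complex 1 t) - G (Complex 1 t)) \<le> e)"
  shows "F \<in> calderon"
proof -
  have "\<exists>G\<in>calderon. \<forall>z. norm (F z - G z) \<le> 1 / real (Suc n)" for n
    using lim[of "1 / real (Suc n)"] by auto
  then obtain G where G: "\<And>n. G n \<in> calderon" "\<And>n z. norm (F z - G n z) \<le> 1 / real (Suc n)"
    by metis
  have ulim: "uniform_limit A G F sequentially" for A
  proof (rule uniform_limitI)
    fix e :: real assume "e > 0"
    then have "\<forall>\<^sub>F n in sequentially. 1 / real (Suc n) < e"
      by (intro order_tendstoD(2)[OF LIMSEQ_Suc[OF lim_1_over_n]])
    then show "\<forall>\<^sub>F n in sequentially. \<forall>z\<in>A. dist (G n z) (F z) < e"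
    proof eventually_elim
      case (elim n)
      show ?case
      proof
        fix z
        show "dist (G n z) (F z) < e"
          using G(2)[of z n] elim by (simp add: dist_norm norm_minus_commute)
      qed
    qed
  qed
  show ?thesis
  proof (rule calderonI[OF off])
    show "norm (F z) \<le> 1 + calderon_norm (G 0)" for z
      using norm_triangle_ineq[of "F z - G 0 z" "G 0 z"] G(2)[of z 0] norm_le_calderon_norm[OF G(1), of 0 z]
      by simp
    show "continuous_on strip F"
      by (rule uniform_limit_theorem[OF _ ulim]) (use calderonD(3)[OF G(1)] in auto)
    show "(\<lambda>z. apply_bcontfun (F z) i) holomorphic_on open_strip" for i
    proof (rule holomorphic_uniform_sequence[OF open_open_strip])
      show "(\<lambda>z. apply_bcontfun (G n z) i) holomorphic_on open_strip" for n
        using calderon_strip_fun[OF G(1)] by (simp add: strip_fun_def)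
      fix x assume "x \<in> open_strip"
      then obtain d where "d > 0" "cball x d \<subseteq> open_strip"
        using open_contains_cball open_open_strip by metis
      moreover have "uniform_limit (cball x d) (\<lambda>n z. apply_bcontfun (G n z) i) (\<lambda>z. apply_bcontfun (F z) i) sequentially"
        by (rule bounded_linear.uniform_limit[OF bounded_linear_apply ulim])
      ultimately show "\<exists>d>0. cball x d \<subseteq> open_strip \<and>
        uniform_limit (cball x d) (\<lambda>n z. apply_bcontfun (G n z) i) (\<lambda>z. apply_bcontfun (F z) i) sequentially"
        by blast
    qed
    show "continuous_vanishing UNIV norm (\<lambda>t. F (Complex 0 t))"
    proof (rule cv_limit[OF edge_norm_linf])
      fix e :: real assume "e > 0"
      then obtain G where "G \<in> calderon" "\<forall>z. norm (F z - G z) \<le> e" using lim by blast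
      then show "\<exists>g. continuous_vanishing UNIV norm g \<and>
        (\<forall>t. F (Complex 0 t) - g t \<in> UNIV \<and> norm (F (Complex 0 t) - g t) \<le> e)"
        using calderonD(5) by (intro exI[of _ "\<lambda>t. G (Complex 0 t)"]) auto
    qed
    show "continuous_vanishing l1 l1_norm (\<lambda>t. F (Complex 1 t))"
    proof (rule cv_limit[OF edge_norm_l1])
      fix e :: real assume "e > 0"
      then obtain G where "G \<in> calderon" "\<forall>t. F (Complex 1 t) - G (Complex 1 t) \<in> l1 \<and>
          l1_norm (F (Complex 1 t) - G (Complex 1 t)) \<le> e" using lim by blast
      then show "\<exists>g. continuous_vanishing l1 l1_norm g \<and>
        (\<forall>t. F (Complex 1 t) - g t \<in> l1 \<and> l1_norm (F (Complex 1 t) - g t) \<le> e)"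
        using calderonD(6) by (intro exI[of _ "\<lambda>t. G (Complex 1 t)"]) auto
    qed
  qed
qed

text \<open>Completeness in the form that passes most directly to quotients. The sum is formed
  coordinatewise; on the right edge the \<ell>_1 bound results from exchanging the series with
  finite sums over coordinates.\<close>

lemma calderon_series:
  assumes F: "\<And>k. F k \<in> calderon" and b: "\<And>k. calderon_norm (F k) \<le> b k" "summable b"
  obtains G where "G \<in> calderon" "(\<lambda>m. calderon_norm (G - (\<Sum>k<m. F k))) \<longlonglongrightarrow> 0"
proof -
  have b0: "0 \<le> b k" for k using b(1)[of k] calderon_norm_nonneg[OF F, of k] by linarith
  have nb: "norm (F k z) \<le> b k" for k z using norm_le_calderon_norm[OF F, of k z] b(1)[of k] by linarith
  have sb: "summable (\<lambda>k. b (k + m))" for m using b(2) by (simp add: summable_iff_shift)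
  have su: "summable (\<lambda>k. cmod (apply_bcontfun (F (k + m) z) n))" for m z n
  proof (rule summable_comparison_test'[OF sb, where N = 0])
    show "norm (cmod (apply_bcontfun (F (k + m) z) n)) \<le> b (k + m)" for k
      using norm_apply_le[of "F (k + m) z" n] nb[of "k + m" z] by simp
  qed
  define G :: "complex \<Rightarrow> linf" where "G z = Bcontfun (\<lambda>n. \<Sum>k. apply_bcontfun (F k z) n)" for z
  define tail where "tail m = (\<Sum>k. b (k + m))" for m
  have le_tail: "cmod (\<Sum>k. apply_bcontfun (F (k + m) z) n) \<le> tail m" for m z n
    unfolding tail_def
    by (rule order_trans[OF summable_norm[OF su] suminf_le[OF _ su sb]])
      (rule order_trans[OF norm_apply_le nb])
  have Gz: "apply_bcontfun (G z) n = (\<Sum>k. apply_bcontfun (F k z) n)" for z n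
    unfolding G_def by (rule apply_Bcontfun[where B = "tail 0"]) (use le_tail[of 0 z] in simp)
  have diff: "apply_bcontfun (G z - (\<Sum>k<m. F k) z) n = (\<Sum>k. apply_bcontfun (F (k + m) z) n)" for z m n
    unfolding sum_fun_apply
    using suminf_minus_initial_segment[of "\<lambda>k. apply_bcontfun (F k z) n" m] summable_norm_cancel[OF su[where m = 0]]
    by (simp add: Gz apply_sum)
  have close: "norm (G z - (\<Sum>k<m. F k) z) \<le> tail m" for z m
    by (rule norm_bound) (simp only: diff le_tail)
  have close1: "G (Complex 1 t) - (\<Sum>k<m. F k) (Complex 1 t) \<in> l1 \<and>
    l1_norm (G (Complex 1 t) - (\<Sum>k<m. F k) (Complex 1 t)) \<le> tail m" for t m
  proof -
    let ?u = "\<lambda>n k. apply_bcontfun (F (k + m) (Complex 1 t)) n"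
    have "(\<Sum>n<p. cmod (apply_bcontfun (G (Complex 1 t) - (\<Sum>k<m. F k) (Complex 1 t)) n)) \<le> tail m" for p
    proof -
      have "(\<Sum>n<p. cmod (apply_bcontfun (G (Complex 1 t) - (\<Sum>k<m. F k) (Complex 1 t)) n)) = (\<Sum>n<p. cmod (\<Sum>k. ?u n k))"
        by (simp only: diff)
      also have "\<dots> \<le> (\<Sum>n<p. \<Sum>k. cmod (?u n k))" by (intro sum_mono summable_norm su)
      also have "\<dots> = (\<Sum>k. \<Sum>n<p. cmod (?u n k))" by (rule suminf_sum[OF su, symmetric])
      also have "\<dots> \<le> (\<Sum>k. b (k + m))"
      proof (rule suminf_le[OF _ summable_sum[OF su] sb])
        fix k
        have "(\<Sum>n<p. cmod (?u n k)) \<le> l1_norm (F (k + m) (Complex 1 t))"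
          by (rule sum_le_l1_norm[OF calderon_l1[OF F]]) simp
        then show "(\<Sum>n<p. cmod (?u n k)) \<le> b (k + m)"
          using calderon_norm_right[OF F, of "k + m" t] b(1)[of "k + m"] by linarith
      qed
      finally show ?thesis by (simp only: tail_def)
    qed
    then show ?thesis using l1I by blast
  qed
  have tail0: "tail \<longlonglongrightarrow> 0"
    unfolding tail_def[abs_def] by (rule suminf_exist_split2[OF b(2)])
  have S: "(\<Sum>k<m. F k) \<in> calderon" for m by (intro calderon_sum F)
  have G: "G \<in> calderon"
  proof (rule calderon_limit)
    show "G z = 0" if "z \<notin> strip" for z by (rule bcontfun_eqI) (simp add: Gz calderonD(1)[OF F that])
    fix e :: real assume "e > 0"
    then have "\<forall>\<^sub>F m in sequentially. tail m < e" using tail0 by (intro order_tendstoD(2)) auto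
    then obtain m where "tail m < e" by (auto simp: eventually_sequentially)
    then have m: "tail m \<le> e" by simp
    then show "\<exists>H\<in>calderon. (\<forall>z. norm (G z - H z) \<le> e) \<and>
      (\<forall>t. G (Complex 1 t) - H (Complex 1 t) \<in> l1 \<and> l1_norm (G (Complex 1 t) - H (Complex 1 t)) \<le> e)"
      using S[of m] order_trans[OF close m] order_trans[OF conjunct2[OF close1] m] conjunct1[OF close1, of _ m]
      by blast
  qed
  have "calderon_norm (G - (\<Sum>k<m. F k)) \<le> tail m" for m
    by (rule calderon_normI) (use close close1 in auto)
  moreover have "0 \<le> calderon_norm (G - (\<Sum>k<m. F k))" for m
    by (intro calderon_norm_nonneg calderon_minus G S)
  ultimately have "(\<lambda>m. calderon_norm (G - (\<Sum>k<m. F k))) \<longlonglongrightarrow> 0"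
    by (intro tendsto_sandwich[OF _ _ tendsto_const tail0]) auto
  with G show ?thesis by (rule that)
qed

section \<open>Tails on the right edge\<close>

lemma l1_tail_tendsto:
  assumes "x \<in> l1"
  shows "(\<lambda>m. l1_norm (rst {m..} x)) \<longlonglongrightarrow> 0"
proof -
  have s: "summable (\<lambda>n. cmod (apply_bcontfun x n))" using assms by (simp add: l1_def)
  have "l1_norm (rst {m..} x) = (\<Sum>n. cmod (apply_bcontfun x (n + m)))" for m
  proof -
    have sr: "summable (\<lambda>n. cmod (apply_bcontfun (rst {m..} x) n))"
      using edge_rst(1)[OF edge_norm_l1 assms, of "{m..}"] by (simp add: l1_def)
    show ?thesis
      unfolding l1_norm_def using suminf_minus_initial_segment[OF sr, of m] by simp
  qed
  then show ?thesis using suminf_exist_split2[OF s] by simp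
qed

text \<open>The curve on the right edge is continuous and vanishes at infinity, so it is relatively
  compact in \<ell>_1, and on such sets tails are uniformly small. On the left edge tails need not
  be small at all.\<close>

lemma uniform_l1_tail:
  assumes F: "F \<in> calderon" and e: "e > 0"
  obtains m where "\<And>t. l1_norm (rst {m..} (F (Complex 1 t))) \<le> e"
proof (rule ccontr)
  note XN = edge_norm_l1
  let ?f = "\<lambda>t. F (Complex 1 t)"
  assume "\<not> thesis"
  then have "\<exists>t. l1_norm (rst {m..} (?f t)) > e" for m using that by (meson not_le)
  then obtain t where t: "\<And>m. l1_norm (rst {m..} (?f (t m))) > e" by metis
  have cv: "continuous_vanishing l1 l1_norm ?f" by (rule calderonD(6)[OF F])
  note i = calderon_l1[OF F]
  have "((\<lambda>s. l1_norm (?f s)) \<longlongrightarrow> 0) at_infinity" using cv by (simp add: continuous_vanishing_def)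
  then have "\<forall>\<^sub>F s in at_infinity. l1_norm (?f s) < e" using e by (intro order_tendstoD(2)) auto
  then obtain b where b: "\<And>s. b \<le> \<bar>s\<bar> \<Longrightarrow> l1_norm (?f s) < e" by (auto simp: eventually_at_infinity)
  have "t m \<in> {-b..b}" for m
  proof (rule ccontr)
    assume "t m \<notin> {-b..b}"
    then have "b \<le> \<bar>t m\<bar>" by auto
    from b[OF this] show False using t[of m] edge_rst(2)[OF XN i, of "{m..}" "t m"] by linarith
  qed
  then obtain l r where lr: "strict_mono r" "(\<lambda>k. t (r k)) \<longlonglongrightarrow> l"
    using compact_imp_seq_compact[OF compact_Icc[of "-b" b]] unfolding seq_compact_def comp_def by metis
  define phi where "phi s = l1_norm (?f s - ?f l)" for s
  have "phi l = 0" using edge_zero(2)[OF XN] by (simp add: phi_def)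
  moreover have "(phi \<longlongrightarrow> 0) (at l)" using cv by (simp add: continuous_vanishing_def phi_def[abs_def])
  ultimately have "isCont phi l" by (simp add: isCont_def)
  then have "(\<lambda>k. phi (t (r k))) \<longlonglongrightarrow> 0"
    using isCont_tendsto_compose[OF _ lr(2), of phi] \<open>phi l = 0\<close> by simp
  moreover have "(\<lambda>k. l1_norm (rst {r k..} (?f l))) \<longlonglongrightarrow> 0"
    using LIMSEQ_subseq_LIMSEQ[OF l1_tail_tendsto[OF i[of l]] lr(1)] by (simp add: comp_def)
  ultimately have "(\<lambda>k. phi (t (r k)) + l1_norm (rst {r k..} (?f l))) \<longlonglongrightarrow> 0"
    by (rule tendsto_add_zero)
  then have "\<forall>\<^sub>F k in sequentially. phi (t (r k)) + l1_norm (rst {r k..} (?f l)) < e"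
    using e by (intro order_tendstoD(2)) auto
  then obtain k where k: "phi (t (r k)) + l1_norm (rst {r k..} (?f l)) < e"
    by (auto simp: eventually_sequentially)
  have d: "?f (t (r k)) - ?f l \<in> l1" by (rule edge_diff(1)[OF XN i i])
  have "rst {r k..} (?f (t (r k))) = rst {r k..} (?f (t (r k)) - ?f l) + rst {r k..} (?f l)"
    by (simp add: rst_diff)
  then have "l1_norm (rst {r k..} (?f (t (r k))))
    \<le> l1_norm (rst {r k..} (?f (t (r k)) - ?f l)) + l1_norm (rst {r k..} (?f l))"
    using edge_add(2)[OF XN edge_rst(1)[OF XN d] edge_rst(1)[OF XN i]] by simp
  also have "\<dots> \<le> phi (t (r k)) + l1_norm (rst {r k..} (?f l))"
    using edge_rst(2)[OF XN d] by (simp add: phi_def)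
  finally show False using t[of "r k"] k by linarith
qed

text \<open>The tail of \<open>F\<close> is bounded on the left edge but small, say \<open>\<le> exp (-2 q)\<close>, on the right one.
  Multiplication by \<open>exp (2 q w)\<close>, where \<open>w = z - 1/2\<close>, balances the two edges, and the
  polynomial \<open>1 - 2 q w + 2 q\<^sup>2 w\<^sup>2\<close> undoes its effect on the derivatives up to order 2.\<close>

lemma tail_representative:
  assumes F: "F \<in> calderon" and e: "e > 0"
  obtains m G where "G \<in> calderon" "calderon_norm G \<le> e"
    "\<And>k. k \<le> 2 \<Longrightarrow> Delta k G = Delta k (rst_fun {m..} F)"
proof -
  define A where "A = calderon_norm F + 1"
  have A: "A \<ge> 1" using calderon_norm_nonneg[OF F] by (simp add: A_def)
  \<comment> \<open>\<open>c\<close> is quadratic in \<open>q\<close>, so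
    \<open>c * exp (- q)\<close> is at most of order 1/q, and this \<open>q\<close> brings its
    product with \<open>2 * gauss_const * A\<close> down to \<open>e\<close>.\<close>
  define q where "q = 216 * gauss_const * A / e"
  have q: "q \<ge> 0" using A gauss_const_ge_1 e by (simp add: q_def)
  define c where "c = 1 + 2 * q + 2 * q\<^sup>2"
  have c: "c \<ge> 1" "2 * q \<le> c" "2 * q\<^sup>2 \<le> c" using q by (auto simp: c_def)
  have small: "2 * gauss_const * c * exp (- q) * A \<le> e"
  proof -
    have "((1 + q) / 3) ^ 3 \<le> exp (q / 3) ^ 3"
    proof (rule power_mono)
      have "(1 + q) / 3 \<le> 1 + q / 3" by (simp add: add_divide_distrib)
      then show "(1 + q) / 3 \<le> exp (q / 3)" using exp_ge_add_one_self[of "q / 3"] by linarith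
    qed (use q in simp)
    also have "\<dots> = exp q" by (simp flip: exp_of_nat_mult)
    finally have 1: "(1 + q) ^ 3 \<le> 27 * exp q" by (simp add: power_divide)
    have "c \<le> 2 * (1 + q)\<^sup>2" using q by (simp add: c_def power2_eq_square algebra_simps)
    then have "c * (1 + q) \<le> 2 * (1 + q) ^ 3"
      using mult_right_mono[of c "2 * (1 + q)\<^sup>2" "1 + q"] q by (simp add: power3_eq_cube power2_eq_square mult_ac)
    also have "\<dots> \<le> 54 * exp q" using 1 by simp
    finally have "c * (1 + q) * exp (- q) \<le> 54 * exp q * exp (- q)" by (intro mult_right_mono) auto
    also have "\<dots> = 54 * (exp q * exp (- q))" by simp
    also have "exp q * exp (- q) = 1" by (simp flip: exp_add)
    finally have 2: "c * exp (- q) * (1 + q) \<le> 54" by (simp add: mult_ac)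
    have "2 * gauss_const * c * exp (- q) * A * (1 + q) = 2 * gauss_const * A * (c * exp (- q) * (1 + q))"
      by simp
    also have "\<dots> \<le> 2 * gauss_const * A * 54" using 2 A gauss_const_ge_1 by (intro mult_left_mono) auto
    also have "\<dots> \<le> e * q" using e A gauss_const_ge_1 by (simp add: q_def)
    also have "\<dots> \<le> e * (1 + q)" using e by simp
    finally show ?thesis using q by simp
  qed
  define g where "g = kern (2 * q) 1 (of_real (- 2 * q)) (of_real (2 * q\<^sup>2))"
  have sg: "strip_fun g" unfolding g_def by (rule strip_fun_kern)
  have jg: "jet g 1 0 0"
    using jet_kern[of "2 * q" 1 "of_real (- 2 * q)" "of_real (2 * q\<^sup>2)"]
    by (simp add: g_def power2_eq_square)
  have gb: "cmod (g z) \<le> 2 * gauss_const * c * exp (2 * q * (Re z - 1/2))" if "z \<in> strip" for z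
    unfolding g_def by (rule norm_kern_le'[OF that]) (use c q in \<open>auto simp: norm_mult norm_power\<close>)
  obtain m where m: "\<And>t. l1_norm (rst {m..} (F (Complex 1 t))) \<le> exp (-2 * q)"
    using uniform_l1_tail[OF F, of "exp (-2 * q)"] by auto
  let ?F = "rst_fun {m..} F"
  have FC: "?F \<in> calderon" by (rule calderon_rst[OF F])
  show ?thesis
  proof (rule that[of "mult_fun g ?F" m])
    show "mult_fun g ?F \<in> calderon" by (rule calderon_mult[OF FC sg])
    show "Delta k (mult_fun g ?F) = Delta k ?F" if "k \<le> 2" for k
      unfolding Delta_mult[OF FC sg jg that] by (rule bcontfun_eqI) simp
    show "calderon_norm (mult_fun g ?F) \<le> e"
    proof (rule calderon_normI)
      fix t
      have FA: "norm (?F (Complex 0 t)) \<le> A"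
        using calderon_norm_left[OF FC, of t] calderon_norm_rst[OF F, of "{m..}"] by (simp add: A_def)
      have "norm (mult_fun g ?F (Complex 0 t)) = cmod (g (Complex 0 t)) * norm (?F (Complex 0 t))"
        by (simp add: mult_fun_def norm_scale_linf)
      also have "\<dots> \<le> (2 * gauss_const * c * exp (- q)) * A"
        using gb[of "Complex 0 t"] FA c gauss_const_ge_1 by (intro mult_mono) auto
      finally show "norm (mult_fun g ?F (Complex 0 t)) \<le> e" using small by linarith
      have "l1_norm (mult_fun g ?F (Complex 1 t)) = cmod (g (Complex 1 t)) * l1_norm (?F (Complex 1 t))"
        unfolding mult_fun_def by (rule edge_scale(2)[OF edge_norm_l1 calderon_l1[OF FC]])
      also have "\<dots> \<le> (2 * gauss_const * c * exp q) * exp (-2 * q)"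
        using gb[of "Complex 1 t"] m[of t] c gauss_const_ge_1
          edge_nonneg[OF edge_norm_l1 calderon_l1[OF FC], of t]
        by (intro mult_mono) (auto simp: rst_fun_def)
      also have "\<dots> = (2 * gauss_const * c * exp (- q)) * 1"
        by (simp flip: exp_add)
      also have "\<dots> \<le> (2 * gauss_const * c * exp (- q)) * A"
        using A c gauss_const_ge_1 by (intro mult_left_mono) auto
      finally show "l1_norm (mult_fun g ?F (Complex 1 t)) \<le> e" using small by linarith
    qed
  qed
qed

section \<open>Quotient seminorms on the Calderon space\<close>

interpretation fs: block_space scale_fun rst_fun
proof (unfold_locales, goal_cases)
qed (auto simp: scale_fun_def rst_fun_def algebra_simps fun_eq_iff intro!: bcontfun_eqI)

lemma subspace_calderon: "fs.subspace calderon"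
  by (simp add: fs.subspace_def calderon_zero calderon_add calderon_scale)

definition agree :: "nat set \<Rightarrow> (complex \<Rightarrow> linf) \<Rightarrow> (complex \<Rightarrow> linf) \<Rightarrow> bool" where
  "agree M F G \<longleftrightarrow> (\<forall>k\<in>M. Delta k F = Delta k G)"

text \<open>The quotient norm of the tuple of all \<open>Delta k F\<close> with
  \<open>k \<in> M\<close>, read as a seminorm of the function \<open>F\<close> itself.\<close>

definition qn :: "nat set \<Rightarrow> (complex \<Rightarrow> linf) \<Rightarrow> real" where
  "qn M F = Inf {calderon_norm G | G. G \<in> calderon \<and> agree M G F}"

lemma qn_le: "G \<in> calderon \<Longrightarrow> agree M G F \<Longrightarrow> qn M F \<le> calderon_norm G"
  unfolding qn_def by (rule cInf_lower) (auto intro!: bdd_belowI[of _ 0] calderon_norm_nonneg)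

lemma qn_approx:
  assumes "F \<in> calderon" "e > 0"
  obtains G where "G \<in> calderon" "agree M G F" "calderon_norm G < qn M F + e"
proof -
  let ?A = "{calderon_norm G | G. G \<in> calderon \<and> agree M G F}"
  have "calderon_norm F \<in> ?A" using assms(1) by (auto simp: agree_def)
  then have "?A \<noteq> {}" by blast
  then obtain x where "x \<in> ?A" "x < Inf ?A + e"
    using cInf_lessD[of ?A "Inf ?A + e"] assms(2) by auto
  then show ?thesis using that unfolding qn_def by auto
qed

lemma qn_nonneg: "F \<in> calderon \<Longrightarrow> 0 \<le> qn M F"
  unfolding qn_def by (rule cInf_greatest) (auto simp: agree_def calderon_norm_nonneg)

lemma qn_cong: "agree M F G \<Longrightarrow> qn M F = qn M G"
  by (simp add: qn_def agree_def)

lemma qn_mono: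
  assumes "M0 \<subseteq> M" "F \<in> calderon"
  shows "qn M0 F \<le> qn M F"
proof (rule field_le_epsilon)
  fix e :: real assume "e > 0"
  then obtain G where "G \<in> calderon" "agree M G F" "calderon_norm G < qn M F + e"
    using qn_approx assms(2) by blast
  moreover from this have "qn M0 F \<le> calderon_norm G"
    using assms(1) by (intro qn_le) (auto simp: agree_def)
  ultimately show "qn M0 F \<le> qn M F + e" by linarith
qed

lemma seminorm_calderon:
  assumes M: "M \<subseteq> {..2}"
  shows "fs.seminorm_on calderon (qn M)"
proof -
  have M2: "k \<le> 2" if "k \<in> M" for k using that M by auto
  have sc: "qn M (scale_fun c F) \<le> cmod c * qn M F" if F: "F \<in> calderon" for c F
  proof (rule field_le_epsilon)
    fix e :: real assume e: "e > 0"
    obtain G where G: "G \<in> calderon" "agree M G F" "calderon_norm G < qn M F + e / (cmod c + 1)"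
      using qn_approx[OF F, of "e / (cmod c + 1)"] e by (auto simp: add_nonneg_pos)
    have "qn M (scale_fun c F) \<le> calderon_norm (scale_fun c G)"
      using G F by (intro qn_le calderon_scale) (auto simp: agree_def Delta_scale M2)
    also have "\<dots> \<le> cmod c * calderon_norm G" by (rule calderon_norm_scale_le[OF G(1)])
    also have "\<dots> \<le> cmod c * (qn M F + e / (cmod c + 1))" using G by (intro mult_left_mono) auto
    also have "\<dots> \<le> cmod c * qn M F + e"
    proof -
      have "cmod c * (e / (cmod c + 1)) \<le> (cmod c + 1) * (e / (cmod c + 1))"
        using e by (intro mult_right_mono) auto
      also have "\<dots> = e" using norm_ge_zero[of c] by (auto simp: add_nonneg_eq_0_iff)
      finally show ?thesis by (simp add: distrib_left)
    qed
    finally show "qn M (scale_fun c F) \<le> cmod c * qn M F + e" .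
  qed
  have "qn M (scale_fun c F) = cmod c * qn M F" if F: "F \<in> calderon" for c F
  proof (cases "c = 0")
    case True
    then show ?thesis using sc[OF F, of 0] qn_nonneg[OF calderon_scale[OF F], of M 0] by simp
  next
    case False
    have "scale_fun (inverse c) (scale_fun c F) = F" using False by simp
    then have "qn M F \<le> cmod (inverse c) * qn M (scale_fun c F)"
      using sc[OF calderon_scale[OF F], of "inverse c" c] by simp
    then have "cmod c * qn M F \<le> qn M (scale_fun c F)"
      using False by (simp add: norm_inverse norm_divide field_simps)
    then show ?thesis using sc[OF F, of c] by simp
  qed
  moreover have "qn M (F + G) \<le> qn M F + qn M G" if F: "F \<in> calderon" and G: "G \<in> calderon" for F G
  proof (rule field_le_epsilon)
    fix e :: real assume e: "e > 0"
    obtain F' where F': "F' \<in> calderon" "agree M F' F" "calderon_norm F' < qn M F + e / 2"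
      using qn_approx[OF F, of "e / 2"] e by auto
    obtain G' where G': "G' \<in> calderon" "agree M G' G" "calderon_norm G' < qn M G + e / 2"
      using qn_approx[OF G, of "e / 2"] e by auto
    have "qn M (F + G) \<le> calderon_norm (F' + G')"
      using F' G' F G by (intro qn_le calderon_add) (auto simp: agree_def Delta_add M2)
    also have "\<dots> \<le> calderon_norm F' + calderon_norm G'" by (rule calderon_norm_add[OF F'(1) G'(1)])
    finally show "qn M (F + G) \<le> qn M F + qn M G + e" using F'(3) G'(3) by linarith
  qed
  moreover have "qn M (rst_fun S F) \<le> qn M F" if F: "F \<in> calderon" for S F
  proof (rule field_le_epsilon)
    fix e :: real assume e: "e > 0"
    obtain G where G: "G \<in> calderon" "agree M G F" "calderon_norm G < qn M F + e"
      using qn_approx[OF F e] by auto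
    have "qn M (rst_fun S F) \<le> calderon_norm (rst_fun S G)"
      using G F by (intro qn_le calderon_rst) (auto simp: agree_def Delta_rst M2)
    also have "\<dots> \<le> calderon_norm G" by (rule calderon_norm_rst[OF G(1)])
    finally show "qn M (rst_fun S F) \<le> qn M F + e" using G(3) by linarith
  qed
  ultimately show ?thesis
    by (auto simp: fs.seminorm_on_def subspace_calderon calderon_rst)
qed

lemma apply_Delta_le_qn:
  assumes F: "F \<in> calderon" and k: "k \<in> M" "k \<le> 2"
  shows "cmod (apply_bcontfun (Delta k F) n) \<le> 16 * qn M F"
proof (rule field_le_epsilon)
  fix e :: real assume e: "e > 0"
  obtain G where G: "G \<in> calderon" "agree M G F" "calderon_norm G < qn M F + e / 16"
    using qn_approx[OF F, of "e / 16"] e by auto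
  have "cmod (apply_bcontfun (Delta k F) n) \<le> 16 * calderon_norm G"
    using norm_Delta_le[OF G(1) k(2), of n] G(2) k(1) by (simp add: agree_def)
  then show "cmod (apply_bcontfun (Delta k F) n) \<le> 16 * qn M F + e" using G(3) by simp
qed

section \<open>The block property of the jet spaces\<close>

definition ker_all :: "nat set \<Rightarrow> (complex \<Rightarrow> linf) set" where
  "ker_all B = {F \<in> calderon. \<forall>b\<in>B. Delta b F = 0}"

lemma subspace_ker_all:
  assumes B: "B \<subseteq> {..2}"
  shows "fs.subspace (ker_all B)"
proof -
  have b2: "b \<le> 2" if "b \<in> B" for b using that B by auto
  have "scale_fun 0 0 = 0" by (rule ext) (simp add: scale_fun_def)
  then have "Delta b 0 = 0" if "b \<le> 2" for b
    using Delta_scale[OF calderon_zero that, of 0] by simp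
  then show ?thesis
    using b2 by (auto simp: fs.subspace_def ker_all_def calderon_zero calderon_add calderon_scale Delta_add Delta_scale)
qed

lemma seminorm_ker_all:
  assumes "B \<subseteq> {..2}" "M \<subseteq> {..2}"
  shows "fs.seminorm_on (ker_all B) (qn M)"
proof -
  have "b \<le> 2" if "b \<in> B" for b using that assms by auto
  moreover have "ker_all B \<subseteq> calderon" by (auto simp: ker_all_def)
  ultimately show ?thesis
    using seminorm_calderon[OF assms(2)] subspace_ker_all[OF assms(1)]
    by (auto simp: fs.seminorm_on_def ker_all_def Delta_rst calderon_rst)
qed

text \<open>The \<open>k\<close>-th Taylor coefficient of \<open>kern\<close>, as in
  \<open>jet_kern\<close>: what \<open>Delta k\<close> sees of an explicitly built function.\<close>

definition kern_jet :: "nat \<Rightarrow> real \<Rightarrow> complex \<Rightarrow> complex \<Rightarrow> complex \<Rightarrow> complex" where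
  "kern_jet k L al be ga = sel k al (al * L + be) (al * L\<^sup>2 / 2 + be * L + ga)"

text \<open>The \<open>k\<close>-th Taylor coefficient in the form of
  \<open>jets_decomposition\<close>: what \<open>Delta k\<close> sees of an arbitrary function of
  small norm.\<close>

definition canon_jet :: "nat \<Rightarrow> complex \<Rightarrow> complex \<Rightarrow> complex \<Rightarrow> complex" where
  "canon_jet k x0 x1 x2 = sel k x0 (x0 * lam x0 + x1) (x0 * (lam x0)\<^sup>2 / 2 + x1 * lam x1 + x2)"

text \<open>For \<open>F\<close> with \<open>\<Delta>\<^sub>b F = 0\<close> for all \<open>b \<in> B\<close>, the two halves below say that the quotient norm of
  \<open>\<Delta>\<^sub>a F\<close> is equivalent to the norm of the Orlicz space whose function is \<open>(t / |ln t| ^ k)\<^sup>2\<close> near 0.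
  The values of \<open>\<Delta>\<^sub>a F\<close> are written as \<open>sqrt t\<close> times \<open>c\<close> in the first half, with \<open>L = ln t\<close>.\<close>

definition modular_index :: "nat set \<Rightarrow> nat \<Rightarrow> nat \<Rightarrow> bool" where
  "modular_index B a k \<longleftrightarrow> k \<le> 2 \<and> a \<le> 2 \<and> B \<subseteq> {..2} \<and> a \<notin> B \<and>
     (\<forall>L c. L \<le> -4 \<and> cmod c \<le> (- L) ^ k \<longrightarrow> (\<exists>al be ga. cmod al \<le> 2 \<and> cmod be \<le> 2 \<and> cmod ga \<le> 2 \<and>
        kern_jet a L al be ga = c \<and> (\<forall>b\<in>B. kern_jet b L al be ga = 0))) \<and>
     (\<forall>t x0 x1 x2. 0 \<le> t \<and> t \<le> exp (-4) \<and> (cmod x0)\<^sup>2 \<le> t \<and> (cmod x1)\<^sup>2 \<le> t \<and> (cmod x2)\<^sup>2 \<le> t \<and>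
        (\<forall>b\<in>B. canon_jet b x0 x1 x2 = 0) \<longrightarrow> cmod (canon_jet a x0 x1 x2) \<le> 4 * rho k t)"

text \<open>A competitor for the infimum is written down. Coordinate n carries a kernel with
  exponent \<open>ln (t n)\<close> and coefficients of order \<open>sqrt (t n)\<close>; its modulus
  is at most a constant on the left edge and that constant times \<open>t n\<close> on the right
  one, where the masses add up to an \<ell>_1 bound.\<close>

lemma modular_upper:
  assumes adm: "modular_index B a k" and F: "F \<in> ker_all B" and S: "finite S" "rst_fun S F = F"
    and t: "\<And>n. 0 \<le> t n" "(\<Sum>n\<in>S. t n) \<le> exp (-4)"
    and le: "\<And>n. n \<in> S \<Longrightarrow> cmod (apply_bcontfun (Delta a F) n) \<le> rho k (t n)"
  shows "qn (insert a B) F \<le> 4 * gauss_const"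
proof -
  have FC: "F \<in> calderon" and FB: "\<And>b. b \<in> B \<Longrightarrow> Delta b F = 0" using F by (auto simp: ker_all_def)
  have a2: "a \<le> 2" and B2: "\<And>b. b \<in> B \<Longrightarrow> b \<le> 2" using adm by (auto simp: modular_index_def)
  define y where "y n = apply_bcontfun (Delta a F) n" for n
  have t4: "t n \<le> exp (-4)" if "n \<in> S" for n
  proof -
    have "t n \<le> (\<Sum>n\<in>S. t n)" using that S t by (intro member_le_sum) auto
    then show ?thesis using t(2) by linarith
  qed
  have "\<exists>al be ga. cmod al \<le> 2 * sqrt (t n) \<and> cmod be \<le> 2 * sqrt (t n) \<and> cmod ga \<le> 2 * sqrt (t n) \<and>
      kern_jet a (ln (t n)) al be ga = y n \<and> (\<forall>b\<in>B. kern_jet b (ln (t n)) al be ga = 0)"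
    if n: "n \<in> S" for n
  proof (cases "t n = 0")
    case True
    then show ?thesis using le[OF n]
      by (intro exI[of _ 0]) (auto simp: kern_jet_def sel_def y_def)
  next
    case False
    then have tp: "t n > 0" using t(1)[of n] by simp
    \<comment> \<open>\<open>modular_index\<close> speaks of entries divided by
      \<open>sqrt (t n)\<close>; since the jets are linear in the three coefficients, the factor can
      be put back afterwards.\<close>
    define q where "q = complex_of_real (sqrt (t n))"
    have q: "q \<noteq> 0" "cmod q = sqrt (t n)" using tp by (auto simp: q_def)
    have "cmod (y n / q) \<le> (- ln (t n)) ^ k"
      using le[OF n] tp by (simp add: y_def rho_def norm_divide q(2) field_simps)
    then obtain al be ga where abg: "cmod al \<le> 2" "cmod be \<le> 2" "cmod ga \<le> 2"
      "kern_jet a (ln (t n)) al be ga = y n / q" "\<And>b. b \<in> B \<Longrightarrow> kern_jet b (ln (t n)) al be ga = 0"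
      using adm ln_le_minus_4[OF tp t4[OF n]] unfolding modular_index_def by metis
    have j: "kern_jet b L (q * al) (q * be) (q * ga) = q * kern_jet b L al be ga" for b L
      by (simp add: kern_jet_def sel_def algebra_simps)
    show ?thesis
      using abg q tp
      by (intro exI[of _ "q * al"] exI[of _ "q * be"] exI[of _ "q * ga"]) (auto simp: j norm_mult)
  qed
  then obtain al be ga where abg: "\<And>n. n \<in> S \<Longrightarrow> cmod (al n) \<le> 2 * sqrt (t n)"
    "\<And>n. n \<in> S \<Longrightarrow> cmod (be n) \<le> 2 * sqrt (t n)" "\<And>n. n \<in> S \<Longrightarrow> cmod (ga n) \<le> 2 * sqrt (t n)"
    "\<And>n. n \<in> S \<Longrightarrow> kern_jet a (ln (t n)) (al n) (be n) (ga n) = y n"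
    "\<And>n b. n \<in> S \<Longrightarrow> b \<in> B \<Longrightarrow> kern_jet b (ln (t n)) (al n) (be n) (ga n) = 0"
    by metis
  let ?k = "\<lambda>n. kern (ln (t n)) (al n) (be n) (ga n)"
  have kb: "cmod (?k n z) \<le> 4 * gauss_const * (sqrt (t n) * exp (ln (t n) * (Re z - 1/2)))"
    if "n \<in> S" "z \<in> strip" for n z
    using norm_kern_le'[OF that(2) abg(1-3)[OF that(1)], of "ln (t n)"] by (simp add: mult_ac)
  have left: "cmod (?k n (Complex 0 u)) \<le> 4 * gauss_const" if n: "n \<in> S" for n u
  proof (cases "t n = 0")
    case True
    then show ?thesis using kb[OF n, of "Complex 0 u"] gauss_const_ge_1 by simp
  next
    case False
    then have tp: "t n > 0" using t(1)[of n] by simp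
    have "sqrt (t n) * exp (ln (t n) * (0 - 1/2)) = 1"
      using tp by (simp add: sqrt_eq_exp flip: exp_add)
    then show ?thesis using kb[OF n, of "Complex 0 u"] by simp
  qed
  have right: "cmod (?k n (Complex 1 u)) \<le> 4 * gauss_const * t n" if n: "n \<in> S" for n u
  proof (cases "t n = 0")
    case True
    then show ?thesis using kb[OF n, of "Complex 1 u"] gauss_const_ge_1 by simp
  next
    case False
    then have tp: "t n > 0" using t(1)[of n] by simp
    have "sqrt (t n) * exp (ln (t n) * (1 - 1/2)) = exp (ln (t n))"
      using tp by (simp only: sqrt_eq_exp flip: exp_add) simp
    then show ?thesis using kb[OF n, of "Complex 1 u"] tp by simp
  qed
  have "(\<Sum>n\<in>S. cmod (?k n (Complex 1 u))) \<le> 4 * gauss_const" for u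
  proof -
    have "(\<Sum>n\<in>S. cmod (?k n (Complex 1 u))) \<le> (\<Sum>n\<in>S. 4 * gauss_const * t n)"
      by (intro sum_mono right)
    also have "\<dots> \<le> 4 * gauss_const * exp (-4)"
      unfolding sum_distrib_left[symmetric] using t(2) gauss_const_ge_1 by (intro mult_left_mono) auto
    also have "\<dots> \<le> 4 * gauss_const * 1" using gauss_const_ge_1 by (intro mult_left_mono) auto
    finally show ?thesis by simp
  qed
  then obtain G where G: "G \<in> calderon" "calderon_norm G \<le> 4 * gauss_const"
    "\<And>n z. n \<in> S \<Longrightarrow> z \<in> strip \<Longrightarrow> apply_bcontfun (G z) n = ?k n z"
    "\<And>n z. n \<notin> S \<Longrightarrow> apply_bcontfun (G z) n = 0"
    using kern_sum[OF S(1), of "\<lambda>n. ln (t n)" al be ga "4 * gauss_const"] left gauss_const_ge_1 by auto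
  have DG: "apply_bcontfun (Delta b G) n = (if n \<in> S then kern_jet b (ln (t n)) (al n) (be n) (ga n) else 0)"
    if b: "b \<le> 2" for b n
  proof (cases "n \<in> S")
    case True
    have "jet (\<lambda>z. apply_bcontfun (G z) n) (al n) (al n * ln (t n) + be n) (al n * (ln (t n))\<^sup>2 / 2 + be n * ln (t n) + ga n)"
      by (rule jet_cong[OF jet_kern]) (use G(3)[OF True] open_strip_subset in auto)
    then show ?thesis using Delta_eq_sel[OF G(1) _ b] True by (simp add: kern_jet_def)
  next
    case False
    have "jet (\<lambda>z. 0) 0 0 0" using jet_poly[of 0 0 0] by simp
    then have "jet (\<lambda>z. apply_bcontfun (G z) n) 0 0 0" using G(4)[OF False] by simp
    from Delta_eq_sel[OF G(1) this b] show ?thesis using False by (simp add: sel_def)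
  qed
  have "agree (insert a B) G F"
    unfolding agree_def
  proof
    fix b assume "b \<in> insert a B"
    then consider "b = a" | "b \<in> B" by auto
    then show "Delta b G = Delta b F"
    proof cases
      case 1
      have "Delta a F = rst S (Delta a F)" using Delta_rst[OF FC a2, of S] S(2) by simp
      then have out: "apply_bcontfun (Delta a F) n = 0" if "n \<notin> S" for n
        using that by (metis apply_rst)
      show ?thesis unfolding 1
        by (rule bcontfun_eqI) (use out in \<open>auto simp: DG[OF a2] abg(4) y_def\<close>)
    next
      case 2
      show ?thesis unfolding FB[OF 2]
        by (rule bcontfun_eqI) (simp add: DG[OF B2[OF 2]] abg(5)[OF _ 2])
    qed
  qed
  then show ?thesis using qn_le[OF G(1)] G(2) order_trans by blast
qed

text \<open>Chosen so that the squares in \<open>jets_decomposition\<close>, applied with d = 8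
  \<open>mod_const\<close>, add up to at most \<open>exp (-4)\<close>.\<close>

definition mod_const :: real where
  "mod_const = exp (-4) / (24 * (6 * gauss_const) ^ 5)"

lemma mod_const: "0 < mod_const" "8 * mod_const \<le> 1" "3 * (6 * gauss_const) ^ 5 * (8 * mod_const) = exp (-4)"
proof -
  have g: "(6 * gauss_const) ^ 5 \<ge> 1" using gauss_const_ge_1 by (intro one_le_power) simp
  then have g0: "(6 * gauss_const) ^ 5 > 0" by linarith
  then show "0 < mod_const" unfolding mod_const_def by (intro divide_pos_pos mult_pos_pos) auto
  show "3 * (6 * gauss_const) ^ 5 * (8 * mod_const) = exp (-4)"
    unfolding mod_const_def using g0 by (simp del: power_mult_distrib)
  have "8 * mod_const = exp (-4) / (3 * (6 * gauss_const) ^ 5)" by (simp add: mod_const_def)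
  also have "\<dots> \<le> 1 / 1" using g by (intro frac_le) auto
  finally show "8 * mod_const \<le> 1" by simp
qed

text \<open>A nearly optimal representative is decomposed by \<open>jets_decomposition\<close>; the
  mass of a coordinate is the sum of its three squares.\<close>

lemma modular_lower:
  assumes adm: "modular_index B a k" and F: "F \<in> ker_all B" and q: "qn (insert a B) F \<le> mod_const"
    and S: "finite S"
  shows "\<exists>t. (\<forall>n. 0 \<le> t n) \<and> (\<Sum>n\<in>S. t n) \<le> exp (-4) \<and>
    (\<forall>n\<in>S. cmod (apply_bcontfun (Delta a F) n) \<le> rho k (t n))"
proof -
  have FC: "F \<in> calderon" and FB: "\<And>b. b \<in> B \<Longrightarrow> Delta b F = 0" using F by (auto simp: ker_all_def)
  have a2: "a \<le> 2" and B2: "\<And>b. b \<in> B \<Longrightarrow> b \<le> 2" using adm by (auto simp: modular_index_def)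
  obtain G where G: "G \<in> calderon" "agree (insert a B) G F" "calderon_norm G < qn (insert a B) F + mod_const"
    using qn_approx[OF FC mod_const(1)] by blast
  \<comment> \<open>The factor 4 cancels the constant 4 in the second half of
    \<open>modular_index\<close>. A representative of norm below 2 \<open>mod_const\<close> becomes
    one of norm at most 8 \<open>mod_const\<close>.\<close>
  let ?H = "scale_fun 4 G"
  have H: "?H \<in> calderon" by (rule calderon_scale[OF G(1)])
  have Hn: "calderon_norm ?H \<le> 8 * mod_const"
    using calderon_norm_scale_le[OF G(1), of 4] G(3) q by simp
  have HD: "Delta b ?H = scale_linf 4 (Delta b F)" if "b \<in> insert a B" for b
    using Delta_scale[OF G(1), of b 4] G(2) that a2 B2 by (auto simp: agree_def)
  obtain x0 x1 x2 where x:
    "\<And>n. n \<in> S \<Longrightarrow> jet (\<lambda>z. apply_bcontfun (?H z) n) (x0 n) (x0 n * lam (x0 n) + x1 n)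
       (x0 n * (lam (x0 n))\<^sup>2 / 2 + x1 n * lam (x1 n) + x2 n)"
    "(\<Sum>n\<in>S. (cmod (x0 n))\<^sup>2 + (cmod (x1 n))\<^sup>2 + (cmod (x2 n))\<^sup>2) \<le> 3 * (6 * gauss_const) ^ 5 * (8 * mod_const)"
  proof (rule jets_decomposition[OF S, where f = "\<lambda>n z. apply_bcontfun (?H z) n" and d = "8 * mod_const"])
    show "strip_fun (\<lambda>z. apply_bcontfun (?H z) n)" for n by (rule calderon_strip_fun[OF H])
    show "cmod (apply_bcontfun (?H (Complex 0 t)) n) \<le> 1" for n t
      using norm_apply_le[of "?H (Complex 0 t)" n] calderon_norm_left[OF H, of t] Hn mod_const(2) by linarith
    show "(\<Sum>n\<in>S. cmod (apply_bcontfun (?H (Complex 1 t)) n)) \<le> 8 * mod_const" for t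
      using sum_le_l1_norm[OF calderon_l1[OF H] S, of t] calderon_norm_right[OF H, of t] Hn by linarith
  qed (use mod_const that in auto)
  define t where "t n = (cmod (x0 n))\<^sup>2 + (cmod (x1 n))\<^sup>2 + (cmod (x2 n))\<^sup>2" for n
  have t: "0 \<le> t n" for n by (simp add: t_def)
  have ts: "(\<Sum>n\<in>S. t n) \<le> exp (-4)" using x(2) mod_const(3) by (simp add: t_def)
  have "cmod (apply_bcontfun (Delta a F) n) \<le> rho k (t n)" if n: "n \<in> S" for n
  proof -
    have "t n \<le> (\<Sum>n\<in>S. t n)" using n S t by (intro member_le_sum) auto
    then have t4: "t n \<le> exp (-4)" using ts by linarith
    have J: "canon_jet b (x0 n) (x1 n) (x2 n) = 4 * apply_bcontfun (Delta b F) n" if "b \<in> insert a B" for b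
    proof -
      have "b \<le> 2" using that a2 B2 by auto
      then show ?thesis
        using Delta_eq_sel[OF H x(1)[OF n], of b] HD[OF that] by (simp add: canon_jet_def)
    qed
    have "cmod (canon_jet a (x0 n) (x1 n) (x2 n)) \<le> 4 * rho k (t n)"
    proof -
      have "\<forall>b\<in>B. canon_jet b (x0 n) (x1 n) (x2 n) = 0" using J FB by simp
      moreover have "(cmod (x0 n))\<^sup>2 \<le> t n" "(cmod (x1 n))\<^sup>2 \<le> t n" "(cmod (x2 n))\<^sup>2 \<le> t n"
        by (auto simp: t_def)
      ultimately show ?thesis using adm t[of n] t4 unfolding modular_index_def by blast
    qed
    then show ?thesis using J[of a] by (simp add: norm_mult)
  qed
  then show ?thesis using t ts by blast
qed

lemma modular_index_block_property:
  assumes adm: "modular_index B a k"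
  shows "fs.l2_block_property (ker_all B) (qn (insert a B))"
proof -
  have a2: "a \<le> 2" and B2: "B \<subseteq> {..2}" and k2: "k \<le> 2" using adm by (auto simp: modular_index_def)
  have C: "F \<in> ker_all B \<Longrightarrow> F \<in> calderon" for F by (simp add: ker_all_def)
  interpret modular_space scale_fun rst_fun "ker_all B" "qn (insert a B)"
    "\<lambda>F n. apply_bcontfun (Delta a F) n" k "4 * gauss_const" mod_const
  proof unfold_locales
    show "fs.seminorm_on (ker_all B) (qn (insert a B))"
      using B2 a2 by (intro seminorm_ker_all) auto
    show "apply_bcontfun (Delta a (x + y)) n = apply_bcontfun (Delta a x) n + apply_bcontfun (Delta a y) n"
      if "x \<in> ker_all B" "y \<in> ker_all B" for x y n
      using Delta_add[OF C[OF that(1)] C[OF that(2)] a2] by simp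
    show "apply_bcontfun (Delta a (scale_fun c x)) n = c * apply_bcontfun (Delta a x) n"
      if "x \<in> ker_all B" for x c n
      using Delta_scale[OF C[OF that] a2] by simp
    show "apply_bcontfun (Delta a (rst_fun S x)) n = (if n \<in> S then apply_bcontfun (Delta a x) n else 0)"
      if "x \<in> ker_all B" for x S n
      using Delta_rst[OF C[OF that] a2] by simp
    show "qn (insert a B) x \<le> 4 * gauss_const"
      if "x \<in> ker_all B" "finite S" "rst_fun S x = x" "\<And>n. 0 \<le> t n" "(\<Sum>n\<in>S. t n) \<le> exp (-4)"
        "\<And>n. n \<in> S \<Longrightarrow> cmod (apply_bcontfun (Delta a x) n) \<le> rho k (t n)" for x S t
      by (rule modular_upper[OF adm that])
    show "\<exists>t. (\<forall>n. 0 \<le> t n) \<and> (\<Sum>n\<in>S. t n) \<le> exp (-4) \<and>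
        (\<forall>n\<in>S. cmod (apply_bcontfun (Delta a x) n) \<le> rho k (t n))"
      if "x \<in> ker_all B" "qn (insert a B) x \<le> mod_const" "finite S" for x S
      by (rule modular_lower[OF adm that])
  qed (use k2 mod_const(1) in auto)
  show ?thesis by (rule l2_block_property)
qed

text \<open>For nonzero x the left side is \<open>rho k\<close> at |x|^2, and \<open>rho k\<close>
  is increasing.\<close>

lemma mult_lam_le:
  assumes "0 \<le> t" "t \<le> exp (-4)" "(cmod x)\<^sup>2 \<le> t" "k \<le> 2"
  shows "cmod x * \<bar>lam x\<bar> ^ k \<le> rho k t"
proof (cases "x = 0")
  case True
  then show ?thesis using rho_nonneg[OF assms(1,2)] by simp
next
  case False
  then have l: "ln ((cmod x)\<^sup>2) = lam x" by (simp add: lam_def ln_realpow)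
  have "ln ((cmod x)\<^sup>2) \<le> -4" using False assms by (intro ln_le_minus_4) auto
  then have "rho k ((cmod x)\<^sup>2) = cmod x * \<bar>lam x\<bar> ^ k" unfolding rho_def l by simp
  then show ?thesis using rho_mono[OF _ assms(3,2,4)] by simp
qed

lemma le_rho:
  assumes "0 \<le> t" "t \<le> exp (-4)" "(cmod x)\<^sup>2 \<le> t"
  shows "cmod x \<le> rho k t"
proof (cases "t = 0")
  case False
  then have t: "t > 0" using assms by simp
  have "cmod x \<le> sqrt t" using assms(3) by (rule real_le_rsqrt)
  also have "\<dots> \<le> sqrt t * (- ln t) ^ k"
    using mult_left_mono[of 1 "(- ln t) ^ k" "sqrt t"] ln_le_minus_4[OF t assms(2)] t by simp
  finally show ?thesis by (simp add: rho_def)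
qed (use assms in auto)

lemma rho_1_le_2: "0 \<le> t \<Longrightarrow> t \<le> exp (-4) \<Longrightarrow> rho 1 t \<le> rho 2 t"
proof (cases "t = 0")
  case False
  assume t: "0 \<le> t" "t \<le> exp (-4)"
  with False have "ln t \<le> -4" using ln_le_minus_4[of t] by simp
  then have "(- ln t) ^ 1 \<le> (- ln t) ^ 2" by (intro power_increasing) auto
  then show ?thesis using t unfolding rho_def by (intro mult_left_mono) auto
qed simp

text \<open>If \<open>\<Delta>\<^sub>1 F = 0\<close>, then \<open>x\<^sub>1 = - x\<^sub>0 lam x\<^sub>0\<close> and the logarithms of \<open>x\<^sub>0\<close> and \<open>x\<^sub>1\<close> are comparable.\<close>

lemma lam_comparison:
  assumes "(cmod x)\<^sup>2 \<le> exp (-4)" "x \<noteq> 0"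
  shows "\<bar>lam x\<bar> \<le> 4 * \<bar>lam (x * lam x)\<bar>"
proof -
  define u where "u = - ln (cmod x)"
  have "ln ((cmod x)\<^sup>2) \<le> -4" using assms by (intro ln_le_minus_4) auto
  then have u: "u \<ge> 2" using assms by (simp add: u_def ln_realpow)
  have l: "lam x = - 2 * u" by (simp add: lam_def u_def)
  have "cmod (x * lam x) = (2 * u) * cmod x" using u by (simp add: l norm_mult)
  moreover have "ln ((2 * u) * cmod x) = ln (2 * u) + ln (cmod x)"
    using u assms by (intro ln_mult_pos) auto
  ultimately have l': "lam (x * lam x) = 2 * (ln (2 * u) - u)" by (simp add: lam_def u_def)
  \<comment> \<open>The tangent of the logarithm of u/2 at 1, that is at the smallest admissible u =
    2, has slope 1/2 in u; with ln 2 \<le> 25/36 this leaves room up to 3u/4.\<close>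
  have "ln (2 * u) = 2 * ln 2 + ln (u / 2)"
    using u by (simp add: ln_mult ln_div)
  also have "\<dots> \<le> 2 * (25/36) + (u / 2 - 1)"
    using ln_le_minus_one[of "u / 2"] u ln2_le_25_over_36 by (intro add_mono mult_left_mono) auto
  also have "\<dots> \<le> 3 * u / 4" using u by simp
  finally have le: "ln (2 * u) \<le> 3 * u / 4" .
  have "\<bar>lam (x * lam x)\<bar> = 2 * (u - ln (2 * u))" unfolding l' using le u by simp
  then have "2 * u \<le> 4 * \<bar>lam (x * lam x)\<bar>" using le by simp
  moreover have "\<bar>lam x\<bar> = 2 * u" unfolding l using u by simp
  ultimately show ?thesis by simp
qed

text \<open>In every instance \<open>k\<close> is \<open>a\<close> minus the number of elements of
  \<open>B\<close>: each of these vanishing conditions of lower order removes one logarithm.\<close>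

lemma modular_index_instances:
  "modular_index {} 0 0" "modular_index {0} 1 0" "modular_index {0, 1} 2 0"
  "modular_index {} 1 1" "modular_index {0} 2 1" "modular_index {1} 2 1" "modular_index {} 2 2"
proof -
  note defs = modular_index_def kern_jet_def canon_jet_def sel_def
  have tri: "cmod (x + y) \<le> p + q" if "cmod x \<le> p" "cmod y \<le> q" for x y :: complex and p q
    using norm_triangle_ineq[of x y] that by linarith
  have r4: "p \<le> 4 * p" if "0 \<le> p" for p :: real using that by simp
  have div1: "cmod (c / L) \<le> 1" if "cmod c \<le> - L" "L \<le> -4" for c :: complex and L :: real
  proof -
    have "cmod (c / L) = cmod c / (- L)" using that by (simp add: norm_divide)
    also have "\<dots> \<le> 1" using that by (subst divide_le_eq_1_pos) auto
    finally show ?thesis .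
  qed
  have div2: "cmod (2 * c / L\<^sup>2) \<le> 2" if "cmod c \<le> L\<^sup>2" for c :: complex and L :: real
  proof (cases "L = 0")
    case False
    have "cmod (2 * c / L\<^sup>2) = 2 * cmod c / L\<^sup>2" by (simp add: norm_divide norm_mult norm_power)
    also have "\<dots> \<le> 2" using that False by (subst pos_divide_le_eq) auto
    finally show ?thesis .
  qed simp
  show "modular_index {} 0 0"
    unfolding defs
  proof (intro conjI allI impI, goal_cases)
    case (5 L c)
    then show ?case by (intro exI[of _ c] exI[of _ 0]) auto
  next
    case (6 t x0 x1 x2)
    then show ?case using le_rho[of t x0 0] rho_nonneg[of t 0] by simp
  qed auto
  show "modular_index {0} 1 0"
    unfolding defs
  proof (intro conjI allI impI, goal_cases)
    case (5 L c)
    then show ?case by (intro exI[of _ 0] exI[of _ c]) auto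
  next
    case (6 t x0 x1 x2)
    then show ?case using le_rho[of t x1 0] rho_nonneg[of t 0] by simp
  qed auto
  show "modular_index {0, 1} 2 0"
    unfolding defs
  proof (intro conjI allI impI, goal_cases)
    case (5 L c)
    then show ?case by (intro exI[of _ 0] exI[of _ c]) auto
  next
    case (6 t x0 x1 x2)
    then have "x0 = 0" "x1 = 0" by auto
    then show ?case using 6 le_rho[of t x2 0] rho_nonneg[of t 0] by simp
  qed auto
  show "modular_index {} 1 1"
    unfolding defs
  proof (intro conjI allI impI, goal_cases)
    case (5 L c)
    then show ?case using div1[of c L] by (intro exI[of _ "c / L"] exI[of _ 0]) auto
  next
    case (6 t x0 x1 x2)
    then have "cmod (x0 * lam x0 + x1) \<le> rho 1 t + rho 1 t"
      using mult_lam_le[of t x0 1] le_rho[of t x1 1] by (intro tri) (auto simp: norm_mult)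
    then show ?case using 6 rho_nonneg[of t 1] by simp
  qed auto
  show "modular_index {0} 2 1"
    unfolding defs
  proof (intro conjI allI impI, goal_cases)
    case (5 L c)
    show ?case
      by (rule exI[of _ 0], rule exI[of _ "c / L"], rule exI[of _ 0]) (use 5 div1[of c L] in auto)
  next
    case (6 t x0 x1 x2)
    then have "cmod (x1 * lam x1 + x2) \<le> rho 1 t + rho 1 t"
      using mult_lam_le[of t x1 1] le_rho[of t x2 1] by (intro tri) (auto simp: norm_mult)
    then show ?case using 6 rho_nonneg[of t 1] by simp
  qed auto
  show "modular_index {1} 2 1"
    unfolding defs
  proof (intro conjI allI impI, goal_cases)
    \<comment> \<open>\<open>Delta 1\<close> vanishes if be = - al L; then al L^2 / 2 + be L = c has
      the solution al = - 2c / L^2, be = 2c / L.\<close>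
    case (5 L c)
    then have c: "cmod c \<le> - L" "L \<le> -4" by auto
    have L: "complex_of_real L \<noteq> 0" using c by auto
    have "cmod (- 2 * c / L\<^sup>2) \<le> 2"
    proof -
      have "- L * 1 \<le> - L * - L" using c by (intro mult_left_mono) auto
      then have "cmod c \<le> L\<^sup>2" using c by (simp add: power2_eq_square)
      then show ?thesis using div2[of c L] by (simp add: norm_divide norm_mult)
    qed
    moreover have "cmod (2 * c / L) \<le> 2" using div1[OF c] by (simp add: norm_divide norm_mult)
    ultimately show ?case using L
      by (intro exI[of _ "- 2 * c / L\<^sup>2"] exI[of _ "2 * c / L"] exI[of _ 0])
        (auto simp: power2_eq_square field_simps)
  next
    case (6 t x0 x1 x2)
    then have t: "0 \<le> t" "t \<le> exp (-4)" "(cmod x0)\<^sup>2 \<le> t" "(cmod x1)\<^sup>2 \<le> t" "(cmod x2)\<^sup>2 \<le> t"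
      and x1: "x1 = - (x0 * lam x0)" by (auto simp: add_eq_0_iff)
    have m: "cmod x1 * \<bar>lam x1\<bar> \<le> rho 1 t" using mult_lam_le[OF t(1,2,4), of 1] by simp
    \<comment> \<open>Of the two logarithms on x0, one is absorbed by x1 = - x0
      \<open>lam x0\<close>, and the other is comparable to \<open>lam x1\<close>.\<close>
    have "cmod (x0 * (lam x0)\<^sup>2 / 2) \<le> 2 * rho 1 t"
    proof (cases "x0 = 0")
      case True
      then show ?thesis using rho_nonneg[OF t(1,2)] by simp
    next
      case False
      have "(cmod x0)\<^sup>2 \<le> exp (-4)" using t by linarith
      then have "\<bar>lam x0\<bar> \<le> 4 * \<bar>lam (x0 * lam x0)\<bar>" using False by (rule lam_comparison)
      also have "lam (x0 * lam x0) = lam x1" by (simp add: x1 lam_def)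
      finally have c: "\<bar>lam x0\<bar> \<le> 4 * \<bar>lam x1\<bar>" .
      have "cmod (x0 * (lam x0)\<^sup>2 / 2) = cmod x1 * \<bar>lam x0\<bar> / 2"
        by (simp add: x1 norm_mult norm_divide norm_power power2_eq_square)
      also have "\<dots> \<le> cmod x1 * (4 * \<bar>lam x1\<bar>) / 2"
        using c by (intro divide_right_mono mult_left_mono) auto
      also have "\<dots> \<le> 2 * rho 1 t" using m by simp
      finally show ?thesis .
    qed
    then have "cmod (x0 * (lam x0)\<^sup>2 / 2 + x1 * lam x1 + x2) \<le> (2 * rho 1 t + rho 1 t) + rho 1 t"
      using m le_rho[OF t(1,2,5), of 1] by (intro tri) (auto simp: norm_mult)
    then show ?case by simp
  qed auto
  show "modular_index {} 2 2"
    unfolding defs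
  proof (intro conjI allI impI, goal_cases)
    case (5 L c)
    then show ?case using div2[of c L]
      by (intro exI[of _ "2 * c / L\<^sup>2"] exI[of _ 0]) (auto simp: norm_mult norm_divide)
  next
    case (6 t x0 x1 x2)
    then have t: "0 \<le> t" "t \<le> exp (-4)" "(cmod x0)\<^sup>2 \<le> t" "(cmod x1)\<^sup>2 \<le> t" "(cmod x2)\<^sup>2 \<le> t"
      by auto
    have "cmod (x1 * lam x1) \<le> rho 2 t"
      using mult_lam_le[OF t(1,2,4), of 1] rho_1_le_2[OF t(1,2)] by (simp add: norm_mult)
    moreover have "cmod (x0 * (lam x0)\<^sup>2 / 2) \<le> rho 2 t"
      using mult_lam_le[OF t(1,2,3), of 2] rho_nonneg[OF t(1,2), of 2]
      by (simp add: norm_mult norm_divide norm_power)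
    ultimately have "cmod (x0 * (lam x0)\<^sup>2 / 2 + x1 * lam x1 + x2) \<le> (rho 2 t + rho 2 t) + rho 2 t"
      using le_rho[OF t(1,2,5), of 2] by (intro tri)
    then show ?case using rho_nonneg[OF t(1,2), of 2] by simp
  qed auto
qed

text \<open>\<open>ker_all B\<close> and \<open>qn B\<close> act as kernel and quotient of the map
  that forgets \<open>Delta a\<close>. For the lifting, a nearly optimal representative of the part
  of \<open>F\<close> seen by \<open>B\<close> is restricted to the support of \<open>F\<close> and
  subtracted; the difference lies in the kernel.\<close>

lemma block_property_insert:
  assumes M0: "fs.l2_block_property calderon (qn B)" and adm: "modular_index B a k"
  shows "fs.l2_block_property calderon (qn (insert a B))"
proof (rule fs.l2_block_property_three_space[where ?N0.0 = "qn B" and ?V0.0 = "ker_all B"])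
  have a2: "a \<le> 2" and B: "B \<subseteq> {..2}" using adm by (auto simp: modular_index_def)
  show "fs.seminorm_on calderon (qn (insert a B))" using a2 B by (intro seminorm_calderon) auto
  show "fs.seminorm_on calderon (qn B)" using B by (rule seminorm_calderon)
  show "qn B F \<le> qn (insert a B) F" if "F \<in> calderon" for F using that by (intro qn_mono) auto
  show "ker_all B \<subseteq> calderon" by (auto simp: ker_all_def)
  show "fs.l2_block_property (ker_all B) (qn (insert a B))" by (rule modular_index_block_property[OF adm])
  fix F S and e :: real assume F: "F \<in> calderon" "rst_fun S F = F" and e: "e > 0"
  obtain G where G: "G \<in> calderon" "agree B G F" "calderon_norm G < qn B F + e"
    using qn_approx[OF F(1) e] by blast
  let ?G = "rst_fun S G"
  have GC: "?G \<in> calderon" by (rule calderon_rst[OF G(1)])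
  have D: "Delta b ?G = Delta b F" if "b \<in> B" for b
  proof -
    have b: "b \<le> 2" using that B by auto
    have "Delta b ?G = rst S (Delta b F)" using G(2) that by (simp add: Delta_rst[OF G(1) b] agree_def)
    also have "\<dots> = Delta b F" using Delta_rst[OF F(1) b, of S] F(2) by simp
    finally show ?thesis .
  qed
  have "F - ?G \<in> ker_all B"
  proof -
    have "Delta b (F - ?G) = 0" if b: "b \<in> B" for b
    proof -
      have b2: "b \<le> 2" using that B by auto
      have "Delta b (F - ?G) + Delta b ?G = Delta b F"
        using Delta_add[OF calderon_minus[OF F(1) GC] GC b2] by simp
      then show ?thesis using D[OF b] by simp
    qed
    then show ?thesis using calderon_minus[OF F(1) GC] by (simp add: ker_all_def)
  qed
  moreover have "rst_fun S (F - ?G) = F - ?G"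
  proof -
    have "rst_fun S (F - ?G) = rst_fun S F - rst_fun S ?G"
      by (rule ext) (simp add: rst_fun_def rst_diff)
    moreover have "rst_fun S ?G = ?G" by (simp add: fs.R_R)
    ultimately show ?thesis using F(2) by simp
  qed
  moreover have "qn (insert a B) (F - (F - ?G)) \<le> qn B F + e"
  proof -
    have "qn (insert a B) ?G \<le> calderon_norm ?G" using GC by (intro qn_le) (auto simp: agree_def)
    also have "\<dots> \<le> calderon_norm G" by (rule calderon_norm_rst[OF G(1)])
    finally show ?thesis using G(3) by simp
  qed
  ultimately show "\<exists>F'\<in>ker_all B. rst_fun S F' = F' \<and> qn (insert a B) (F - F') \<le> qn B F + e"
    by blast
qed (rule M0)

text \<open>Every set is reached by adding its elements in increasing order, which only calls for
  the instances of \<open>modular_index\<close> established above.\<close>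

lemma block_property_calderon:
  assumes "M \<subseteq> {0, 1, 2}" "M \<noteq> {}"
  shows "fs.l2_block_property calderon (qn M)"
proof -
  have k: "ker_all {} = calderon" by (simp add: ker_all_def)
  have 0: "fs.l2_block_property calderon (qn {0})"
    using modular_index_block_property[OF modular_index_instances(1)] by (simp add: k)
  have 1: "fs.l2_block_property calderon (qn {1})"
    using modular_index_block_property[OF modular_index_instances(4)] by (simp add: k)
  have 2: "fs.l2_block_property calderon (qn {2})"
    using modular_index_block_property[OF modular_index_instances(7)] by (simp add: k)
  have 10: "fs.l2_block_property calderon (qn {1, 0})"
    by (rule block_property_insert[OF 0 modular_index_instances(2)])
  have 20: "fs.l2_block_property calderon (qn {2, 0})"
    by (rule block_property_insert[OF 0 modular_index_instances(5)])
  have 21: "fs.l2_block_property calderon (qn {2, 1})"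
    by (rule block_property_insert[OF 1 modular_index_instances(6)])
  have 01: "{1, 0} = {0, 1::nat}" by auto
  have 210: "fs.l2_block_property calderon (qn {2, 0, 1})"
    by (rule block_property_insert[OF 10[unfolded 01] modular_index_instances(3)])
  have "M \<in> Pow {2, 0, 1}" using assms(1) by auto
  then have "M = {0} \<or> M = {1} \<or> M = {2} \<or> M = {0, 1} \<or> M = {2, 0} \<or> M = {2, 1} \<or> M = {2, 0, 1}"
    using assms(2) by (auto simp: Pow_insert)
  then show ?thesis using 0 1 2 10[unfolded 01] 20 21 210 by auto
qed

section \<open>Embedding of the Hilbert sequence space\<close>

lemma l2_add:
  assumes "x \<in> l2" "y \<in> l2"
  shows "x + y \<in> l2"
proof -
  have "summable (\<lambda>n. 2 * (cmod (apply_bcontfun x n))\<^sup>2 + 2 * (cmod (apply_bcontfun y n))\<^sup>2)"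
    using assms by (intro summable_add summable_mult) (auto simp: l2_def)
  then have "summable (\<lambda>n. (cmod (apply_bcontfun (x + y) n))\<^sup>2)"
  proof (rule summable_comparison_test'[where N = 0])
    fix n
    let ?a = "apply_bcontfun x n" and ?b = "apply_bcontfun y n"
    have "(cmod (?a + ?b))\<^sup>2 \<le> (cmod ?a + cmod ?b)\<^sup>2"
      by (intro power_mono norm_triangle_ineq) auto
    also have "\<dots> \<le> 2 * (cmod ?a)\<^sup>2 + 2 * (cmod ?b)\<^sup>2"
      using zero_le_power2[of "cmod ?a - cmod ?b"] by (simp add: power2_eq_square algebra_simps)
    finally show "norm ((cmod (apply_bcontfun (x + y) n))\<^sup>2) \<le> 2 * (cmod ?a)\<^sup>2 + 2 * (cmod ?b)\<^sup>2"
      by simp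
  qed
  then show ?thesis by (simp add: l2_def)
qed

lemma l2_scale: "x \<in> l2 \<Longrightarrow> scale_linf c x \<in> l2"
  by (simp add: l2_def norm_mult power_mult_distrib summable_mult)

lemma l2_zero: "0 \<in> l2"
  by (simp add: l2_def)

lemma l2_norm_partial:
  assumes "x \<in> l2"
  shows "(\<lambda>n. sqrt (\<Sum>j<n. (cmod (apply_bcontfun x j))\<^sup>2)) \<longlonglongrightarrow> l2_norm x"
    "sqrt (\<Sum>j<n. (cmod (apply_bcontfun x j))\<^sup>2) \<le> l2_norm x"
proof -
  have s: "summable (\<lambda>j. (cmod (apply_bcontfun x j))\<^sup>2)" using assms by (simp add: l2_def)
  show "(\<lambda>n. sqrt (\<Sum>j<n. (cmod (apply_bcontfun x j))\<^sup>2)) \<longlonglongrightarrow> l2_norm x"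
    unfolding l2_norm_def by (intro tendsto_real_sqrt summable_LIMSEQ s)
  show "sqrt (\<Sum>j<n. (cmod (apply_bcontfun x j))\<^sup>2) \<le> l2_norm x"
    unfolding l2_norm_def by (intro real_sqrt_le_mono sum_le_suminf s) auto
qed

lemma l2_norm_eq_0: "x \<in> l2 \<Longrightarrow> l2_norm x = 0 \<Longrightarrow> x = 0"
proof (rule bcontfun_eqI)
  fix j
  assume x: "x \<in> l2" "l2_norm x = 0"
  have "(\<Sum>i<Suc j. (cmod (apply_bcontfun x i))\<^sup>2) \<le> 0"
    using l2_norm_partial(2)[OF x(1), of "Suc j"] x(2) by simp
  moreover have "(cmod (apply_bcontfun x j))\<^sup>2 \<le> (\<Sum>i<Suc j. (cmod (apply_bcontfun x i))\<^sup>2)"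
    by (intro member_le_sum) auto
  ultimately have "(cmod (apply_bcontfun x j))\<^sup>2 \<le> 0" by (rule order_trans[rotated])
  then show "apply_bcontfun x j = apply_bcontfun 0 j" by simp
qed

text \<open>Completeness is expressed by absolutely convergent series, the form inherited by
  quotients.\<close>

locale complete_normed = vector_space s
  for s :: "complex \<Rightarrow> 'v::ab_group_add \<Rightarrow> 'v" +
  fixes V :: "'v set" and N :: "'v \<Rightarrow> real"
  assumes V: "subspace V"
    and N_add: "x \<in> V \<Longrightarrow> y \<in> V \<Longrightarrow> N (x + y) \<le> N x + N y"
    and N_scale: "x \<in> V \<Longrightarrow> N (s c x) = cmod c * N x"
    and N_nonneg: "x \<in> V \<Longrightarrow> 0 \<le> N x"
    and N_eq_0: "x \<in> V \<Longrightarrow> N x = 0 \<Longrightarrow> x = 0"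
    and complete: "(\<And>k. f k \<in> V) \<Longrightarrow> (\<And>k. N (f k) \<le> b k) \<Longrightarrow> summable b \<Longrightarrow>
      \<exists>l\<in>V. (\<lambda>m. N (l - (\<Sum>k<m. f k))) \<longlonglongrightarrow> 0"
begin

lemma N_minus: "x \<in> V \<Longrightarrow> N (- x) = N x"
  using N_scale[of x "-1"] by simp

lemma N_diff: "x \<in> V \<Longrightarrow> y \<in> V \<Longrightarrow> N (x - y) \<le> N x + N y"
  using N_add[of x "- y"] N_minus[of y] subspace_neg[OF V, of y] by simp

lemma N_triangle:
  assumes "x \<in> V" "y \<in> V" "z \<in> V"
  shows "N (x - z) \<le> N (x - y) + N (y - z)"
  using N_add[of "x - y" "y - z"] subspace_diff[OF V] assms by simp

lemma N_commute: "x \<in> V \<Longrightarrow> y \<in> V \<Longrightarrow> N (x - y) = N (y - x)"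
  using N_minus[of "x - y"] subspace_diff[OF V, of x y] by simp

lemma limit_unique:
  assumes "y \<in> V" "y' \<in> V" "\<And>n. p n \<in> V"
    and "(\<lambda>n. N (y - p n)) \<longlonglongrightarrow> 0" "(\<lambda>n. N (y' - p n)) \<longlonglongrightarrow> 0"
  shows "y = y'"
proof -
  have "N (y - y') \<le> N (y - p n) + N (y' - p n)" for n
    using N_triangle[OF assms(1,3,2), of n] N_commute[OF assms(2) assms(3)[of n]] by simp
  then have "N (y - y') \<le> 0"
    by (intro LIMSEQ_le_const[OF tendsto_add_zero[OF assms(4,5)]]) auto
  then have "y - y' = 0"
    using N_eq_0[of "y - y'"] N_nonneg[of "y - y'"] subspace_diff[OF V assms(1,2)] by auto
  then show ?thesis by simp
qed

text \<open>The isomorphism maps a square summable sequence to the sum of its series in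
  \<open>w\<close>. The upper estimate makes partial sums Cauchy, closedness keeps the sums in
  \<open>Y\<close>, and both estimates pass to the limit.\<close>

lemma l2_embedding:
  fixes w :: "nat \<Rightarrow> 'v"
  assumes Y: "closed_subspace s V N Y" and w: "\<And>j. w j \<in> Y" and "c > 0"
    and low: "\<And>a n. c * sqrt (\<Sum>j<n. (cmod (a j))\<^sup>2) \<le> N (\<Sum>j<n. s (a j) (w j))"
    and up: "\<And>a n. N (\<Sum>j<n. s (a j) (w j)) \<le> C * sqrt (\<Sum>j<n. (cmod (a j))\<^sup>2)"
  shows "\<exists>Z. subspace Z \<and> Z \<subseteq> Y \<and> isomorphic_spaces scale_linf l2 l2_norm s Z N"
proof -
  have YS: "subspace Y" and YV: "Y \<subseteq> V" using Y by (auto simp: closed_subspace_def)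
  have Ycl: "y \<in> Y" if "y \<in> V" "\<And>e. e > 0 \<Longrightarrow> \<exists>x\<in>Y. N (y - x) < e" for y
    using Y that unfolding closed_subspace_def by blast
  define P where "P a n = (\<Sum>j<n. s (apply_bcontfun a j) (w j))" for a :: linf and n
  have PY: "P a n \<in> Y" for a n
    unfolding P_def by (intro subspace_sum[OF YS] subspace_scale[OF YS] w)
  have PV: "P a n \<in> V" for a n using PY YV by auto
  have C0: "C \<ge> 0"
    using up[of "\<lambda>_. 1" 1] N_nonneg[of "w 0"] w[of 0] YV by auto
  have ex: "\<exists>y\<in>V. (\<lambda>n. N (y - P a n)) \<longlonglongrightarrow> 0" if a: "a \<in> l2" for a
  proof -
    have sm: "summable (\<lambda>j. (cmod (apply_bcontfun a j))\<^sup>2)" using a by (simp add: l2_def)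
    define tail where "tail n = (\<Sum>j. (cmod (apply_bcontfun a (j + n)))\<^sup>2)" for n
    have tail0: "tail \<longlonglongrightarrow> 0" unfolding tail_def[abs_def] by (rule suminf_exist_split2[OF sm])
    have diff: "N (P a m - P a n) \<le> C * sqrt (tail n)" if "n \<le> m" for m n
    proof -
      let ?b = "\<lambda>j. if j < n then 0 else apply_bcontfun a j"
      have "P a m - P a n = (\<Sum>j<m. s (?b j) (w j))"
      proof -
        have "P a m - P a n = (\<Sum>j\<in>{n..<m}. s (apply_bcontfun a j) (w j))"
          unfolding P_def using that by (simp add: sum_diff_nat_ivl flip: atLeast0LessThan)
        also have "\<dots> = (\<Sum>j\<in>{n..<m}. s (?b j) (w j))" by (intro sum.cong) auto
        also have "\<dots> = (\<Sum>j<m. s (?b j) (w j))" by (intro sum.mono_neutral_left) auto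
        finally show ?thesis .
      qed
      then have "N (P a m - P a n) \<le> C * sqrt (\<Sum>j<m. (cmod (?b j))\<^sup>2)" using up[where a = ?b and n = m] by simp
      also have "(\<Sum>j<m. (cmod (?b j))\<^sup>2) = (\<Sum>j\<in>{n..<m}. (cmod (apply_bcontfun a j))\<^sup>2)"
        by (rule sum.mono_neutral_cong_right) auto
      also have "\<dots> = (\<Sum>j<m - n. (cmod (apply_bcontfun a (j + n)))\<^sup>2)"
        by (rule sum.reindex_bij_witness[of _ "\<lambda>j. j + n" "\<lambda>j. j - n"]) auto
      also have "C * sqrt \<dots> \<le> C * sqrt (tail n)"
        unfolding tail_def using C0 summable_ignore_initial_segment[OF sm, of n]
        by (intro mult_left_mono real_sqrt_le_mono sum_le_suminf) auto
      finally show ?thesis .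
    qed
    \<comment> \<open>Along \<open>r\<close> the increments of the partial sums are dominated by a
      geometric series, as \<open>complete\<close> requires; the whole sequence then converges by
      the Cauchy estimate \<open>diff\<close>.\<close>
    have "\<exists>r. strict_mono r \<and> (\<forall>k. tail (r k) \<le> (1/4) ^ k)"
    proof -
      have "\<exists>m>n. tail m \<le> (1/4) ^ k" for n k
      proof -
        have "\<forall>\<^sub>F m in sequentially. tail m < (1/4) ^ k"
          using tail0 by (intro order_tendstoD(2)) auto
        then have "\<forall>\<^sub>F m in sequentially. tail m < (1/4) ^ k \<and> m > n"
          using eventually_gt_at_top[of n] by eventually_elim auto
        then show ?thesis by (auto simp: eventually_sequentially intro: less_imp_le)
      qed
      then have "\<exists>r. \<forall>k. tail (r k) \<le> (1/4) ^ k \<and> r k < r (Suc k)"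
        using dependent_nat_choice[of "\<lambda>k m. tail m \<le> (1/4) ^ k" "\<lambda>k m m'. m < m'"] by meson
      then show ?thesis by (auto simp: strict_mono_Suc_iff)
    qed
    then obtain r where r: "strict_mono r" "\<And>k. tail (r k) \<le> (1/4) ^ k" by blast
    have st: "sqrt (tail (r k)) \<le> (1/2) ^ k" for k
    proof -
      have "sqrt (tail (r k)) \<le> sqrt ((1/4) ^ k)" using r(2) by (rule real_sqrt_le_mono)
      also have "\<dots> = (1/2) ^ k" by (simp add: real_sqrt_power real_sqrt_divide)
      finally show ?thesis .
    qed
    define x where "x k = P a (r (Suc k)) - P a (r k)" for k
    have xV: "x k \<in> V" for k unfolding x_def by (intro subspace_diff[OF V] PV)
    have Nx: "N (x k) \<le> C * (1/2) ^ k" for k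
    proof -
      have "N (x k) \<le> C * sqrt (tail (r k))"
        unfolding x_def using r(1) by (intro diff) (simp add: strict_mono_less_eq)
      also have "\<dots> \<le> C * (1/2) ^ k" using st C0 by (intro mult_left_mono)
      finally show ?thesis .
    qed
    have "summable (\<lambda>k. C * (1/2) ^ k)" by (intro summable_mult summable_geometric) simp
    from complete[OF xV Nx this]
    obtain z where z: "z \<in> V" "(\<lambda>m. N (z - (\<Sum>k<m. x k))) \<longlonglongrightarrow> 0" ..
    have sx: "(\<Sum>k<m. x k) = P a (r m) - P a (r 0)" for m
      unfolding x_def by (induction m) auto
    define y where "y = z + P a (r 0)"
    have yV: "y \<in> V" unfolding y_def by (intro subspace_add[OF V] z PV)
    have yr: "(\<lambda>m. N (y - P a (r m))) \<longlonglongrightarrow> 0"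
      using z(2) by (simp add: sx y_def algebra_simps)
    have "(\<lambda>n. N (y - P a n)) \<longlonglongrightarrow> 0"
      unfolding tendsto_iff
    proof (intro allI impI)
      fix e :: real assume e: "e > 0"
      have "(\<lambda>m. N (y - P a (r m)) + C * sqrt (tail (r m))) \<longlonglongrightarrow> 0 + C * sqrt 0"
        using LIMSEQ_subseq_LIMSEQ[OF tail0 r(1)] by (intro tendsto_intros yr) (simp add: comp_def)
      then have "\<forall>\<^sub>F m in sequentially. N (y - P a (r m)) + C * sqrt (tail (r m)) < e"
        using e by (intro order_tendstoD(2)) auto
      then obtain m where m: "N (y - P a (r m)) + C * sqrt (tail (r m)) < e"
        by (auto simp: eventually_sequentially)
      have "N (y - P a n) < e" if "r m \<le> n" for n
      proof -
        have "N (y - P a n) \<le> N (y - P a (r m)) + N (P a (r m) - P a n)" by (intro N_triangle yV PV)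
        also have "N (P a (r m) - P a n) \<le> C * sqrt (tail (r m))"
          using diff[OF that] N_commute[OF PV PV] by simp
        finally show ?thesis using m by simp
      qed
      moreover have "0 \<le> N (y - P a n)" for n by (intro N_nonneg subspace_diff[OF V] yV PV)
      ultimately show "\<forall>\<^sub>F n in sequentially. dist (N (y - P a n)) 0 < e"
        by (auto simp: eventually_sequentially)
    qed
    then show ?thesis using yV by blast
  qed
  then obtain U where U: "\<And>a. a \<in> l2 \<Longrightarrow> U a \<in> V" "\<And>a. a \<in> l2 \<Longrightarrow> (\<lambda>n. N (U a - P a n)) \<longlonglongrightarrow> 0"
    by metis
  have U_unique: "U a = y" if "a \<in> l2" "y \<in> V" "(\<lambda>n. N (y - P a n)) \<longlonglongrightarrow> 0" for a y
    by (rule limit_unique[OF U(1)[OF that(1)] that(2) PV U(2)[OF that(1)] that(3)])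
  have UY: "U a \<in> Y" if a: "a \<in> l2" for a
  proof (rule Ycl[OF U(1)[OF a]])
    fix e :: real assume "e > 0"
    then have "\<forall>\<^sub>F n in sequentially. N (U a - P a n) < e" using U(2)[OF a] by (intro order_tendstoD(2))
    then obtain n where "N (U a - P a n) < e" by (auto simp: eventually_sequentially)
    then show "\<exists>x\<in>Y. N (U a - x) < e" using PY by blast
  qed
  have U_add: "U (a + b) = U a + U b" if a: "a \<in> l2" "b \<in> l2" for a b
  proof (rule U_unique[OF l2_add[OF a] subspace_add[OF V U(1)[OF a(1)] U(1)[OF a(2)]]])
    have Pab: "P (a + b) n = P a n + P b n" for n
      by (simp add: P_def scale_left_distrib sum.distrib)
    have "N (U a + U b - P (a + b) n) \<le> N (U a - P a n) + N (U b - P b n)" for n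
      using N_add[of "U a - P a n" "U b - P b n"] subspace_diff[OF V U(1) PV] a
      by (simp add: Pab algebra_simps)
    moreover have "0 \<le> N (U a + U b - P (a + b) n)" for n
      by (intro N_nonneg subspace_diff[OF V] subspace_add[OF V] U(1) PV a)
    ultimately show "(\<lambda>n. N (U a + U b - P (a + b) n)) \<longlonglongrightarrow> 0"
      by (intro tendsto_sandwich[OF _ _ tendsto_const tendsto_add_zero[OF U(2)[OF a(1)] U(2)[OF a(2)]]]) auto
  qed
  have U_scale: "U (scale_linf d a) = s d (U a)" if a: "a \<in> l2" for d a
  proof (rule U_unique[OF l2_scale[OF a] subspace_scale[OF V U(1)[OF a]]])
    have "s d (U a) - P (scale_linf d a) n = s d (U a - P a n)" for n
      by (simp add: P_def scale_right_diff_distrib scale_sum_right)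
    then have "N (s d (U a) - P (scale_linf d a) n) = cmod d * N (U a - P a n)" for n
      using N_scale[OF subspace_diff[OF V U(1)[OF a] PV]] by simp
    then show "(\<lambda>n. N (s d (U a) - P (scale_linf d a) n)) \<longlonglongrightarrow> 0"
      using tendsto_mult_left[OF U(2)[OF a], of "cmod d"] by simp
  qed
  have U_up: "N (U a) \<le> C * l2_norm a" if a: "a \<in> l2" for a
  proof -
    have "N (U a) \<le> N (U a - P a n) + C * l2_norm a" for n
    proof -
      have "N (U a) \<le> N (U a - P a n) + N (P a n)"
        using N_add[OF subspace_diff[OF V U(1)[OF a] PV[of a n]] PV[of a n]] by simp
      also have "N (P a n) \<le> C * sqrt (\<Sum>j<n. (cmod (apply_bcontfun a j))\<^sup>2)"
        unfolding P_def by (rule up)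
      also have "\<dots> \<le> C * l2_norm a" using l2_norm_partial(2)[OF a] C0 by (intro mult_left_mono)
      finally show ?thesis by simp
    qed
    moreover have "(\<lambda>n. N (U a - P a n) + C * l2_norm a) \<longlonglongrightarrow> 0 + C * l2_norm a"
      by (intro tendsto_intros U(2)[OF a])
    ultimately show ?thesis using LIMSEQ_le_const by fastforce
  qed
  have U_low: "c * l2_norm a \<le> N (U a)" if a: "a \<in> l2" for a
  proof -
    have "c * sqrt (\<Sum>j<n. (cmod (apply_bcontfun a j))\<^sup>2) \<le> N (U a) + N (U a - P a n)" for n
    proof -
      have "c * sqrt (\<Sum>j<n. (cmod (apply_bcontfun a j))\<^sup>2) \<le> N (P a n)" unfolding P_def by (rule low)
      also have "\<dots> \<le> N (U a) + N (U a - P a n)"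
        using N_diff[OF U(1)[OF a] subspace_diff[OF V U(1)[OF a] PV[of a n]]] by simp
      finally show ?thesis .
    qed
    moreover have "(\<lambda>n. c * sqrt (\<Sum>j<n. (cmod (apply_bcontfun a j))\<^sup>2)) \<longlonglongrightarrow> c * l2_norm a"
      by (intro tendsto_mult_left l2_norm_partial(1)[OF a])
    moreover have "(\<lambda>n. N (U a) + N (U a - P a n)) \<longlonglongrightarrow> N (U a) + 0"
      by (intro tendsto_intros U(2)[OF a])
    ultimately have "c * l2_norm a \<le> N (U a) + 0" by (intro LIMSEQ_le) auto
    then show ?thesis by simp
  qed
  have "inj_on U l2"
  proof (rule inj_onI)
    fix a b assume ab: "a \<in> l2" "b \<in> l2" "U a = U b"
    have m: "scale_linf (-1) b \<in> l2" by (rule l2_scale[OF ab(2)])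
    have d: "a + scale_linf (-1) b \<in> l2" by (rule l2_add[OF ab(1) m])
    have "U (a + scale_linf (-1) b) = 0"
      using ab U_add[OF ab(1) m] U_scale[OF ab(2), of "-1"] by simp
    then have "c * l2_norm (a + scale_linf (-1) b) \<le> 0"
      using U_low[OF d] N_scale[OF subspace_0[OF V], of 0] by simp
    moreover have "l2_norm (a + scale_linf (-1) b) \<ge> 0"
      unfolding l2_norm_def using d by (intro real_sqrt_ge_zero suminf_nonneg) (auto simp: l2_def)
    ultimately have "l2_norm (a + scale_linf (-1) b) = 0"
      using \<open>c > 0\<close> by (simp add: mult_le_0_iff)
    then have z: "a + scale_linf (-1) b = 0" by (rule l2_norm_eq_0[OF d])
    show "a = b"
    proof (rule bcontfun_eqI)
      fix n
      have "apply_bcontfun (a + scale_linf (-1) b) n = 0" unfolding z by simp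
      then show "apply_bcontfun a n = apply_bcontfun b n" by simp
    qed
  qed
  then have "bij_betw U l2 (U ` l2)" by (simp add: bij_betw_def)
  moreover have "l2_norm a \<le> (1 / c) * N (U a)" if "a \<in> l2" for a
    using U_low[OF that] \<open>c > 0\<close> by (simp add: field_simps)
  ultimately have "isomorphic_spaces scale_linf l2 l2_norm s (U ` l2) N"
    unfolding isomorphic_spaces_def using U_add U_scale U_up by blast
  moreover have "subspace (U ` l2)"
    unfolding subspace_def
  proof (intro conjI ballI allI)
    have "U (scale_linf 0 0) = s 0 (U 0)" by (rule U_scale[OF l2_zero])
    then have "U 0 = 0" by simp
    then show "0 \<in> U ` l2" using l2_zero by force
    fix x y assume "x \<in> U ` l2" "y \<in> U ` l2"
    then obtain a b where "a \<in> l2" "b \<in> l2" "x = U a" "y = U b" by blast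
    then show "x + y \<in> U ` l2" using U_add[of a b] l2_add[of a b] by (metis imageI)
  next
    fix d x assume "x \<in> U ` l2"
    then obtain a where "a \<in> l2" "x = U a" by blast
    then show "s d x \<in> U ` l2" using U_scale[of a d] l2_scale[of a d] by (metis imageI)
  qed
  ultimately show ?thesis using UY by blast
qed

end

text \<open>A functional lowers the dimension by at most one: a finite set spanning the kernel,
  together with one vector outside the kernel, would span everything.\<close>

lemma infinite_dimensional_kernels:
  assumes "vector_space s" and Y: "module.subspace s Y" "infinite_dimensional s Y"
    and "finite I" and add: "\<And>i x y. x \<in> Y \<Longrightarrow> y \<in> Y \<Longrightarrow> p i (x + y) = p i x + p i y"
    and scale: "\<And>i c x. x \<in> Y \<Longrightarrow> p i (s c x) = c * p i x"
  shows "module.subspace s {y\<in>Y. \<forall>i\<in>I. p i y = (0 :: complex)} \<and>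
    infinite_dimensional s {y\<in>Y. \<forall>i\<in>I. p i y = 0}"
proof -
  interpret vector_space s by fact
  have sub: "subspace {y\<in>Y. \<forall>i\<in>I. p i y = 0}" for I
  proof -
    have "p i 0 = 0" for i using scale[of 0 i 0] subspace_0[OF Y(1)] by simp
    then show ?thesis
      using Y(1) add scale by (auto simp: subspace_def)
  qed
  have "infinite_dimensional s {y\<in>Y. \<forall>i\<in>I. p i y = 0}"
    using \<open>finite I\<close>
  proof (induction I)
    case (insert i I)
    let ?Z = "{y\<in>Y. \<forall>i\<in>I. p i y = 0}" and ?Z' = "{y\<in>Y. \<forall>j\<in>insert i I. p j y = 0}"
    show ?case
    proof (rule ccontr)
      assume "\<not> infinite_dimensional s ?Z'"
      then obtain B where B: "finite B" "?Z' \<subseteq> span B" by (auto simp: infinite_dimensional_def)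
      have "\<exists>B'. finite B' \<and> ?Z \<subseteq> span B'"
      proof (cases "\<exists>z\<in>?Z. p i z \<noteq> 0")
        case True
        then obtain z where z: "z \<in> ?Z" "p i z \<noteq> 0" by blast
        have "y \<in> span (insert z B)" if y: "y \<in> ?Z" for y
        proof -
          let ?c = "p i y / p i z"
          have zc: "s (- ?c) z \<in> ?Z" by (rule subspace_scale[OF sub z(1)])
          have "y + s (- ?c) z \<in> ?Z" by (rule subspace_add[OF sub y zc])
          moreover have "p i (y + s (- ?c) z) = 0"
            using add[of y "s (- ?c) z" i] scale[of z i "- ?c"] y z zc by simp
          ultimately have "y + s (- ?c) z \<in> ?Z'" by auto
          then have "y + s (- ?c) z \<in> span (insert z B)" using B(2) span_mono[of B "insert z B"] by blast
          moreover have "s ?c z \<in> span (insert z B)" by (intro span_scale span_base) simp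
          ultimately have "(y + s (- ?c) z) + s ?c z \<in> span (insert z B)" by (rule span_add)
          then show ?thesis by simp
        qed
        then show ?thesis using B(1) by (intro exI[of _ "insert z B"]) auto
      next
        case False
        then have "?Z \<subseteq> ?Z'" by auto
        then have "?Z \<subseteq> span B" using B(2) by (rule subset_trans)
        then show ?thesis using B(1) by (intro exI[of _ B] conjI)
      qed
      then show False using insert.IH by (simp add: infinite_dimensional_def)
    qed
  qed (use Y in simp)
  with sub show ?thesis by (rule conjI)
qed

section \<open>Hereditarily Hilbertian jet spaces\<close>

text \<open>A common frame for \<open>Delta\<close>, \<open>Delta2\<close> and
  \<open>Delta3\<close>: \<open>A\<close> holds the orders recorded by \<open>T\<close>, in whatever
  arrangement, and \<open>B\<close> the orders required to vanish.\<close>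

locale delta_map = vector_space s
  for s :: "complex \<Rightarrow> 'v::ab_group_add \<Rightarrow> 'v" +
  fixes T :: "(complex \<Rightarrow> linf) \<Rightarrow> 'v" and A B :: "nat set"
  assumes T_add: "F \<in> calderon \<Longrightarrow> G \<in> calderon \<Longrightarrow> T (F + G) = T F + T G"
    and T_scale: "F \<in> calderon \<Longrightarrow> T (scale_fun c F) = s c (T F)"
    and T_eq: "T F = T G \<longleftrightarrow> agree A F G"
    and A: "A \<subseteq> {0, 1, 2}" "A \<noteq> {}" and B: "B \<subseteq> {0, 1, 2}"
begin

abbreviation "K \<equiv> ker_all B"
abbreviation "M \<equiv> A \<union> B"
abbreviation "N \<equiv> quotient_norm T K"

lemma M2: "M \<subseteq> {..2}" "k \<in> M \<Longrightarrow> k \<le> 2" "B \<subseteq> {..2}"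
  using A B by auto

lemma kerD: "F \<in> K \<Longrightarrow> F \<in> calderon" "F \<in> K \<Longrightarrow> b \<in> B \<Longrightarrow> Delta b F = 0"
  by (auto simp: ker_all_def)

lemma K_subspace: "fs.subspace K"
  by (rule subspace_ker_all[OF M2(3)])

lemma qn_K: "fs.seminorm_on K (qn M)"
  by (rule seminorm_ker_all[OF M2(3,1)])

text \<open>A function that agrees with \<open>F\<close> on \<open>A \<union> B\<close> satisfies
  the vanishing conditions automatically, so both infima run over the same functions. This is the
  isometric embedding into the space without conditions.\<close>

lemma N_T:
  assumes F: "F \<in> K"
  shows "N (T F) = qn M F"
proof -
  have "G \<in> K \<and> T G = T F \<longleftrightarrow> G \<in> calderon \<and> agree M G F" for G
    using F unfolding T_eq by (auto simp: agree_def ker_all_def)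
  then have "{calderon_norm G |G. G \<in> K \<and> T G = T F} = {calderon_norm G |G. G \<in> calderon \<and> agree M G F}"
    by blast
  then show ?thesis unfolding quotient_norm_def qn_def by (rule arg_cong)
qed

lemma T_zero: "T 0 = 0"
  using T_scale[OF calderon_zero, of 0] by simp

lemma T_sum: "(\<And>i. i \<in> I \<Longrightarrow> F i \<in> calderon) \<Longrightarrow> T (\<Sum>i\<in>I. F i) = (\<Sum>i\<in>I. T (F i))"
  by (induction I rule: infinite_finite_induct) (auto simp: T_zero T_add calderon_sum)

lemma T_minus: "F \<in> calderon \<Longrightarrow> T (- F) = - T F"
  using T_scale[of F "-1"] by simp

lemma T_diff: "F \<in> calderon \<Longrightarrow> G \<in> calderon \<Longrightarrow> T (F - G) = T F - T G"
  using T_add[of F "- G"] T_minus[of G] fs.subspace_neg[OF subspace_calderon, of G] by simp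

lemma Delta_zero: "k \<le> 2 \<Longrightarrow> Delta k 0 = 0"
  using Delta_scale[OF calderon_zero, of k 0] by simp

lemma Delta_neg: "F \<in> calderon \<Longrightarrow> k \<le> 2 \<Longrightarrow> Delta k (- F) = - Delta k F"
  using Delta_scale[of F k "-1"] by (auto intro!: bcontfun_eqI)

lemma Delta_diff: "F \<in> calderon \<Longrightarrow> G \<in> calderon \<Longrightarrow> k \<le> 2 \<Longrightarrow> Delta k (F - G) = Delta k F - Delta k G"
  using Delta_add[of F "- G" k] Delta_neg[of G k] fs.subspace_neg[OF subspace_calderon, of G] by simp

lemma T_eq_0: "T F = 0 \<longleftrightarrow> (\<forall>k\<in>A. Delta k F = 0)"
  using T_eq[of F 0] A Delta_zero unfolding T_zero agree_def by (metis M2(2) UnI1)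

lemma image_subspace:
  assumes "fs.subspace W" "W \<subseteq> calderon"
  shows "subspace (T ` W)"
proof -
  have 0: "0 \<in> W" by (rule fs.subspace_0[OF assms(1)])
  show ?thesis
    unfolding subspace_def
  proof (intro conjI ballI allI)
    show "0 \<in> T ` W" using 0 T_zero by force
    fix x y assume "x \<in> T ` W" "y \<in> T ` W"
    then obtain F G where "F \<in> W" "G \<in> W" "x = T F" "y = T G" by blast
    then show "x + y \<in> T ` W"
      using T_add[of F G] fs.subspace_add[OF assms(1), of F G] assms(2) by (metis imageI subsetD)
  next
    fix c x assume "x \<in> T ` W"
    then obtain F where "F \<in> W" "x = T F" by blast
    then show "s c x \<in> T ` W"
      using T_scale[of F c] fs.subspace_scale[OF assms(1), of F c] assms(2) by (metis imageI subsetD)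
  qed
qed

text \<open>An absolutely convergent series is lifted with error (1/2)^k in the k-th term, summed in
  the Calderon space and mapped down again. The sum stays in \<open>K\<close> because each Delta is
  continuous coordinatewise.\<close>

lemma complete_normed_image: "complete_normed s (T ` K) N"
proof (unfold_locales)
  have KC: "K \<subseteq> calderon" using kerD by blast
  show "subspace (T ` K)" by (rule image_subspace[OF K_subspace KC])
  show "N (x + y) \<le> N x + N y" if xy: "x \<in> T ` K" "y \<in> T ` K" for x y
  proof -
    obtain F G where FG: "F \<in> K" "G \<in> K" "x = T F" "y = T G" using xy by blast
    have "x + y = T (F + G)" using FG kerD by (simp add: T_add)
    then show ?thesis
      using fs.seminorm_add[OF qn_K FG(1,2)] FG fs.subspace_add[OF K_subspace FG(1,2)]
      by (simp add: N_T)
  qed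
  show "N (s c x) = cmod c * N x" if x: "x \<in> T ` K" for c x
  proof -
    obtain F where F: "F \<in> K" "x = T F" using x by blast
    have "s c x = T (scale_fun c F)" using F kerD by (simp add: T_scale)
    then show ?thesis
      using fs.seminorm_scale[OF qn_K F(1)] F fs.subspace_scale[OF K_subspace F(1)] by (simp add: N_T)
  qed
  show "0 \<le> N x" if "x \<in> T ` K" for x
    using that N_T fs.seminorm_nonneg[OF qn_K] by auto
  show "x = 0" if x: "x \<in> T ` K" "N x = 0" for x
  proof -
    obtain F where F: "F \<in> K" "x = T F" using x(1) by blast
    have "Delta k F = 0" if k: "k \<in> A" for k
    proof (rule bcontfun_eqI)
      fix n
      show "apply_bcontfun (Delta k F) n = apply_bcontfun 0 n"
        using apply_Delta_le_qn[OF kerD(1)[OF F(1)], of k M n] k M2(2) x(2) F by (simp add: N_T)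
    qed
    then show ?thesis using T_eq_0 F by simp
  qed
  fix f :: "nat \<Rightarrow> 'v" and b :: "nat \<Rightarrow> real"
  assume f: "\<And>k. f k \<in> T ` K" "\<And>k. N (f k) \<le> b k" "summable b"
  have "\<exists>G\<in>K. T G = f k \<and> calderon_norm G \<le> b k + (1/2) ^ k" for k
  proof -
    obtain F where F: "F \<in> K" "f k = T F" using f(1)[of k] by blast
    obtain G where G: "G \<in> calderon" "agree M G F" "calderon_norm G < qn M F + (1/2) ^ k"
      using qn_approx[OF kerD(1)[OF F(1)], of "(1/2) ^ k"] by auto
    have "G \<in> K" using G F by (auto simp: ker_all_def agree_def)
    moreover have "T G = f k" unfolding F(2) T_eq using G(2) by (auto simp: agree_def)
    moreover have "calderon_norm G \<le> b k + (1/2) ^ k" using G(3) f(2)[of k] F by (simp add: N_T)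
    ultimately show ?thesis by blast
  qed
  then obtain G where G: "\<And>k. G k \<in> K" "\<And>k. T (G k) = f k" "\<And>k. calderon_norm (G k) \<le> b k + (1/2) ^ k"
    by metis
  have "summable (\<lambda>k. b k + (1/2) ^ k)" using f(3) by (intro summable_add summable_geometric) auto
  then obtain H where H: "H \<in> calderon" "(\<lambda>m. calderon_norm (H - (\<Sum>k<m. G k))) \<longlonglongrightarrow> 0"
    using calderon_series[of G "\<lambda>k. b k + (1/2) ^ k"] G kerD(1) by blast
  have S: "(\<Sum>k<m. G k) \<in> K" for m using G(1) by (intro fs.subspace_sum[OF K_subspace])
  have D: "H - (\<Sum>k<m. G k) \<in> calderon" for m by (intro calderon_minus H kerD(1) S)
  have "Delta j H = 0" if j: "j \<in> B" for j
  proof (rule bcontfun_eqI)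
    fix n
    have j2: "j \<le> 2" using j M2(3) by auto
    have "cmod (apply_bcontfun (Delta j H) n) \<le> 16 * calderon_norm (H - (\<Sum>k<m. G k))" for m
      using norm_Delta_le[OF D j2, of m n] Delta_diff[OF H(1) kerD(1)[OF S] j2, of m] kerD(2)[OF S j, of m] by simp
    moreover have "(\<lambda>m. 16 * calderon_norm (H - (\<Sum>k<m. G k))) \<longlonglongrightarrow> 16 * 0"
      by (intro tendsto_mult_left H(2))
    ultimately have "cmod (apply_bcontfun (Delta j H) n) \<le> 16 * 0" using LIMSEQ_le_const by blast
    then show "apply_bcontfun (Delta j H) n = apply_bcontfun 0 n" by simp
  qed
  then have HK: "H \<in> K" using H(1) by (simp add: ker_all_def)
  have DK: "H - (\<Sum>k<m. G k) \<in> K" for m by (intro fs.subspace_diff[OF K_subspace] HK S)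
  have e: "T H - (\<Sum>k<m. f k) = T (H - (\<Sum>k<m. G k))" for m
    using kerD(1) G(1) by (simp add: T_diff[OF H(1) kerD(1)[OF S]] T_sum G(2))
  have "(\<lambda>m. N (T H - (\<Sum>k<m. f k))) \<longlonglongrightarrow> 0"
  proof (rule tendsto_sandwich[OF _ _ tendsto_const H(2)])
    show "\<forall>\<^sub>F m in sequentially. 0 \<le> N (T H - (\<Sum>k<m. f k))"
      unfolding e N_T[OF DK] using fs.seminorm_nonneg[OF qn_K DK] by simp
    show "\<forall>\<^sub>F m in sequentially. N (T H - (\<Sum>k<m. f k)) \<le> calderon_norm (H - (\<Sum>k<m. G k))"
      unfolding e N_T[OF DK] by (intro always_eventually allI qn_le D) (simp add: agree_def)
  qed
  then show "\<exists>l\<in>T ` K. (\<lambda>m. N (l - (\<Sum>k<m. f k))) \<longlonglongrightarrow> 0" using HK by blast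
qed

text \<open>Vanishing of the first \<open>m\<close> entries of the recorded Delta amounts to
  finitely many linear conditions on \<open>Y\<close>, so an infinite-dimensional \<open>Y\<close>
  contains a nonzero solution.\<close>

lemma exists_high_vector:
  assumes Y: "subspace Y" "Y \<subseteq> T ` K" "infinite_dimensional s Y"
  obtains F where "F \<in> K" "T F \<in> Y" "qn M F = 1" "\<And>k n. k \<in> M \<Longrightarrow> n < m \<Longrightarrow> apply_bcontfun (Delta k F) n = 0"
proof -
  \<comment> \<open>Preimages are chosen only to define functionals on \<open>Y\<close>; for orders
    in \<open>A\<close> their values do not depend on the choice.\<close>
  define rep where "rep y = (SOME F. F \<in> K \<and> T F = y)" for y
  have rep: "rep y \<in> K" "T (rep y) = y" if "y \<in> Y" for y
    unfolding rep_def using someI_ex[of "\<lambda>F. F \<in> K \<and> T F = y"] that Y(2) by auto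
  define p where "p i y = apply_bcontfun (Delta (fst i) (rep y)) (snd i)" for i y
  let ?I = "A \<times> {..<m}"
  have p: "p i (T F) = apply_bcontfun (Delta (fst i) F) (snd i)" if "i \<in> ?I" "F \<in> K" "T F \<in> Y" for i F
    using rep[OF that(3)] that(1) T_eq[of "rep (T F)" F] by (auto simp: p_def agree_def)
  have fin: "finite ?I" using A finite_subset[OF A(1)] by simp
  \<comment> \<open>Set to 0 outside \<open>?I\<close>, where the value may depend on the preimage,
    since \<open>infinite_dimensional_kernels\<close> demands linearity for every index.\<close>
  let ?q = "\<lambda>i y. if i \<in> ?I then p i y else 0"
  have "subspace {y\<in>Y. \<forall>i\<in>?I. ?q i y = 0} \<and> infinite_dimensional s {y\<in>Y. \<forall>i\<in>?I. ?q i y = 0}"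
  proof (rule infinite_dimensional_kernels[OF vector_space_axioms Y(1,3) fin])
    fix i x y assume xy: "x \<in> Y" "y \<in> Y"
    have "T (rep x + rep y) = x + y" using rep[OF xy(1)] rep[OF xy(2)] kerD(1) by (simp add: T_add)
    moreover have "rep x + rep y \<in> K" by (intro fs.subspace_add[OF K_subspace] rep xy)
    ultimately show "?q i (x + y) = ?q i x + ?q i y"
      using p[of i "rep x + rep y"] subspace_add[OF Y(1) xy] Delta_add[OF kerD(1)[OF rep(1)[OF xy(1)]] kerD(1)[OF rep(1)[OF xy(2)]]]
        M2(2)[of "fst i"] by (auto simp: p_def)
  next
    fix i c x assume x: "x \<in> Y"
    have "T (scale_fun c (rep x)) = s c x" using rep[OF x] kerD(1) by (simp add: T_scale)
    moreover have "scale_fun c (rep x) \<in> K" by (intro fs.subspace_scale[OF K_subspace] rep x)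
    ultimately show "?q i (s c x) = c * ?q i x"
      using p[of i "scale_fun c (rep x)"] subspace_scale[OF Y(1) x] Delta_scale[OF kerD(1)[OF rep(1)[OF x]]]
        M2(2)[of "fst i"] by (auto simp: p_def)
  qed
  then have "infinite_dimensional s {y\<in>Y. \<forall>i\<in>?I. ?q i y = 0}" ..
  then have "\<not> {y\<in>Y. \<forall>i\<in>?I. ?q i y = 0} \<subseteq> span {}"
    unfolding infinite_dimensional_def by blast
  then obtain y where y: "y \<in> Y" "\<And>i. i \<in> ?I \<Longrightarrow> p i y = 0" "y \<noteq> 0" by auto
  let ?F = "rep y"
  have F: "?F \<in> K" "T ?F = y" using rep[OF y(1)] by auto
  have high: "apply_bcontfun (Delta k ?F) n = 0" if k: "k \<in> M" "n < m" for k n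
  proof (cases "k \<in> A")
    case True
    then show ?thesis using y(2)[of "(k, n)"] k by (simp add: p_def)
  next
    case False
    then show ?thesis using kerD(2)[OF F(1)] k by auto
  qed
  obtain k where k: "k \<in> A" "Delta k ?F \<noteq> 0" using T_eq_0[of ?F] F(2) y(3) by auto
  then obtain n where n: "apply_bcontfun (Delta k ?F) n \<noteq> 0"
    by (metis bcontfun_eqI zero_bcontfun.rep_eq)
  have "0 < cmod (apply_bcontfun (Delta k ?F) n)" using n by simp
  also have "\<dots> \<le> 16 * qn M ?F" using k by (intro apply_Delta_le_qn kerD F M2) auto
  finally have pos: "0 < qn M ?F" by simp
  let ?c = "complex_of_real (1 / qn M ?F)"
  show ?thesis
  proof (rule that[of "scale_fun ?c ?F"])
    show "scale_fun ?c ?F \<in> K" by (rule fs.subspace_scale[OF K_subspace F(1)])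
    show "T (scale_fun ?c ?F) \<in> Y"
      unfolding T_scale[OF kerD(1)[OF F(1)]] F(2) by (rule subspace_scale[OF Y(1) y(1)])
    show "qn M (scale_fun ?c ?F) = 1"
      unfolding fs.seminorm_scale[OF qn_K F(1)] using pos by (simp add: norm_divide)
    show "apply_bcontfun (Delta k (scale_fun ?c ?F)) n = 0" if "k \<in> M" "n < m" for k n
      using high[OF that] Delta_scale[OF kerD(1)[OF F(1)] M2(2)[OF that(1)]] by simp
  qed
qed

text \<open>Restricting a tail further does not increase the seminorm, so the starting point can be
  moved beyond \<open>m\<close>.\<close>

lemma small_tail:
  assumes F: "F \<in> K" and e: "e > 0"
  obtains m' where "m' > m" "qn M (rst_fun {m'..} F) \<le> e"
proof -
  obtain l G where G: "G \<in> calderon" "calderon_norm G \<le> e" "\<And>k. k \<le> 2 \<Longrightarrow> Delta k G = Delta k (rst_fun {l..} F)"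
    using tail_representative[OF kerD(1)[OF F] e] by blast
  let ?m = "max l (Suc m)"
  have "rst_fun {?m..} F = rst_fun {?m..} (rst_fun {l..} F)"
  proof -
    have "{?m..} \<inter> {l..} = {?m..}" by auto
    then show ?thesis unfolding fs.R_R by simp
  qed
  then have "qn M (rst_fun {?m..} F) \<le> qn M (rst_fun {l..} F)"
    using fs.seminorm_R[OF qn_K fs.seminorm_R(1)[OF qn_K F]] by simp
  also have "\<dots> \<le> calderon_norm G" using G M2(2) by (intro qn_le) (auto simp: agree_def)
  also have "\<dots> \<le> e" by (rule G(2))
  finally show ?thesis by (intro that[of ?m]) auto
qed

text \<open>The functions \<open>F i\<close> map into \<open>Y\<close> but are only approximately
  blocks; their middle parts \<open>k i\<close> are blocks but need not map into \<open>Y\<close>.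
  The \<ell>_2 sequence is found among blocks of the \<open>k i\<close> and transferred by
  perturbation to the \<open>F i\<close>.\<close>

theorem hereditarily_l2_image: "image_hereditarily_l2 s T K"
  unfolding image_hereditarily_l2_def hereditarily_l2_def
proof (intro allI impI, elim conjE)
  fix Y assume cY: "closed_subspace s (T ` K) N Y" and iY: "infinite_dimensional s Y"
  have Y: "subspace Y" "Y \<subseteq> T ` K" using cY by (auto simp: closed_subspace_def)
  let ?good = "\<lambda>m F m'. F \<in> K \<and> T F \<in> Y \<and> qn M F = 1 \<and>
    (\<forall>k\<in>M. \<forall>n<m. apply_bcontfun (Delta k F) n = 0) \<and> m < m'"
  let ?P = "\<lambda>i (m, F, m'). ?good m F m' \<and> qn M (rst_fun {m'..} F) \<le> (1/2) ^ (i + 1)"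
  have ex: "\<exists>F m'. ?P i (m, F, m')" for i m
  proof -
    obtain F where F: "F \<in> K" "T F \<in> Y" "qn M F = 1"
      "\<And>k n. k \<in> M \<Longrightarrow> n < m \<Longrightarrow> apply_bcontfun (Delta k F) n = 0"
      using exists_high_vector[OF Y iY, of m] by blast
    obtain m' where "m' > m" "qn M (rst_fun {m'..} F) \<le> (1/2) ^ (i + 1)"
      using small_tail[OF F(1), of "(1/2) ^ (i + 1)" m] by auto
    then show ?thesis using F by auto
  qed
  have "\<exists>g. \<forall>i. ?P i (g i) \<and> fst (g (Suc i)) = snd (snd (g i))"
  proof (rule dependent_nat_choice)
    show "\<exists>t. ?P 0 t" using ex[of 0 0] by blast
    fix t i
    obtain F m' where "?P (Suc i) (snd (snd t), F, m')" using ex by blast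
    then show "\<exists>t'. ?P (Suc i) t' \<and> fst t' = snd (snd t)"
      by (intro exI[of _ "(snd (snd t), F, m')"]) auto
  qed
  then obtain g where "\<forall>i. ?P i (g i) \<and> fst (g (Suc i)) = snd (snd (g i))" by (rule exE)
  then have g: "?P i (g i)" "fst (g (Suc i)) = snd (snd (g i))" for i by simp_all
  define m F where "m i = fst (g i)" and "F i = fst (snd (g i))" for i
  have mF: "F i \<in> K" "T (F i) \<in> Y" "qn M (F i) = 1" "m i < m (Suc i)"
    "\<And>k n. k \<in> M \<Longrightarrow> n < m i \<Longrightarrow> apply_bcontfun (Delta k (F i)) n = 0"
    "qn M (rst_fun {m (Suc i)..} (F i)) \<le> (1/2) ^ (i + 1)" for i
    using g(1)[of i] g(2)[of i] by (auto simp: m_def F_def split: prod.splits)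
  have sm: "strict_mono m" using mF(4) by (simp add: strict_mono_Suc_iff)
  define k where "k i = rst_fun {m i..<m (Suc i)} (F i)" for i
  have kK: "k i \<in> K" for i unfolding k_def by (rule fs.seminorm_R(1)[OF qn_K mF(1)])
  have kR: "rst_fun {m i..<m (Suc i)} (k i) = k i" for i unfolding k_def fs.R_R by simp
  have FkK: "F i - k i \<in> K" for i by (rule fs.subspace_diff[OF K_subspace mF(1) kK])
  have close: "qn M (F i - k i) \<le> (1/2) ^ (i + 1)" for i
  proof -
    \<comment> \<open>The two functions may differ below \<open>m i\<close>, but there the Delta of
      orders in \<open>M\<close> vanish, and \<open>qn M\<close> sees nothing else.\<close>
    have "agree M (F i - k i) (rst_fun {m (Suc i)..} (F i))"
      unfolding agree_def
    proof
      fix j assume j: "j \<in> M"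
      show "Delta j (F i - k i) = Delta j (rst_fun {m (Suc i)..} (F i))"
      proof (rule bcontfun_eqI)
        fix n
        have "Delta j (k i) = rst {m i..<m (Suc i)} (Delta j (F i))"
          unfolding k_def by (rule Delta_rst[OF kerD(1)[OF mF(1)] M2(2)[OF j]])
        then have e: "Delta j (F i - k i) = Delta j (F i) - rst {m i..<m (Suc i)} (Delta j (F i))"
          using Delta_diff[OF kerD(1)[OF mF(1)] kerD(1)[OF kK] M2(2)[OF j]] by simp
        show "apply_bcontfun (Delta j (F i - k i)) n = apply_bcontfun (Delta j (rst_fun {m (Suc i)..} (F i))) n"
          unfolding e Delta_rst[OF kerD(1)[OF mF(1)] M2(2)[OF j]]
          using mF(4)[of i] mF(5)[OF j, of n i] by (cases "n < m i") auto
      qed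
    qed
    from qn_cong[OF this] show ?thesis using mF(6)[of i] by simp
  qed
  have khalf: "qn M (k i) \<ge> 1/2" for i
  proof -
    have "qn M (F i) \<le> qn M (k i) + qn M (F i - k i)"
      using fs.seminorm_add[OF qn_K kK[of i] FkK[of i]] by simp
    moreover have "(1/2::real) ^ (i + 1) \<le> 1/2" using power_decreasing[of 1 "i + 1" "1/2::real"] by simp
    ultimately show ?thesis using mF(3)[of i] close[of i] by linarith
  qed
  have kb: "fs.blocks K k" unfolding fs.blocks_def using sm kK kR by blast
  have "fs.l2_block_property calderon (qn M)"
    using A B by (intro block_property_calderon) auto
  moreover have "fs.blocks calderon k" unfolding fs.blocks_def using sm kerD(1)[OF kK] kR by blast
  moreover have "qn M (k i) > 0" for i using khalf[of i] by linarith
  ultimately obtain v' where v': "fs.sub_blocks k v'" "fs.l2_basis (qn M) v'"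
    unfolding fs.l2_block_property_def by blast
  have cl: "qn M (F i - k i) \<le> (1/2) ^ i" for i
    using close[of i] by (rule order_trans) simp
  obtain w where w: "fs.sub_blocks F w" "fs.l2_basis (qn M) w"
    by (rule fs.l2_perturbation[OF qn_K kb khalf mF(1) cl v'])
  \<comment> \<open>The vectors \<open>w j\<close> are finite combinations of the
    \<open>F i\<close>, all of which lie in this subspace.\<close>
  have "fs.subspace {G \<in> K. T G \<in> Y}"
    using K_subspace Y(1) kerD(1) unfolding fs.subspace_def subspace_def by (auto simp: T_zero T_add T_scale)
  then have wK: "w j \<in> K" "T (w j) \<in> Y" for j
    using fs.sub_blocks_in[of "{G \<in> K. T G \<in> Y}" F w j] mF(1,2) w(1) by auto
  obtain c C where c: "c > 0" and cC: "fs.l2_bounds c C (qn M) w"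
    using w(2) by (auto simp: fs.l2_basis_def)
  have sw: "N (\<Sum>j<n. s (a j) (T (w j))) = qn M (\<Sum>j<n. scale_fun (a j) (w j))" for a n
  proof -
    have "(\<Sum>j<n. scale_fun (a j) (w j)) \<in> K"
      by (intro fs.subspace_sum[OF K_subspace] fs.subspace_scale[OF K_subspace] wK)
    moreover have "T (\<Sum>j<n. scale_fun (a j) (w j)) = (\<Sum>j<n. s (a j) (T (w j)))"
      using kerD(1)[OF wK(1)] by (simp add: T_sum T_scale calderon_scale)
    ultimately show ?thesis using N_T by metis
  qed
  show "\<exists>Z. subspace Z \<and> Z \<subseteq> Y \<and> isomorphic_spaces scale_linf l2 l2_norm s Z N"
  proof (rule complete_normed.l2_embedding[OF complete_normed_image cY wK(2) c])
    show "c * sqrt (\<Sum>j<n. (cmod (a j))\<^sup>2) \<le> N (\<Sum>j<n. s (a j) (T (w j)))"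
      "N (\<Sum>j<n. s (a j) (T (w j))) \<le> C * sqrt (\<Sum>j<n. (cmod (a j))\<^sup>2)" for a n
      using cC unfolding sw fs.l2_bounds_def by blast+
  qed
qed

end

section \<open>Complex structure on pairs and triples\<close>

lemma vector_space_scale_linf2: "vector_space scale_linf2"
proof -
  interpret vector_space_prod scale_linf scale_linf
    by (intro vector_space_prod.intro vector_space_pair.intro vector_space_scale_linf)
  show ?thesis by (rule p.vector_space_axioms)
qed

lemma vector_space_scale_linf3: "vector_space scale_linf3"
proof -
  interpret vector_space_prod scale_linf scale_linf2
    by (intro vector_space_prod.intro vector_space_pair.intro vector_space_scale_linf vector_space_scale_linf2)
  show ?thesis by (rule p.vector_space_axioms)
qed

lemma scale_linf2_Pair: "scale_linf2 c (x, y) = (scale_linf c x, scale_linf c y)"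
proof -
  interpret vector_space_prod scale_linf scale_linf
    by (intro vector_space_prod.intro vector_space_pair.intro vector_space_scale_linf)
  show ?thesis by (rule scale_prod)
qed

lemma scale_linf3_Pair: "scale_linf3 c (x, y, z) = (scale_linf c x, scale_linf c y, scale_linf c z)"
proof -
  interpret vector_space_prod scale_linf scale_linf2
    by (intro vector_space_prod.intro vector_space_pair.intro vector_space_scale_linf vector_space_scale_linf2)
  show ?thesis by (simp add: scale_prod scale_linf2_Pair)
qed

lemma hereditarily_l2_Delta:
  assumes "a \<in> {0, 1, 2}" "B \<subseteq> {0, 1, 2}"
  shows "image_hereditarily_l2 scale_linf (Delta a) (ker_all B)"
proof -
  have a: "a \<le> 2" using assms by auto
  have "delta_map scale_linf (Delta a) {a} B"
    by (intro delta_map.intro delta_map_axioms.intro vector_space_scale_linf)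
      (use assms a in \<open>auto simp: agree_def Delta_add Delta_scale\<close>)
  then show ?thesis by (rule delta_map.hereditarily_l2_image)
qed

lemma hereditarily_l2_Delta2:
  assumes "{a, b} \<subseteq> {0, 1, 2}" "B \<subseteq> {0, 1, 2}"
  shows "image_hereditarily_l2 scale_linf2 (Delta2 a b) (ker_all B)"
proof -
  have a: "a \<le> 2" "b \<le> 2" using assms by auto
  have "delta_map scale_linf2 (Delta2 a b) {a, b} B"
    by (intro delta_map.intro delta_map_axioms.intro vector_space_scale_linf2)
      (use assms a in \<open>auto simp: agree_def Delta2_def Delta_add Delta_scale scale_linf2_Pair\<close>)
  then show ?thesis by (rule delta_map.hereditarily_l2_image)
qed

lemma hereditarily_l2_Delta3:
  assumes "{a, b, c} \<subseteq> {0, 1, 2}" "B \<subseteq> {0, 1, 2}"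
  shows "image_hereditarily_l2 scale_linf3 (Delta3 a b c) (ker_all B)"
proof -
  have a: "a \<le> 2" "b \<le> 2" "c \<le> 2" using assms by auto
  have "delta_map scale_linf3 (Delta3 a b c) {a, b, c} B"
    by (intro delta_map.intro delta_map_axioms.intro vector_space_scale_linf3)
      (use assms a in \<open>auto simp: agree_def Delta3_def Delta_add Delta_scale scale_linf3_Pair\<close>)
  then show ?thesis by (rule delta_map.hereditarily_l2_image)
qed

text \<open>Equality with a set of three elements forces \<open>a\<close>, \<open>b\<close>,
  \<open>c\<close> to be distinct, so the hypothesis says that they form a permutation.\<close>

theorem proposition7p1:
  fixes a b c :: nat
  assumes "{a, b, c} = {2, 1, 0}"
  shows "image_hereditarily_l2 scale_linf (Delta a) (ker_Delta b \<inter> ker_Delta c)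
    \<and> image_hereditarily_l2 scale_linf2 (Delta2 a b) (ker_Delta c)
    \<and> image_hereditarily_l2 scale_linf3 (Delta3 a b c) calderon
    \<and> image_hereditarily_l2 scale_linf (Delta b) (ker_Delta c)
    \<and> image_hereditarily_l2 scale_linf2 (Delta2 b c) calderon
    \<and> image_hereditarily_l2 scale_linf (Delta c) calderon"
proof -
  have abc: "a \<in> {0, 1, 2}" "b \<in> {0, 1, 2}" "c \<in> {0, 1, 2}" using assms by auto
  have k: "ker_Delta b \<inter> ker_Delta c = ker_all {b, c}" "ker_Delta c = ker_all {c}" "calderon = ker_all {}"
    by (auto simp: ker_Delta_def ker_all_def)
  show ?thesis
    unfolding k(1) unfolding k(2,3)
  proof (intro conjI)
    show "image_hereditarily_l2 scale_linf (Delta a) (ker_all {b, c})"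
      "image_hereditarily_l2 scale_linf (Delta b) (ker_all {c})"
      "image_hereditarily_l2 scale_linf (Delta c) (ker_all {})"
      using abc by (intro hereditarily_l2_Delta; simp)+
    show "image_hereditarily_l2 scale_linf2 (Delta2 a b) (ker_all {c})"
      "image_hereditarily_l2 scale_linf2 (Delta2 b c) (ker_all {})"
      using abc by (intro hereditarily_l2_Delta2; simp)+
    show "image_hereditarily_l2 scale_linf3 (Delta3 a b c) (ker_all {})"
      using abc by (intro hereditarily_l2_Delta3; simp)
  qed
qed

end
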